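(* Let $n\geq 2$, let $K\subset\mathbb{R}^n$ be a compact convex set with $o\in\operatorname{int}K$, let $E_1,\ldots,E_k$ be linear subspaces of $\mathbb{R}^n$ with $\dim E_i=n_i\in\{1,\ldots,n-1\}$, and let $c_1,\ldots,c_k>0$ be real numbers such that $$\sum_{i=1}^k c_iP_{E_i}=I_n .$$ Then equality $$|K|= \frac{\prod_{i=1}^k(n_i!)^{c_i}}{n!}\cdot \prod_{i=1}^k\left |K\cap E_i\right |^{c_i}$$ holds if and only if both of the following hold: (i) $\oplus_{j=1}^\ell F_j=\mathbb{R}^n$, where $F_1,\ldots,F_\ell\subset\mathbb{R}^n$ are the (distinct) independent subspaces associated with $E_1,\ldots,E_k$; and (ii) $K=\operatorname{conv}\{K\cap F_j\}_{j=1}^\ell$, that is, $K$ is the convex hull of $\bigcup_{j=1}^\ell (K\cap F_j)$.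
   Context: $o$ is the origin of $\mathbb{R}^n$, $P_E$ denotes the orthogonal projection of $\mathbb{R}^n$ onto a linear subspace $E$, and $I_n$ is the identity map on $\mathbb{R}^n$. For a compact set $X\subset\mathbb{R}^n$ whose affine hull has dimension $m$, $|X|$ denotes its $m$-dimensional Lebesgue measure (so $|K\cap E_i|$ is $n_i$-dimensional volume in $E_i$). Independent subspaces: given linear subspaces $E_1,\ldots,E_k$ of $\mathbb{R}^n$ with $\dim E_i=n_i\in\{1,\ldots,n-1\}$ for which $\sum_{i=1}^k c_iP_{E_i}=I_n$ with real numbers $c_1,\ldots,c_k>0$, a linear subspace $F$ is called an independent subspace (associated with $E_1,\ldots,E_k$) if $\dim F\geq 1$ and $F=\bigcap_{i=1}^kE_{i,0}$, where for each $i=1,\ldots,k$ either $E_{i,0}=E_i$ or $E_{i,0}=E_i^\perp$. There may exist no independent subspace at all (in which case condition (i) fails, the empty direct sum being $\{o\}$). Distinct independent subspaces are pairwise orthogonal. *)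

theory Defs
  imports "HOL-Analysis.Analysis"
begin

definition orth_proj :: "'a::euclidean_space set \<Rightarrow> 'a \<Rightarrow> 'a" where
  "orth_proj E x = (THE y. y \<in> E \<and> x - y \<in> E\<^sup>\<bottom>)"

lemma orth_proj_ex1:
  fixes E :: "'a::euclidean_space set"
  assumes "subspace E"
  shows "\<exists>!y. y \<in> E \<and> x - y \<in> E\<^sup>\<bottom>"
proof -
  obtain y z where yz: "y \<in> span E" "\<And>w. w \<in> span E \<Longrightarrow> orthogonal z w" "x = y + z"
    using orthogonal_subspace_decomp_exists[of E x] by metis
  have E: "span E = E"
    using assms by (simp add: span_eq_iff)
  have 1: "y \<in> E \<and> x - y \<in> E\<^sup>\<bottom>"
    using yz E by (auto simp: orthogonal_comp_def orthogonal_commute)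
  have 2: "u = y" if u: "u \<in> E" "x - u \<in> E\<^sup>\<bottom>" for u
  proof -
    have "u - y \<in> E"
      using u 1 assms by (simp add: subspace_diff)
    moreover have "(x - y) - (x - u) \<in> E\<^sup>\<bottom>"
      using u 1 subspace_orthogonal_comp subspace_diff by blast
    ultimately have "orthogonal (u - y) (u - y)"
      by (simp add: orthogonal_comp_def)
    then show ?thesis
      by (simp add: orthogonal_self)
  qed
  show ?thesis
    using 1 2 by blast
qed

definition orthonormal_basis_of :: "'a::euclidean_space set \<Rightarrow> 'a set \<Rightarrow> bool" where
  "orthonormal_basis_of E B \<longleftrightarrow>
     B \<subseteq> E \<and> pairwise orthogonal B \<and> (\<forall>b\<in>B. norm b = 1) \<and> span B = E"

lemma orthonormal_basis_of_exists:
  fixes E :: "'a::euclidean_space set"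
  assumes "subspace E"
  shows "\<exists>B. orthonormal_basis_of E B \<and> finite B \<and> card B = dim E"
proof -
  obtain B where "B \<subseteq> E" "pairwise orthogonal B" "\<And>x. x \<in> B \<Longrightarrow> norm x = 1"
    "independent B" "card B = dim E" "span B = E"
    using orthonormal_basis_subspace[OF assms] by metis
  then show ?thesis
    unfolding orthonormal_basis_of_def
    by (intro exI[of _ B]) (auto intro: independent_imp_finite)
qed

text \<open>
  The \<open>dim E\<close>-dimensional Lebesgue measure on a linear subspace \<open>E\<close>, regarded as a measure on the
  ambient space: Lebesgue measure on the coordinates with respect to an orthonormal basis of
  \<open>E\<close>. This is how the library builds \<^const>\<open>lborel\<close> from the standard basis. Rotation
  invariance of Lebesgue measure makes the choice of the basis immaterial.
\<close>
definition subspace_lborel :: "'a::euclidean_space set \<Rightarrow> 'a measure" where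
  "subspace_lborel E =
     (let B = (SOME B. orthonormal_basis_of E B)
      in distr (\<Pi>\<^sub>M b\<in>B. lborel) borel (\<lambda>f. \<Sum>b\<in>B. f b *\<^sub>R b))"

definition independent_subspace ::
    "nat \<Rightarrow> (nat \<Rightarrow> 'a::euclidean_space set) \<Rightarrow> 'a set \<Rightarrow> bool" where
  "independent_subspace k E F \<longleftrightarrow>
     1 \<le> dim F \<and>
     (\<exists>E0. (\<forall>i\<in>{1..k}. E0 i = E i \<or> E0 i = (E i)\<^sup>\<bottom>) \<and> F = (\<Inter>i\<in>{1..k}. E0 i))"

text \<open>
  \<open>V\<close> is the internal direct sum of the members of \<open>\<F>\<close>: every element of \<open>V\<close> is a sum of
  components, one from each member, in exactly one way, and all such sums lie in \<open>V\<close>.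
  The direct sum of the empty family is \<open>{0}\<close>.
\<close>
definition is_direct_sum :: "'a::real_vector set set \<Rightarrow> 'a set \<Rightarrow> bool" where
  "is_direct_sum \<F> V \<longleftrightarrow>
     finite \<F> \<and> bij_betw (\<lambda>f. \<Sum>F\<in>\<F>. f F) (\<Pi>\<^sub>E F\<in>\<F>. F) V"

end

theory Submission
  imports Defs "HOL-Probability.Probability"
begin

text \<open>
  Let \<open>N\<close> be the gauge of \<open>K\<close> and \<open>P\<^sub>i\<close> the projection onto \<open>E\<^sub>i\<close>. Since
  \<open>n! |K|\<close> and \<open>n\<^sub>i! |K \<inter> E\<^sub>i|\<close> are the integrals of \<open>exp (- N)\<close> over the space and
  over \<open>E\<^sub>i\<close>, both can be read off the heat flow at the origin as time tends to infinity. Let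
  \<open>U(t)\<close> and \<open>V\<^sub>i(t)\<close> be the logarithms of the heat flows started at \<open>exp (- N)\<close> and at
  \<open>exp (- N \<circ> P\<^sub>i)\<close>. By a maximum principle the deficit
  \<open>U(t, \<Sum>\<^sub>i c\<^sub>i P\<^sub>i x\<^sub>i) - \<Sum>\<^sub>i c\<^sub>i V\<^sub>i(t, x\<^sub>i)\<close> stays nonnegative; letting
  \<open>t\<close> tend to infinity gives the volume inequality.

  If equality holds, then for every \<open>t > 0\<close> the deficit vanishes somewhere on each fibre
  \<open>\<Sum>\<^sub>i c\<^sub>i P\<^sub>i x\<^sub>i = z\<close>: otherwise a small bump could be subtracted from \<open>U(t)\<close> and the
  inequality would fail for the smaller function. At such a zero the time derivative vanishes, so the
  Hessian of the deficit is positive semidefinite with trace zero on the diagonal; hence it annihilates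
  the diagonal, which means that the Hessian of \<open>U(t)\<close> at \<open>z\<close> has no mixed terms between
  \<open>E\<^sub>i\<close> and its orthogonal complement. Therefore \<open>U(t)\<close> splits along this decomposition, and as
  \<open>t\<close> tends to \<open>0\<close> so does \<open>N\<close>. Then every extreme point of \<open>K\<close> lies, for each
  \<open>i\<close>, in \<open>E\<^sub>i\<close> or in its complement, that is, in an independent subspace, and the
  Krein-Milman theorem gives (i) and (ii). Conversely, (i) and (ii) make \<open>N\<close> a sum over the
  independent subspaces, and the heat flow factorizes.
\<close>

subsection \<open>Lebesgue measure on subspaces\<close>

text \<open>The gauge is only Lipschitz, so second derivatives are available at positive times only;
  every derivative of the flow is therefore written as a moment of the Gaussian measure tilted by
  \<open>exp u\<close>, and \<open>u\<close> itself is never differentiated. The logarithm f of a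
  heat flow satisfies df/dt = (Laplacian f + |grad f|^2) / 2. The quadratic terms of the deficit do
  not cancel outright, but the identity |p|^2 = sum c_i |P_i p|^2 makes them a combination of first
  derivatives of the deficit, and so a maximum principle applies. Compactness is missing twice: the
  points x_i range over the whole space, which a quadratic penalty repairs, and a zero on a fibre
  has to be attained, which the linear growth of the gauge ensures. Equality of volumes speaks about
  infinite time only. It is brought back to time t by restarting the flow at t: the kernels
  normalised by powers of sqrt (2 pi s) increase with s at the origin, so a bump removed at time t
  costs a fixed positive amount in the limit. A zero is needed on every fibre because the Hessian
  has to be known at every z.\<close>

lemma nn_integral_lborel_translate:
  fixes a :: "'a::euclidean_space" and h :: "'a \<Rightarrow> ennreal"
  assumes [measurable]: "h \<in> borel_measurable borel"
  shows "(\<integral>\<^sup>+x. h (a + x) \<partial>lborel) = (\<integral>\<^sup>+x. h x \<partial>lborel)"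
proof -
  have "(\<integral>\<^sup>+x. h x \<partial>lborel) = (\<integral>\<^sup>+x. h x \<partial>distr lborel borel ((+) a))"
    by (simp add: lborel_distr_plus)
  also have "\<dots> = (\<integral>\<^sup>+x. h (a + x) \<partial>lborel)"
    by (subst nn_integral_distr) auto
  finally show ?thesis by simp
qed

lemma nn_integral_lborel_scale:
  fixes h :: "'a::euclidean_space \<Rightarrow> ennreal"
  assumes [measurable]: "h \<in> borel_measurable borel" and r: "r > 0"
  shows "(\<integral>\<^sup>+x. h (r *\<^sub>R x) \<partial>lborel) = ennreal (1 / r ^ DIM('a)) * (\<integral>\<^sup>+x. h x \<partial>lborel)"
proof -
  have "(\<integral>\<^sup>+x. h x \<partial>lborel) = (\<integral>\<^sup>+x. h x \<partial>density (distr lborel borel (\<lambda>x. 0 + r *\<^sub>R x)) (\<lambda>_. ennreal (\<bar>r\<bar>^DIM('a))))"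
    using lborel_affine[of r "0::'a"] r by simp
  also have "\<dots> = ennreal (r^DIM('a)) * (\<integral>\<^sup>+x. h (r *\<^sub>R x) \<partial>lborel)"
    using r by (simp add: nn_integral_density nn_integral_cmult nn_integral_distr)
  finally show ?thesis
    using r by (simp add: mult.assoc[symmetric] flip: ennreal_mult)
qed

text \<open>Multiply by the mass \<open>v\<close> of the unit ball, written as the integral of its
  indicator \<open>b\<close>, and evaluate the double integral of \<open>b y * h (T x + y)\<close>.
  Translation invariance moves the shift by \<open>T x\<close> into \<open>b\<close>, and
  \<open>b (y - T x)\<close> integrates to \<open>v\<close> over \<open>x\<close> because an
  isometry preserves balls.\<close>

lemma nn_integral_lborel_isometry:
  fixes T :: "'a::euclidean_space \<Rightarrow> 'a" and h :: "'a \<Rightarrow> ennreal"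
  assumes T: "linear T" "\<And>x. norm (T x) = norm x" and h[measurable]: "h \<in> borel_measurable borel"
  shows "(\<integral>\<^sup>+x. h (T x) \<partial>lborel) = (\<integral>\<^sup>+x. h x \<partial>lborel)"
proof -
  have "orthogonal_transformation T"
    using T by (simp add: orthogonal_transformation)
  then have "surj T" by (rule orthogonal_transformation_surj)
  define S where "S = inv T"
  have TS: "T (S y) = y" for y
    unfolding S_def using \<open>surj T\<close> by (rule surj_f_inv_f)
  have [measurable]: "T \<in> borel_measurable borel"
    using T(1) by (intro borel_measurable_continuous_onI linear_continuous_on linear_conv_bounded_linear[THEN iffD1])
  define b :: "'a \<Rightarrow> ennreal" where "b = indicator (ball 0 1)"
  have [measurable]: "b \<in> borel_measurable borel" unfolding b_def by (intro borel_measurable_indicator) simp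
  have b_cong: "b x = b y" if "norm x = norm y" for x y
    using that by (auto simp: b_def indicator_def)
  define v where "v = (\<integral>\<^sup>+x. b x \<partial>lborel)"
  have v: "v = emeasure lborel (ball (0::'a) 1)" by (simp add: v_def b_def)
  have v0: "v \<noteq> 0"
  proof
    assume "v = 0"
    then have "negligible (ball (0::'a) 1)"
      unfolding negligible_iff_null_sets v by (intro null_sets_completionI null_setsI) auto
    then show False using open_not_negligible[of "ball (0::'a) 1"] by simp
  qed
  have vfin: "v \<noteq> \<infinity>"
    unfolding v using emeasure_lborel_ball_finite[of "0::'a" 1] by simp
  have *: "(\<integral>\<^sup>+x. b (y - T x) \<partial>lborel) = v" for y
  proof -
    have "b (y - T x) = b (- S y + x)" for x
    proof (rule b_cong)
      have "y - T x = T (S y - x)" using T(1) by (simp add: TS linear_diff)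
      then show "norm (y - T x) = norm (- S y + x)"
        by (simp add: T(2) norm_minus_commute)
    qed
    then have "(\<integral>\<^sup>+x. b (y - T x) \<partial>lborel) = (\<integral>\<^sup>+x. b (- S y + x) \<partial>lborel)"
      by (intro nn_integral_cong)
    also have "\<dots> = v" unfolding v_def by (rule nn_integral_lborel_translate) simp
    finally show ?thesis .
  qed
  have "v * (\<integral>\<^sup>+x. h (T x) \<partial>lborel) = (\<integral>\<^sup>+y. b y * (\<integral>\<^sup>+x. h (T x) \<partial>lborel) \<partial>lborel)"
    unfolding v_def by (simp add: nn_integral_multc)
  also have "\<dots> = (\<integral>\<^sup>+y. \<integral>\<^sup>+x. b y * h (T x + y) \<partial>lborel \<partial>lborel)"
  proof (rule nn_integral_cong)
    fix y :: 'a
    have "(\<integral>\<^sup>+x. h (T x) \<partial>lborel) = (\<integral>\<^sup>+x. h (T (S y + x)) \<partial>lborel)"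
      by (rule nn_integral_lborel_translate[symmetric]) simp
    also have "\<dots> = (\<integral>\<^sup>+x. h (T x + y) \<partial>lborel)"
      using T(1) by (simp add: linear_add TS add.commute)
    finally show "b y * (\<integral>\<^sup>+x. h (T x) \<partial>lborel) = (\<integral>\<^sup>+x. b y * h (T x + y) \<partial>lborel)"
      by (simp add: nn_integral_cmult)
  qed
  also have "\<dots> = (\<integral>\<^sup>+x. \<integral>\<^sup>+y. b y * h (T x + y) \<partial>lborel \<partial>lborel)"
    by (rule lborel_pair.Fubini') simp
  also have "\<dots> = (\<integral>\<^sup>+x. \<integral>\<^sup>+y. b (y - T x) * h y \<partial>lborel \<partial>lborel)"
  proof (rule nn_integral_cong)
    fix x :: 'a
    have "(\<integral>\<^sup>+y. b y * h (T x + y) \<partial>lborel) = (\<integral>\<^sup>+y. (\<lambda>z. b (z - T x) * h z) (T x + y) \<partial>lborel)"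
      by simp
    also have "\<dots> = (\<integral>\<^sup>+y. b (y - T x) * h y \<partial>lborel)"
      by (rule nn_integral_lborel_translate) measurable
    finally show "(\<integral>\<^sup>+y. b y * h (T x + y) \<partial>lborel) = (\<integral>\<^sup>+y. b (y - T x) * h y \<partial>lborel)" .
  qed
  also have "\<dots> = (\<integral>\<^sup>+y. \<integral>\<^sup>+x. b (y - T x) * h y \<partial>lborel \<partial>lborel)"
    by (rule lborel_pair.Fubini'[symmetric]) simp
  also have "\<dots> = (\<integral>\<^sup>+y. v * h y \<partial>lborel)"
    by (simp add: nn_integral_multc *)
  also have "\<dots> = v * (\<integral>\<^sup>+y. h y \<partial>lborel)"
    by (simp add: nn_integral_cmult)
  finally show ?thesis
    using v0 vfin by (simp add: ennreal_mult_cancel_left)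
qed

lemma orthonormal_basis_ofD:
  fixes E :: "'a::euclidean_space set"
  assumes "orthonormal_basis_of E B"
  shows "finite B" "independent B" "card B = dim E" "subspace E" "B \<subseteq> E" "span B = E"
    and "\<And>b c. b \<in> B \<Longrightarrow> c \<in> B \<Longrightarrow> b \<bullet> c = (if b = c then 1 else 0)"
proof -
  have "0 \<notin> B" using assms by (force simp: orthonormal_basis_of_def)
  then show i: "independent B"
    using assms pairwise_orthogonal_independent by (auto simp: orthonormal_basis_of_def)
  then show "finite B" by (rule independent_imp_finite)
  show "span B = E" "B \<subseteq> E" using assms by (auto simp: orthonormal_basis_of_def)
  then show "subspace E" by auto
  show "card B = dim E" using i \<open>span B = E\<close> dim_span_eq_card_independent by metis
  show "b \<bullet> c = (if b = c then 1 else 0)" if "b \<in> B" "c \<in> B" for b c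
    using that assms unfolding orthonormal_basis_of_def pairwise_def orthogonal_def
    by (auto simp: norm_eq_1)
qed

text \<open>\<open>subspace_lborel\<close> hides its basis behind a choice. With the basis as a
  parameter, bases can be compared and united.\<close>

definition onb_measure :: "'a::euclidean_space set \<Rightarrow> 'a measure" where
  "onb_measure B = distr (\<Pi>\<^sub>M b\<in>B. lborel) borel (\<lambda>f. \<Sum>b\<in>B. f b *\<^sub>R b)"

lemma sets_onb_measure [simp, measurable_cong]: "sets (onb_measure B) = sets borel"
  by (simp add: onb_measure_def)

lemma nn_integral_onb_measure:
  fixes h :: "'a::euclidean_space \<Rightarrow> ennreal"
  assumes [measurable]: "h \<in> borel_measurable borel"
  shows "(\<integral>\<^sup>+x. h x \<partial>onb_measure B) = (\<integral>\<^sup>+f. h (\<Sum>b\<in>B. f b *\<^sub>R b) \<partial>(\<Pi>\<^sub>M b\<in>B. lborel))"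
  unfolding onb_measure_def by (subst nn_integral_distr) auto

interpretation lborel_PiM: product_sigma_finite "\<lambda>_::'i. lborel :: real measure"
  by standard

lemma nn_integral_PiM_lborel_scale:
  fixes F :: "('i \<Rightarrow> real) \<Rightarrow> ennreal"
  assumes "finite B" "F \<in> borel_measurable (\<Pi>\<^sub>M b\<in>B. lborel)" and r: "r > 0"
  shows "(\<integral>\<^sup>+f. F (\<lambda>b\<in>B. r * f b) \<partial>(\<Pi>\<^sub>M b\<in>B. lborel))
    = ennreal (1 / r ^ card B) * (\<integral>\<^sup>+f. F f \<partial>(\<Pi>\<^sub>M b\<in>B. lborel))"
  using assms(1,2)
proof (induction B arbitrary: F rule: finite_induct)
  case empty
  then show ?case by (simp add: PiM_empty nn_integral_count_space_finite)
next
  case (insert a B)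
  note [measurable] = insert.prems
  define G where "G y = (\<integral>\<^sup>+f. F (f(a := y)) \<partial>(\<Pi>\<^sub>M b\<in>B. lborel))" for y
  interpret sigma_finite_measure "\<Pi>\<^sub>M b\<in>B. (lborel::real measure)"
    using insert by (intro lborel_PiM.sigma_finite)
  have [measurable]: "G \<in> borel_measurable borel"
    unfolding G_def by measurable
  have eq: "(\<lambda>b\<in>insert a B. r * (f(a := y)) b) = (\<lambda>b\<in>B. r * f b)(a := r * y)" for f y
    using insert.hyps by (auto simp: fun_eq_iff)
  have "(\<integral>\<^sup>+f. F (\<lambda>b\<in>insert a B. r * f b) \<partial>(\<Pi>\<^sub>M b\<in>insert a B. lborel))
     = (\<integral>\<^sup>+y. \<integral>\<^sup>+f. F (\<lambda>b\<in>insert a B. r * (f(a := y)) b) \<partial>(\<Pi>\<^sub>M b\<in>B. lborel) \<partial>lborel)"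
    using insert by (subst lborel_PiM.product_nn_integral_insert_rev) auto
  also have "\<dots> = (\<integral>\<^sup>+y. \<integral>\<^sup>+f. F ((\<lambda>b\<in>B. r * f b)(a := r * y)) \<partial>(\<Pi>\<^sub>M b\<in>B. lborel) \<partial>lborel)"
    unfolding eq ..
  also have "\<dots> = (\<integral>\<^sup>+y. ennreal (1 / r ^ card B) * G (r * y) \<partial>lborel)"
    unfolding G_def by (intro nn_integral_cong insert.IH[where F="\<lambda>f. F (f(a := c))" for c]) simp
  also have "\<dots> = ennreal (1 / r ^ card B) * (\<integral>\<^sup>+y. G (r *\<^sub>R y) \<partial>lborel)"
    by (subst nn_integral_cmult) auto
  also have "\<dots> = ennreal (1 / r ^ card (insert a B)) * (\<integral>\<^sup>+y. G y \<partial>lborel)"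
  proof -
    have "ennreal (1 / r ^ card (insert a B)) = ennreal (1 / r ^ card B) * ennreal (1 / r ^ DIM(real))"
      using insert.hyps r by (subst ennreal_mult[symmetric]) (auto simp: field_simps)
    then show ?thesis using r by (subst nn_integral_lborel_scale) (simp_all add: mult.assoc)
  qed
  also have "(\<integral>\<^sup>+y. G y \<partial>lborel) = (\<integral>\<^sup>+f. F f \<partial>(\<Pi>\<^sub>M b\<in>insert a B. lborel))"
    unfolding G_def using insert by (subst lborel_PiM.product_nn_integral_insert_rev) auto
  finally show ?case .
qed

lemma distr_PiM_lborel_reindex:
  assumes s: "bij_betw s A B" and A: "finite A"
  shows "distr (\<Pi>\<^sub>M b\<in>B. (lborel::real measure)) (\<Pi>\<^sub>M a\<in>A. lborel) (\<lambda>f. \<lambda>a\<in>A. f (s a)) = (\<Pi>\<^sub>M a\<in>A. lborel)"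
proof (rule lborel_PiM.PiM_eqI[OF A])
  have B: "finite B" using s A bij_betw_finite by blast
  have sA: "s a \<in> B" if "a \<in> A" for a using s that by (auto simp: bij_betw_def)
  have [measurable]: "(\<lambda>f. \<lambda>a\<in>A. f (s a)) \<in> measurable (\<Pi>\<^sub>M b\<in>B. (lborel::real measure)) (\<Pi>\<^sub>M a\<in>A. lborel)"
    by (rule measurable_restrict) (use sA in auto)
  fix X assume X: "\<And>i. i \<in> A \<Longrightarrow> X i \<in> sets (lborel::real measure)"
  have "(\<lambda>f. \<lambda>a\<in>A. f (s a)) -` Pi\<^sub>E A X \<inter> space (\<Pi>\<^sub>M b\<in>B. (lborel::real measure))
      = Pi\<^sub>E B (\<lambda>b. X (inv_into A s b))"
    using s by (auto simp: space_PiM PiE_iff bij_betw_def inv_into_f_f extensional_def f_inv_into_f inv_into_into)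
  moreover have "Pi\<^sub>E A X \<in> sets (\<Pi>\<^sub>M a\<in>A. (lborel::real measure))"
    using X A by (intro sets_PiM_I_finite)
  ultimately have "emeasure (distr (\<Pi>\<^sub>M b\<in>B. (lborel::real measure)) (\<Pi>\<^sub>M a\<in>A. lborel) (\<lambda>f. \<lambda>a\<in>A. f (s a))) (Pi\<^sub>E A X)
      = emeasure (\<Pi>\<^sub>M b\<in>B. (lborel::real measure)) (Pi\<^sub>E B (\<lambda>b. X (inv_into A s b)))"
    by (subst emeasure_distr) auto
  also have "\<dots> = (\<Prod>b\<in>B. emeasure lborel (X (inv_into A s b)))"
    using s X B by (intro lborel_PiM.emeasure_PiM) (auto simp: bij_betw_def inv_into_into)
  also have "\<dots> = (\<Prod>a\<in>A. emeasure lborel (X a))"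
    using s by (subst prod.reindex_bij_betw[OF s, symmetric]) (auto simp: bij_betw_def inv_into_f_f intro!: prod.cong)
  finally show "emeasure (distr (\<Pi>\<^sub>M b\<in>B. (lborel::real measure)) (\<Pi>\<^sub>M a\<in>A. lborel) (\<lambda>f. \<lambda>a\<in>A. f (s a))) (Pi\<^sub>E A X)
      = (\<Prod>a\<in>A. emeasure lborel (X a))" .
qed simp

text \<open>A bijection from the standard basis to \<open>B\<close> extends linearly to an isometry
  \<open>T\<close>, which carries \<open>lborel\<close> to \<open>onb_measure B\<close>; invariance
  under isometries then removes the dependence on the basis.\<close>

lemma onb_measure_UNIV:
  fixes B :: "'a::euclidean_space set"
  assumes B: "orthonormal_basis_of UNIV B"
  shows "onb_measure B = lborel"
proof -
  note BD = orthonormal_basis_ofD[OF B]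
  have "card B = card (Basis::'a set)" using BD(3) by simp
  then obtain s where s: "bij_betw s (Basis::'a set) B"
    using BD(1) finite_Basis by (metis finite_same_card_bij)
  define T where "T x = (\<Sum>b\<in>Basis. (x \<bullet> b) *\<^sub>R s b)" for x :: 'a
  have lin: "linear T"
    unfolding T_def by (intro linearI) (simp_all add: algebra_simps sum.distrib scaleR_sum_right)
  have sB: "s a \<in> B" if "a \<in> Basis" for a using s that by (auto simp: bij_betw_def)
  have ss: "s a \<bullet> s b = (if a = b then 1 else 0)" if "a \<in> Basis" "b \<in> Basis" for a b
    using s that BD(7)[OF sB sB] by (auto simp: bij_betw_def inj_on_def)
  have TT: "T x \<bullet> T x = x \<bullet> x" for x
  proof -
    have *: "s a \<bullet> T x = x \<bullet> a" if "a \<in> Basis" for a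
    proof -
      have "s a \<bullet> T x = (\<Sum>b\<in>Basis. (x \<bullet> b) * (s a \<bullet> s b))"
        unfolding T_def by (simp add: inner_sum_right)
      also have "\<dots> = (\<Sum>b\<in>Basis. if a = b then x \<bullet> b else 0)"
        using that by (intro sum.cong) (auto simp: ss)
      finally show ?thesis using that by simp
    qed
    have "T x \<bullet> T x = (\<Sum>a\<in>Basis. (x \<bullet> a) * (s a \<bullet> T x))"
      by (subst T_def) (simp add: inner_sum_left)
    also have "\<dots> = (\<Sum>a\<in>Basis. (x \<bullet> a) * (x \<bullet> a))"
      by (simp add: *)
    also have "\<dots> = x \<bullet> x" by (subst euclidean_inner[of x x]) simp
    finally show ?thesis .
  qed
  then have nT: "norm (T x) = norm x" for x by (simp add: norm_eq_sqrt_inner)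
  have [measurable]: "T \<in> borel_measurable borel"
    using lin by (intro borel_measurable_continuous_onI linear_continuous_on linear_conv_bounded_linear[THEN iffD1])
  have "emeasure (onb_measure B) X = emeasure lborel X" if X[measurable]: "X \<in> sets borel" for X
  proof -
    have *: "(\<Sum>b\<in>B. f b *\<^sub>R b) = T (\<Sum>a\<in>Basis. f (s a) *\<^sub>R a)" for f
    proof -
      have "(\<Sum>b\<in>B. f b *\<^sub>R b) = (\<Sum>a\<in>Basis. f (s a) *\<^sub>R s a)"
        using sum.reindex_bij_betw[OF s, of "\<lambda>b. f b *\<^sub>R b"] by simp
      then show ?thesis unfolding T_def by simp
    qed
    have meas: "(\<lambda>f. \<lambda>a\<in>(Basis::'a set). f (s a)) \<in> measurable (\<Pi>\<^sub>M b\<in>B. (lborel::real measure)) (\<Pi>\<^sub>M a\<in>Basis. lborel)"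
      by (rule measurable_restrict) (use sB in auto)
    have "(\<integral>\<^sup>+x. indicator X x \<partial>onb_measure B)
        = (\<integral>\<^sup>+f. indicator X (T (\<Sum>a\<in>Basis. f (s a) *\<^sub>R a)) \<partial>(\<Pi>\<^sub>M b\<in>B. lborel))"
      by (subst nn_integral_onb_measure) (auto simp: *)
    also have "\<dots> = (\<integral>\<^sup>+f. indicator X (T (\<Sum>a\<in>Basis. (\<lambda>a\<in>(Basis::'a set). f (s a)) a *\<^sub>R a)) \<partial>(\<Pi>\<^sub>M b\<in>B. lborel))"
      by simp
    also have "\<dots> = (\<integral>\<^sup>+f. indicator X (T (\<Sum>a\<in>Basis. f a *\<^sub>R a)) \<partial>(\<Pi>\<^sub>M b\<in>Basis. lborel))"
      using nn_integral_distr[OF meas, of "\<lambda>f. indicator X (T (\<Sum>a\<in>Basis. f a *\<^sub>R a))"]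
      unfolding distr_PiM_lborel_reindex[OF s finite_Basis] by simp
    also have "\<dots> = (\<integral>\<^sup>+x. indicator X (T x) \<partial>onb_measure Basis)"
      by (subst nn_integral_onb_measure) auto
    also have "\<dots> = (\<integral>\<^sup>+x. indicator X (T x) \<partial>lborel)"
      by (simp add: onb_measure_def flip: lborel_eq)
    also have "\<dots> = (\<integral>\<^sup>+x. indicator X x \<partial>lborel)"
      by (rule nn_integral_lborel_isometry[OF lin nT]) simp
    finally show ?thesis by simp
  qed
  then show ?thesis by (intro measure_eqI) simp_all
qed

section \<open>Orthogonal projections and integration along a subspace and its complement\<close>

lemma
  fixes E :: "'a::euclidean_space set"
  assumes E: "subspace E"
  shows orth_proj_in: "orth_proj E x \<in> E"
    and orth_proj_diff_in: "x - orth_proj E x \<in> E\<^sup>\<bottom>"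
    and orth_proj_unique: "y \<in> E \<Longrightarrow> x - y \<in> E\<^sup>\<bottom> \<Longrightarrow> orth_proj E x = y"
proof -
  have "orth_proj E x \<in> E \<and> x - orth_proj E x \<in> E\<^sup>\<bottom>"
    unfolding orth_proj_def by (rule theI'[OF orth_proj_ex1[OF E]])
  then show "orth_proj E x \<in> E" "x - orth_proj E x \<in> E\<^sup>\<bottom>" by auto
  then show "y \<in> E \<Longrightarrow> x - y \<in> E\<^sup>\<bottom> \<Longrightarrow> orth_proj E x = y"
    using orth_proj_ex1[OF E, of x] by blast
qed

lemma orth_comp_inner: "x \<in> E \<Longrightarrow> y \<in> E\<^sup>\<bottom> \<Longrightarrow> x \<bullet> y = 0"
  by (simp add: orthogonal_comp_def orthogonal_def)

lemma orth_comp_inner': "x \<in> E \<Longrightarrow> y \<in> E\<^sup>\<bottom> \<Longrightarrow> y \<bullet> x = 0"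
  by (simp add: orthogonal_comp_def orthogonal_def inner_commute)

context
  fixes E :: "'a::euclidean_space set"
  assumes E: "subspace E"
begin

lemma linear_orth_proj: "linear (orth_proj E)"
proof (rule linearI)
  show "orth_proj E (x + y) = orth_proj E x + orth_proj E y" for x y
  proof (rule orth_proj_unique[OF E])
    have "(x - orth_proj E x) + (y - orth_proj E y) \<in> E\<^sup>\<bottom>"
      by (intro subspace_add subspace_orthogonal_comp orth_proj_diff_in[OF E])
    then show "x + y - (orth_proj E x + orth_proj E y) \<in> E\<^sup>\<bottom>"
      by (simp add: algebra_simps)
  qed (intro subspace_add E orth_proj_in)
  show "orth_proj E (r *\<^sub>R x) = r *\<^sub>R orth_proj E x" for r x
  proof (rule orth_proj_unique[OF E])
    have "r *\<^sub>R (x - orth_proj E x) \<in> E\<^sup>\<bottom>"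
      by (intro subspace_scale subspace_orthogonal_comp orth_proj_diff_in[OF E])
    then show "r *\<^sub>R x - r *\<^sub>R orth_proj E x \<in> E\<^sup>\<bottom>"
      by (simp add: algebra_simps)
  qed (intro subspace_scale E orth_proj_in[OF E])
qed

lemma orth_proj_id: "x \<in> E \<Longrightarrow> orth_proj E x = x"
  by (rule orth_proj_unique[OF E]) (auto intro: subspace_0 subspace_orthogonal_comp)

lemma orth_proj_eq_0: "x \<in> E\<^sup>\<bottom> \<Longrightarrow> orth_proj E x = 0"
  by (rule orth_proj_unique[OF E]) (auto intro: subspace_0 E)

lemma orth_proj_proj [simp]: "orth_proj E (orth_proj E x) = orth_proj E x"
  by (rule orth_proj_id) (rule orth_proj_in[OF E])

lemma inner_orth_proj: "orth_proj E x \<bullet> y = orth_proj E x \<bullet> orth_proj E y"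
proof -
  have "orth_proj E x \<bullet> (y - orth_proj E y) = 0"
    by (rule orth_comp_inner[OF orth_proj_in[OF E] orth_proj_diff_in[OF E]])
  then show ?thesis by (simp add: inner_diff_right)
qed

lemma orth_proj_sym: "orth_proj E x \<bullet> y = x \<bullet> orth_proj E y"
  using inner_orth_proj[of x y] inner_orth_proj[of y x] by (metis inner_commute)

lemma norm_orth_proj_decomp: "(norm x)\<^sup>2 = (norm (orth_proj E x))\<^sup>2 + (norm (x - orth_proj E x))\<^sup>2"
proof -
  have "orthogonal (orth_proj E x) (x - orth_proj E x)"
    unfolding orthogonal_def by (rule orth_comp_inner[OF orth_proj_in[OF E] orth_proj_diff_in[OF E]])
  from norm_add_Pythagorean[OF this] show ?thesis by simp
qed

lemma norm_orth_proj_le: "norm (orth_proj E x) \<le> norm x"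
proof (rule power2_le_imp_le)
  show "(norm (orth_proj E x))\<^sup>2 \<le> (norm x)\<^sup>2"
    unfolding norm_orth_proj_decomp[of x] by simp
qed simp

end

lemma orth_proj_UNIV [simp]: "orth_proj UNIV x = x"
  by (rule orth_proj_id) auto

lemma borel_measurable_orth_proj [measurable]:
  fixes E :: "'a::euclidean_space set"
  assumes "subspace E"
  shows "orth_proj E \<in> borel_measurable borel"
  using linear_orth_proj[OF assms]
  by (simp add: borel_measurable_continuous_onI linear_continuous_on linear_conv_bounded_linear)

lemma subspace_lborel_obtain:
  fixes E :: "'a::euclidean_space set"
  assumes "subspace E"
  obtains B where "orthonormal_basis_of E B" "subspace_lborel E = onb_measure B"
proof
  show "orthonormal_basis_of E (SOME B. orthonormal_basis_of E B)"
    using orthonormal_basis_of_exists[OF assms] by (blast intro: someI_ex[where P="orthonormal_basis_of E"])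
  show "subspace_lborel E = onb_measure (SOME B. orthonormal_basis_of E B)"
    by (simp add: subspace_lborel_def onb_measure_def Let_def)
qed

lemma sets_subspace_lborel [simp, measurable_cong]: "sets (subspace_lborel E) = sets borel"
  by (simp add: subspace_lborel_def Let_def)

lemma space_subspace_lborel [simp]: "space (subspace_lborel E) = UNIV"
  by (simp add: subspace_lborel_def Let_def)

lemma subspace_lborel_UNIV: "subspace_lborel (UNIV :: 'a::euclidean_space set) = lborel"
  using onb_measure_UNIV by (metis subspace_UNIV subspace_lborel_obtain)

lemma onb_sum_in:
  assumes "orthonormal_basis_of E B"
  shows "(\<Sum>b\<in>B. f b *\<^sub>R b) \<in> E"
  using orthonormal_basis_ofD[OF assms] by (auto intro!: subspace_sum subspace_scale)

lemma onb_norm_sum: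
  assumes "orthonormal_basis_of E B"
  shows "(norm (\<Sum>b\<in>B. f b *\<^sub>R b))\<^sup>2 = (\<Sum>b\<in>B. (f b)\<^sup>2)"
proof -
  note BD = orthonormal_basis_ofD[OF assms]
  have "(norm (\<Sum>b\<in>B. f b *\<^sub>R b))\<^sup>2 = (\<Sum>b\<in>B. (norm (f b *\<^sub>R b))\<^sup>2)"
    using BD by (intro norm_sum_Pythagorean) (auto simp: pairwise_def orthogonal_def)
  also have "\<dots> = (\<Sum>b\<in>B. (f b)\<^sup>2)"
    using assms by (intro sum.cong) (auto simp: orthonormal_basis_of_def)
  finally show ?thesis .
qed

text \<open>The measure is the image of a product measure under a map with values in
  \<open>E\<close>, so integrands matter on \<open>E\<close> only.\<close>

lemma nn_integral_subspace_lborel_cong: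
  fixes E :: "'a::euclidean_space set" and g h :: "'a \<Rightarrow> ennreal"
  assumes E: "subspace E" and [measurable]: "g \<in> borel_measurable borel" "h \<in> borel_measurable borel"
    and eq: "\<And>x. x \<in> E \<Longrightarrow> g x = h x"
  shows "(\<integral>\<^sup>+x. g x \<partial>subspace_lborel E) = (\<integral>\<^sup>+x. h x \<partial>subspace_lborel E)"
proof -
  obtain B where B: "orthonormal_basis_of E B" "subspace_lborel E = onb_measure B"
    by (rule subspace_lborel_obtain[OF E])
  show ?thesis
    unfolding B(2) by (simp add: nn_integral_onb_measure eq onb_sum_in[OF B(1)])
qed

lemma nn_integral_subspace_lborel_scale:
  fixes E :: "'a::euclidean_space set" and h :: "'a \<Rightarrow> ennreal"
  assumes E: "subspace E" and [measurable]: "h \<in> borel_measurable borel" and r: "r > 0"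
  shows "(\<integral>\<^sup>+x. h (r *\<^sub>R x) \<partial>subspace_lborel E)
    = ennreal (1 / r ^ dim E) * (\<integral>\<^sup>+x. h x \<partial>subspace_lborel E)"
proof -
  obtain B where B: "orthonormal_basis_of E B" "subspace_lborel E = onb_measure B"
    by (rule subspace_lborel_obtain[OF E])
  note BD = orthonormal_basis_ofD[OF B(1)]
  have "(\<integral>\<^sup>+x. h (r *\<^sub>R x) \<partial>subspace_lborel E)
      = (\<integral>\<^sup>+f. h (\<Sum>b\<in>B. (\<lambda>b\<in>B. r * f b) b *\<^sub>R b) \<partial>(\<Pi>\<^sub>M b\<in>B. lborel))"
    unfolding B(2) by (subst nn_integral_onb_measure) (auto simp: scaleR_sum_right)
  also have "\<dots> = ennreal (1 / r ^ card B) * (\<integral>\<^sup>+f. h (\<Sum>b\<in>B. f b *\<^sub>R b) \<partial>(\<Pi>\<^sub>M b\<in>B. lborel))"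
    using BD(1) r by (intro nn_integral_PiM_lborel_scale[where F="\<lambda>f. h (\<Sum>b\<in>B. f b *\<^sub>R b)"]) auto
  finally show ?thesis
    unfolding B(2) BD(3) by (simp add: nn_integral_onb_measure)
qed

lemma sigma_finite_PiM_lborel: "finite B \<Longrightarrow> sigma_finite_measure (\<Pi>\<^sub>M b\<in>B. (lborel::real measure))"
  by (rule lborel_PiM.sigma_finite)

lemma orthonormal_basis_Un:
  fixes E :: "'a::euclidean_space set"
  assumes E: "subspace E" and B: "orthonormal_basis_of E B" and C: "orthonormal_basis_of (E\<^sup>\<bottom>) C"
  shows "orthonormal_basis_of UNIV (B \<union> C)" "B \<inter> C = {}"
proof -
  note BD = orthonormal_basis_ofD[OF B] and CD = orthonormal_basis_ofD[OF C]
  have o: "b \<bullet> c = 0" if "b \<in> B" "c \<in> C" for b c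
    using that BD(5) CD(5) by (intro orth_comp_inner[of _ E]) auto
  show "B \<inter> C = {}"
  proof (rule equals0I)
    fix b assume "b \<in> B \<inter> C"
    then show False using o[of b b] BD(7)[of b b] by simp
  qed
  have "x \<in> span (B \<union> C)" for x
  proof -
    have "orth_proj E x \<in> span (B \<union> C)"
      using orth_proj_in[OF E, of x] BD(6) span_mono[of B "B \<union> C"] by auto
    moreover have "x - orth_proj E x \<in> span (B \<union> C)"
      using orth_proj_diff_in[OF E, of x] CD(6) span_mono[of C "B \<union> C"] by auto
    ultimately have "orth_proj E x + (x - orth_proj E x) \<in> span (B \<union> C)"
      by (rule span_add)
    then show ?thesis by simp
  qed
  moreover have "norm b = 1" if "b \<in> B \<union> C" for b
    using that B C by (auto simp: orthonormal_basis_of_def)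
  moreover have "pairwise orthogonal (B \<union> C)"
  proof (rule pairwiseI)
    fix b c assume "b \<in> B \<union> C" "c \<in> B \<union> C" "b \<noteq> c"
    then show "orthogonal b c"
      unfolding orthogonal_def using o BD(7) CD(7) inner_commute[of b c] by auto
  qed
  ultimately show "orthonormal_basis_of UNIV (B \<union> C)"
    unfolding orthonormal_basis_of_def by blast
qed

text \<open>Orthonormal bases of \<open>E\<close> and of its complement unite to one of the whole
  space, so this is Fubini for a product over a disjoint union of index sets.\<close>

lemma nn_integral_lborel_split:
  fixes E :: "'a::euclidean_space set" and h :: "'a \<Rightarrow> ennreal"
  assumes E: "subspace E" and [measurable]: "h \<in> borel_measurable borel"
  shows "(\<integral>\<^sup>+x. h x \<partial>lborel) = (\<integral>\<^sup>+x. \<integral>\<^sup>+y. h (x + y) \<partial>subspace_lborel (E\<^sup>\<bottom>) \<partial>subspace_lborel E)"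
proof -
  obtain B where B: "orthonormal_basis_of E B" "subspace_lborel E = onb_measure B"
    by (rule subspace_lborel_obtain[OF E])
  obtain C where C: "orthonormal_basis_of (E\<^sup>\<bottom>) C" "subspace_lborel (E\<^sup>\<bottom>) = onb_measure C"
    by (rule subspace_lborel_obtain[OF subspace_orthogonal_comp])
  note BD = orthonormal_basis_ofD[OF B(1)] and CD = orthonormal_basis_ofD[OF C(1)]
  note U = orthonormal_basis_Un[OF E B(1) C(1)]
  interpret C: sigma_finite_measure "\<Pi>\<^sub>M b\<in>C. (lborel::real measure)"
    by (rule sigma_finite_PiM_lborel[OF CD(1)])
  have *: "(\<Sum>b\<in>B \<union> C. merge B C (f, g) b *\<^sub>R b) = (\<Sum>b\<in>B. f b *\<^sub>R b) + (\<Sum>b\<in>C. g b *\<^sub>R b)" for f g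
  proof -
    have "(\<Sum>b\<in>B. merge B C (f, g) b *\<^sub>R b) = (\<Sum>b\<in>B. f b *\<^sub>R b)"
      by (intro sum.cong) (auto simp: merge_def)
    moreover have "(\<Sum>b\<in>C. merge B C (f, g) b *\<^sub>R b) = (\<Sum>b\<in>C. g b *\<^sub>R b)"
      using U(2) by (intro sum.cong) (auto simp: merge_def)
    ultimately show ?thesis
      using U(2) BD(1) CD(1) by (simp add: sum.union_disjoint)
  qed
  have "(\<integral>\<^sup>+x. h x \<partial>lborel) = (\<integral>\<^sup>+f. h (\<Sum>b\<in>B \<union> C. f b *\<^sub>R b) \<partial>(\<Pi>\<^sub>M b\<in>B \<union> C. lborel))"
    unfolding onb_measure_UNIV[OF U(1), symmetric] by (subst nn_integral_onb_measure) auto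
  also have "\<dots> = (\<integral>\<^sup>+f. \<integral>\<^sup>+g. h ((\<Sum>b\<in>B. f b *\<^sub>R b) + (\<Sum>b\<in>C. g b *\<^sub>R b)) \<partial>(\<Pi>\<^sub>M b\<in>C. lborel) \<partial>(\<Pi>\<^sub>M b\<in>B. lborel))"
    using BD(1) CD(1) U(2) by (subst lborel_PiM.product_nn_integral_fold) (auto simp: *)
  also have "\<dots> = (\<integral>\<^sup>+x. \<integral>\<^sup>+g. h (x + (\<Sum>b\<in>C. g b *\<^sub>R b)) \<partial>(\<Pi>\<^sub>M b\<in>C. lborel) \<partial>onb_measure B)"
    by (subst nn_integral_onb_measure) (auto intro!: C.borel_measurable_nn_integral)
  also have "\<dots> = (\<integral>\<^sup>+x. \<integral>\<^sup>+y. h (x + y) \<partial>onb_measure C \<partial>onb_measure B)"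
    by (intro nn_integral_cong, subst nn_integral_onb_measure) auto
  finally show ?thesis unfolding B(2) C(2) .
qed

lemma nn_integral_gauss_real: "(\<integral>\<^sup>+x. ennreal (exp (- x\<^sup>2 / 2)) \<partial>lborel) = ennreal (sqrt (2 * pi))"
proof -
  have "(\<integral>\<^sup>+x. ennreal (exp (- x\<^sup>2 / 2)) \<partial>lborel)
      = (\<integral>\<^sup>+x. ennreal (sqrt (2 * pi)) * ennreal (std_normal_density x) \<partial>lborel)"
    by (intro nn_integral_cong) (simp add: std_normal_density_def flip: ennreal_mult)
  also have "\<dots> = ennreal (sqrt (2 * pi)) * (\<integral>\<^sup>+x. ennreal (std_normal_density x) \<partial>lborel)"
    by (simp add: nn_integral_cmult)
  also have "(\<integral>\<^sup>+x. ennreal (std_normal_density x) \<partial>lborel) = 1"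
    by (subst nn_integral_eq_integral) auto
  finally show ?thesis by simp
qed

abbreviation gauss_kernel :: "'a::real_normed_vector \<Rightarrow> real" where
  "gauss_kernel x \<equiv> exp (- (norm x)\<^sup>2 / 2)"

lemma nn_integral_gauss_subspace:
  fixes E :: "'a::euclidean_space set"
  assumes E: "subspace E"
  shows "(\<integral>\<^sup>+x. ennreal (gauss_kernel x) \<partial>subspace_lborel E) = ennreal (sqrt (2 * pi) ^ dim E)"
proof -
  obtain B where B: "orthonormal_basis_of E B" "subspace_lborel E = onb_measure B"
    by (rule subspace_lborel_obtain[OF E])
  note BD = orthonormal_basis_ofD[OF B(1)]
  have "(\<integral>\<^sup>+x. ennreal (gauss_kernel x) \<partial>subspace_lborel E)
     = (\<integral>\<^sup>+f. (\<Prod>b\<in>B. ennreal (exp (- (f b)\<^sup>2 / 2))) \<partial>(\<Pi>\<^sub>M b\<in>B. lborel))"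
    unfolding B(2)
    by (subst nn_integral_onb_measure)
      (auto simp: onb_norm_sum[OF B(1)] prod_ennreal exp_sum[OF BD(1)] sum_negf sum_divide_distrib
        simp flip: exp_sum[OF BD(1)])
  also have "\<dots> = ennreal (sqrt (2 * pi) ^ card B)"
    using BD(1) by (subst lborel_PiM.product_nn_integral_prod) (auto simp: nn_integral_gauss_real[simplified] ennreal_power)
  finally show ?thesis unfolding BD(3) .
qed

lemma dim_orth_comp:
  fixes E :: "'a::euclidean_space set"
  assumes E: "subspace E"
  shows "dim E + dim (E\<^sup>\<bottom>) = DIM('a)"
proof -
  obtain B where B: "orthonormal_basis_of E B" using orthonormal_basis_of_exists[OF E] by blast
  obtain C where C: "orthonormal_basis_of (E\<^sup>\<bottom>) C"
    using orthonormal_basis_of_exists[OF subspace_orthogonal_comp] by blast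
  note U = orthonormal_basis_Un[OF E B C]
  have "card (B \<union> C) = DIM('a)" using orthonormal_basis_ofD(3)[OF U(1)] by simp
  then show ?thesis
    using U(2) orthonormal_basis_ofD[OF B] orthonormal_basis_ofD[OF C] by (simp add: card_Un_disjoint)
qed

text \<open>Layer cake: \<open>exp (- N x)\<close> is the integral of \<open>exp (- r)\<close> over
  all \<open>r \<ge> N x\<close>. By homogeneity the level set at height \<open>r\<close> has
  \<open>r ^ dim E\<close> times the measure of the one at height 1, and the Gamma integral of this
  power is the factorial.\<close>

lemma nn_integral_exp_neg_gauge:
  fixes E :: "'a::euclidean_space set" and N :: "'a \<Rightarrow> real"
  assumes E: "subspace E" and N[measurable]: "N \<in> borel_measurable borel"
    and N0: "\<And>x. N x \<ge> 0" and hom: "\<And>r x. r > 0 \<Longrightarrow> N (r *\<^sub>R x) = r * N x"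
  shows "(\<integral>\<^sup>+x. ennreal (exp (- N x)) \<partial>subspace_lborel E)
    = ennreal (fact (dim E)) * emeasure (subspace_lborel E) {x. N x \<le> 1}"
proof -
  obtain B where B: "orthonormal_basis_of E B" "subspace_lborel E = onb_measure B"
    by (rule subspace_lborel_obtain[OF E])
  note BD = orthonormal_basis_ofD[OF B(1)]
  interpret B: sigma_finite_measure "\<Pi>\<^sub>M b\<in>B. (lborel::real measure)"
    by (rule sigma_finite_PiM_lborel[OF BD(1)])
  interpret P: pair_sigma_finite "\<Pi>\<^sub>M b\<in>B. (lborel::real measure)" "lborel :: real measure"
    by standard
  define q :: "real \<Rightarrow> 'a \<Rightarrow> ennreal" where "q r x = ennreal (exp (- r)) * indicator {N x..} r" for r x
  have [measurable]: "case_prod q \<in> borel_measurable (borel \<Otimes>\<^sub>M borel)"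
  proof -
    have "case_prod q = (\<lambda>(r, x). if N x \<le> r then ennreal (exp (- r)) else 0)"
      by (auto simp: q_def fun_eq_iff)
    then show ?thesis by simp
  qed
  have exp_eq: "ennreal (exp (- N x)) = (\<integral>\<^sup>+r. q r x \<partial>lborel)" for x
  proof -
    have "(\<integral>\<^sup>+r. q r x \<partial>lborel) = ennreal (0 - (- exp (- N x)))"
      unfolding q_def
      using tendsto_minus[OF filterlim_compose[OF exp_at_bot filterlim_uminus_at_bot_at_top]]
      by (intro nn_integral_FTC_atLeast) (auto intro!: derivative_eq_intros)
    then show ?thesis by simp
  qed
  \<comment> \<open>The height 0 is left out because the proof rescales by \<open>1 / r\<close>; a
    single height is a null set in the outer integral.\<close>
  have level: "(\<integral>\<^sup>+x. q r x \<partial>subspace_lborel E)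
      = (ennreal (r ^ dim E * exp (- r)) * indicator {0..} r) * emeasure (subspace_lborel E) {x. N x \<le> 1}"
    if "r \<noteq> 0" for r
  proof (cases "r > 0")
    case True
    have "(\<integral>\<^sup>+x. q r x \<partial>subspace_lborel E)
       = (\<integral>\<^sup>+x. ennreal (exp (- r)) * indicator {x. N x \<le> 1} ((1 / r) *\<^sub>R x) \<partial>subspace_lborel E)"
    proof (rule nn_integral_cong)
      fix x
      have "N ((1 / r) *\<^sub>R x) \<le> 1 \<longleftrightarrow> N x \<le> r"
        using True by (subst hom) (auto simp: field_simps)
      then show "q r x = ennreal (exp (- r)) * indicator {x. N x \<le> 1} ((1 / r) *\<^sub>R x)"
        by (simp add: q_def indicator_def)
    qed
    also have "\<dots> = ennreal (exp (- r)) * (\<integral>\<^sup>+x. indicator {x. N x \<le> 1} ((1 / r) *\<^sub>R x) \<partial>subspace_lborel E)"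
      by (rule nn_integral_cmult) simp
    also have "(\<integral>\<^sup>+x. indicator {x. N x \<le> 1} ((1 / r) *\<^sub>R x) \<partial>subspace_lborel E)
       = ennreal (r ^ dim E) * emeasure (subspace_lborel E) {x. N x \<le> 1}"
      using True by (subst nn_integral_subspace_lborel_scale[OF E]) (auto simp: power_divide)
    finally show ?thesis
      using True by (simp add: ennreal_mult mult_ac)
  next
    case False
    then have "q r x = 0" for x using that N0[of x] by (auto simp: q_def indicator_def)
    then show ?thesis using False that by simp
  qed
  have "(\<integral>\<^sup>+x. ennreal (exp (- N x)) \<partial>subspace_lborel E)
    = (\<integral>\<^sup>+f. \<integral>\<^sup>+r. q r (\<Sum>b\<in>B. f b *\<^sub>R b) \<partial>lborel \<partial>(\<Pi>\<^sub>M b\<in>B. lborel))"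
    unfolding B(2) by (subst nn_integral_onb_measure) (auto simp: exp_eq)
  also have "\<dots> = (\<integral>\<^sup>+r. \<integral>\<^sup>+f. q r (\<Sum>b\<in>B. f b *\<^sub>R b) \<partial>(\<Pi>\<^sub>M b\<in>B. lborel) \<partial>lborel)"
    by (rule P.Fubini'[symmetric]) simp
  also have "\<dots> = (\<integral>\<^sup>+r. \<integral>\<^sup>+x. q r x \<partial>subspace_lborel E \<partial>lborel)"
    unfolding B(2) by (intro nn_integral_cong, subst nn_integral_onb_measure) auto
  also have "\<dots> = (\<integral>\<^sup>+r. (ennreal (r ^ dim E * exp (- r)) * indicator {0..} r) * emeasure (subspace_lborel E) {x. N x \<le> 1} \<partial>lborel)"
    using AE_lborel_singleton[of "0::real"] by (intro nn_integral_cong_AE) (auto simp: level)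
  also have "\<dots> = (\<integral>\<^sup>+r. ennreal (r ^ dim E * exp (- r)) * indicator {0..} r \<partial>lborel) * emeasure (subspace_lborel E) {x. N x \<le> 1}"
    by (rule nn_integral_multc) simp
  finally show ?thesis
    by (simp add: nn_intergal_power_times_exp_Ici)
qed

subsection \<open>Gaussian measure\<close>

definition std_gauss :: "'a::euclidean_space measure" where
  "std_gauss = density lborel (\<lambda>y. ennreal (gauss_kernel y / sqrt (2 * pi) ^ DIM('a)))"

lemma sets_std_gauss [simp, measurable_cong]: "sets std_gauss = sets borel"
  by (simp add: std_gauss_def)

lemma space_std_gauss [simp]: "space std_gauss = UNIV"
  by (simp add: std_gauss_def)

lemma nn_integral_std_gauss:
  fixes h :: "'a::euclidean_space \<Rightarrow> ennreal"
  assumes [measurable]: "h \<in> borel_measurable borel"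
  shows "(\<integral>\<^sup>+y. h y \<partial>std_gauss) = ennreal (1 / sqrt (2 * pi) ^ DIM('a)) * (\<integral>\<^sup>+y. ennreal (gauss_kernel y) * h y \<partial>lborel)"
proof -
  have "(\<integral>\<^sup>+y. h y \<partial>std_gauss) = (\<integral>\<^sup>+y. ennreal (1 / sqrt (2 * pi) ^ DIM('a)) * (ennreal (gauss_kernel y) * h y) \<partial>lborel)"
    unfolding std_gauss_def
    by (subst nn_integral_density) (auto intro!: nn_integral_cong simp: mult.assoc[symmetric] simp flip: ennreal_mult)
  then show ?thesis by (simp add: nn_integral_cmult)
qed

lemma nn_integral_gauss_lborel:
  "(\<integral>\<^sup>+y. ennreal (gauss_kernel (y::'a::euclidean_space)) \<partial>lborel) = ennreal (sqrt (2 * pi) ^ DIM('a))"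
  using nn_integral_gauss_subspace[OF subspace_UNIV, where 'a='a] by (simp add: subspace_lborel_UNIV)

lemma prob_space_std_gauss: "prob_space (std_gauss :: 'a::euclidean_space measure)"
proof
  have "emeasure (std_gauss :: 'a measure) UNIV = (\<integral>\<^sup>+y. 1 \<partial>(std_gauss :: 'a measure))"
    by simp
  also have "\<dots> = 1"
    by (subst nn_integral_std_gauss) (simp_all add: nn_integral_gauss_lborel[simplified] flip: ennreal_mult)
  finally show "emeasure (std_gauss :: 'a measure) (space std_gauss) = 1" by simp
qed

interpretation std_gauss: prob_space std_gauss
  by (rule prob_space_std_gauss)

text \<open>By Pythagoras the Gaussian weight is a product along \<open>E\<close> and its
  complement. This is the independence of the two components with explicit normalising
  constants.\<close>

lemma nn_integral_std_gauss_split: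
  fixes E :: "'a::euclidean_space set" and \<phi> \<psi> :: "'a \<Rightarrow> ennreal"
  assumes E: "subspace E" and [measurable]: "\<phi> \<in> borel_measurable borel" "\<psi> \<in> borel_measurable borel"
  shows "(\<integral>\<^sup>+y. \<phi> (orth_proj E y) * \<psi> (y - orth_proj E y) \<partial>std_gauss)
    = ennreal (1 / sqrt (2 * pi) ^ DIM('a))
      * (\<integral>\<^sup>+x. ennreal (gauss_kernel x) * \<phi> x \<partial>subspace_lborel E)
      * (\<integral>\<^sup>+x. ennreal (gauss_kernel x) * \<psi> x \<partial>subspace_lborel (E\<^sup>\<bottom>))"
proof -
  note [measurable] = borel_measurable_orth_proj[OF E]
  define e where "e x = ennreal (gauss_kernel x)" for x :: 'a
  have [measurable]: "e \<in> borel_measurable borel" unfolding e_def by measurable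
  define h where "h y = e y * (\<phi> (orth_proj E y) * \<psi> (y - orth_proj E y))" for y
  have [measurable]: "h \<in> borel_measurable borel" unfolding h_def by measurable
  have h: "h (x + y) = e x * \<phi> x * (e y * \<psi> y)" if "x \<in> E" "y \<in> E\<^sup>\<bottom>" for x y
  proof -
    have P: "orth_proj E (x + y) = x"
      using that by (intro orth_proj_unique[OF E]) auto
    have "- (norm (x + y))\<^sup>2 / 2 = - (norm x)\<^sup>2 / 2 + - (norm y)\<^sup>2 / 2"
      using norm_orth_proj_decomp[OF E, of "x + y"] unfolding P by (simp add: field_simps)
    then have "e (x + y) = e x * e y"
      unfolding e_def by (simp only: exp_add ennreal_mult exp_ge_zero)
    then show ?thesis by (simp add: h_def P mult_ac)
  qed
  have inner: "(\<integral>\<^sup>+y. h (x + y) \<partial>subspace_lborel (E\<^sup>\<bottom>)) = e x * \<phi> x * (\<integral>\<^sup>+y. e y * \<psi> y \<partial>subspace_lborel (E\<^sup>\<bottom>))"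
    if "x \<in> E" for x
  proof -
    have "(\<integral>\<^sup>+y. h (x + y) \<partial>subspace_lborel (E\<^sup>\<bottom>)) = (\<integral>\<^sup>+y. e x * \<phi> x * (e y * \<psi> y) \<partial>subspace_lborel (E\<^sup>\<bottom>))"
      using that by (intro nn_integral_subspace_lborel_cong subspace_orthogonal_comp) (auto simp: h)
    then show ?thesis by (simp add: nn_integral_cmult)
  qed
  obtain C where C: "orthonormal_basis_of (E\<^sup>\<bottom>) C" "subspace_lborel (E\<^sup>\<bottom>) = onb_measure C"
    by (rule subspace_lborel_obtain[OF subspace_orthogonal_comp])
  interpret C: sigma_finite_measure "\<Pi>\<^sub>M b\<in>C. (lborel::real measure)"
    by (rule sigma_finite_PiM_lborel[OF orthonormal_basis_ofD(1)[OF C(1)]])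
  have [measurable]: "(\<lambda>x. \<integral>\<^sup>+y. h (x + y) \<partial>subspace_lborel (E\<^sup>\<bottom>)) \<in> borel_measurable borel"
    unfolding C(2) by (subst nn_integral_onb_measure) (auto intro!: C.borel_measurable_nn_integral)
  have "(\<integral>\<^sup>+y. \<phi> (orth_proj E y) * \<psi> (y - orth_proj E y) \<partial>std_gauss)
    = ennreal (1 / sqrt (2 * pi) ^ DIM('a)) * (\<integral>\<^sup>+y. h y \<partial>lborel)"
    unfolding h_def e_def by (rule nn_integral_std_gauss) measurable
  also have "(\<integral>\<^sup>+y. h y \<partial>lborel) = (\<integral>\<^sup>+x. \<integral>\<^sup>+y. h (x + y) \<partial>subspace_lborel (E\<^sup>\<bottom>) \<partial>subspace_lborel E)"
    by (rule nn_integral_lborel_split[OF E]) measurable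
  also have "\<dots> = (\<integral>\<^sup>+x. e x * \<phi> x * (\<integral>\<^sup>+y. e y * \<psi> y \<partial>subspace_lborel (E\<^sup>\<bottom>)) \<partial>subspace_lborel E)"
    by (intro nn_integral_subspace_lborel_cong[OF E]) (auto simp: inner)
  also have "\<dots> = (\<integral>\<^sup>+x. e x * \<phi> x \<partial>subspace_lborel E) * (\<integral>\<^sup>+y. e y * \<psi> y \<partial>subspace_lborel (E\<^sup>\<bottom>))"
    by (rule nn_integral_multc) measurable
  finally show ?thesis by (simp add: e_def mult_ac)
qed

lemma nn_integral_std_gauss_proj:
  fixes E :: "'a::euclidean_space set" and \<phi> :: "'a \<Rightarrow> ennreal"
  assumes E: "subspace E" and [measurable]: "\<phi> \<in> borel_measurable borel"
  shows "(\<integral>\<^sup>+y. \<phi> (orth_proj E y) \<partial>std_gauss)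
    = ennreal (1 / sqrt (2 * pi) ^ dim E) * (\<integral>\<^sup>+x. ennreal (gauss_kernel x) * \<phi> x \<partial>subspace_lborel E)"
proof -
  have "(\<integral>\<^sup>+y. \<phi> (orth_proj E y) \<partial>std_gauss) = (\<integral>\<^sup>+y. \<phi> (orth_proj E y) * 1 \<partial>std_gauss)" by simp
  also have "\<dots> = ennreal (1 / sqrt (2 * pi) ^ DIM('a))
      * (\<integral>\<^sup>+x. ennreal (gauss_kernel x) * \<phi> x \<partial>subspace_lborel E) * ennreal (sqrt (2 * pi) ^ dim (E\<^sup>\<bottom>))"
    using nn_integral_std_gauss_split[OF E, of \<phi> "\<lambda>_. 1"] nn_integral_gauss_subspace[OF subspace_orthogonal_comp, of E]
    by simp
  also have "\<dots> = (ennreal (1 / sqrt (2 * pi) ^ DIM('a)) * ennreal (sqrt (2 * pi) ^ dim (E\<^sup>\<bottom>)))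
     * (\<integral>\<^sup>+x. ennreal (gauss_kernel x) * \<phi> x \<partial>subspace_lborel E)"
    by (simp add: mult_ac)
  also have "ennreal (1 / sqrt (2 * pi) ^ DIM('a)) * ennreal (sqrt (2 * pi) ^ dim (E\<^sup>\<bottom>)) = ennreal (1 / sqrt (2 * pi) ^ dim E)"
    unfolding dim_orth_comp[OF E, symmetric] power_add by (simp flip: ennreal_mult)
  finally show ?thesis .
qed

lemma nn_integral_std_gauss_indep:
  fixes E :: "'a::euclidean_space set" and \<phi> \<psi> :: "'a \<Rightarrow> ennreal"
  assumes E: "subspace E" and [measurable]: "\<phi> \<in> borel_measurable borel" "\<psi> \<in> borel_measurable borel"
  shows "(\<integral>\<^sup>+y. \<phi> (orth_proj E y) * \<psi> (y - orth_proj E y) \<partial>std_gauss)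
    = (\<integral>\<^sup>+y. \<phi> (orth_proj E y) \<partial>std_gauss) * (\<integral>\<^sup>+y. \<psi> (y - orth_proj E y) \<partial>std_gauss)"
proof -
  define a where "a = (\<integral>\<^sup>+x. ennreal (gauss_kernel x) * \<phi> x \<partial>subspace_lborel E)"
  define b where "b = (\<integral>\<^sup>+x. ennreal (gauss_kernel x) * \<psi> x \<partial>subspace_lborel (E\<^sup>\<bottom>))"
  define c where "c = ennreal (1 / sqrt (2 * pi) ^ DIM('a))"
  have 1: "(\<integral>\<^sup>+y. \<psi> (y - orth_proj E y) \<partial>std_gauss) = c * ennreal (sqrt (2 * pi) ^ dim E) * b"
    using nn_integral_std_gauss_split[OF E, of "\<lambda>_. 1" \<psi>] nn_integral_gauss_subspace[OF E]
    by (simp add: b_def c_def)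
  have 2: "(\<integral>\<^sup>+y. \<phi> (orth_proj E y) \<partial>std_gauss) = ennreal (1 / sqrt (2 * pi) ^ dim E) * a"
    unfolding a_def by (rule nn_integral_std_gauss_proj[OF E]) measurable
  have 3: "(\<integral>\<^sup>+y. \<phi> (orth_proj E y) * \<psi> (y - orth_proj E y) \<partial>std_gauss) = c * a * b"
    unfolding a_def b_def c_def by (rule nn_integral_std_gauss_split[OF E]) measurable
  have "ennreal (1 / sqrt (2 * pi) ^ dim E) * a * (c * ennreal (sqrt (2 * pi) ^ dim E) * b)
      = (ennreal (1 / sqrt (2 * pi) ^ dim E) * ennreal (sqrt (2 * pi) ^ dim E)) * (c * a * b)"
    by (simp add: mult_ac)
  also have "ennreal (1 / sqrt (2 * pi) ^ dim E) * ennreal (sqrt (2 * pi) ^ dim E) = 1"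
    by (simp flip: ennreal_mult)
  finally show ?thesis unfolding 1 2 3 by simp
qed

text \<open>As \<open>t\<close> grows, the weight on the right tends to 1, so a normalised Gaussian
  mean recovers the integral over \<open>E\<close>: the bridge from heat flow to volume.\<close>

lemma nn_integral_std_gauss_proj_scale:
  fixes E :: "'a::euclidean_space set" and \<phi> :: "'a \<Rightarrow> ennreal"
  assumes E: "subspace E" and [measurable]: "\<phi> \<in> borel_measurable borel" and t: "t > 0"
  shows "ennreal (sqrt (2 * pi * t) ^ dim E) * (\<integral>\<^sup>+y. \<phi> (sqrt t *\<^sub>R orth_proj E y) \<partial>std_gauss)
    = (\<integral>\<^sup>+x. ennreal (exp (- (norm x)\<^sup>2 / (2 * t))) * \<phi> x \<partial>subspace_lborel E)"
proof -
  define h where "h x = ennreal (exp (- (norm x)\<^sup>2 / (2 * t))) * \<phi> x" for x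
  have [measurable]: "h \<in> borel_measurable borel" unfolding h_def by measurable
  have "(\<integral>\<^sup>+y. \<phi> (sqrt t *\<^sub>R orth_proj E y) \<partial>std_gauss)
     = ennreal (1 / sqrt (2 * pi) ^ dim E) * (\<integral>\<^sup>+x. ennreal (gauss_kernel x) * \<phi> (sqrt t *\<^sub>R x) \<partial>subspace_lborel E)"
    by (rule nn_integral_std_gauss_proj[OF E]) measurable
  also have "(\<integral>\<^sup>+x. ennreal (gauss_kernel x) * \<phi> (sqrt t *\<^sub>R x) \<partial>subspace_lborel E) = (\<integral>\<^sup>+x. h (sqrt t *\<^sub>R x) \<partial>subspace_lborel E)"
    using t by (intro nn_integral_cong) (simp add: h_def power_mult_distrib)
  also have "\<dots> = ennreal (1 / sqrt t ^ dim E) * (\<integral>\<^sup>+x. h x \<partial>subspace_lborel E)"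
    using t by (intro nn_integral_subspace_lborel_scale[OF E]) auto
  finally have "ennreal (sqrt (2 * pi * t) ^ dim E) * (\<integral>\<^sup>+y. \<phi> (sqrt t *\<^sub>R orth_proj E y) \<partial>std_gauss)
    = (ennreal (sqrt (2 * pi * t) ^ dim E) * ennreal (1 / sqrt (2 * pi) ^ dim E) * ennreal (1 / sqrt t ^ dim E)) * (\<integral>\<^sup>+x. h x \<partial>subspace_lborel E)"
    by (simp add: mult_ac)
  also have "ennreal (sqrt (2 * pi * t) ^ dim E) * ennreal (1 / sqrt (2 * pi) ^ dim E) * ennreal (1 / sqrt t ^ dim E) = 1"
    using t by (simp add: real_sqrt_mult power_mult_distrib flip: ennreal_mult)
  finally show ?thesis by (simp add: h_def)
qed

text \<open>The Cameron-Martin formula. The shift moves from the function to the density, so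
  derivatives in the base point fall on an exponential and not on \<open>h\<close>.\<close>

lemma integral_std_gauss_translate:
  fixes h :: "'a::euclidean_space \<Rightarrow> real"
  assumes [measurable]: "h \<in> borel_measurable borel"
  shows "(LINT y|std_gauss. h (a + y)) = (LINT y|std_gauss. exp (a \<bullet> y - (norm a)\<^sup>2 / 2) * h y)"
proof -
  define k where "k y = gauss_kernel y / sqrt (2 * pi) ^ DIM('a)" for y :: 'a
  have [measurable]: "k \<in> borel_measurable borel" unfolding k_def by measurable
  have sg: "std_gauss = density lborel (\<lambda>y. ennreal (k y))" by (simp add: std_gauss_def k_def)
  have k0: "k y \<ge> 0" for y by (simp add: k_def)
  have shift: "k (y - a) = k y * exp (a \<bullet> y - (norm a)\<^sup>2 / 2)" for y
  proof -
    have "- (norm (y - a))\<^sup>2 / 2 = - (norm y)\<^sup>2 / 2 + (a \<bullet> y - (norm a)\<^sup>2 / 2)"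
      by (simp add: power2_norm_eq_inner inner_diff_left inner_diff_right inner_commute field_simps)
    then show ?thesis unfolding k_def by (simp only: exp_add times_divide_eq_left)
  qed
  define g where "g y = k (y - a) * h y" for y
  have [measurable]: "g \<in> borel_measurable borel" unfolding g_def by measurable
  have g: "g (a + y) = k y * h (a + y)" for y by (simp add: g_def)
  have "(LINT y|std_gauss. h (a + y)) = (LINT y|lborel. g (a + y))"
    unfolding sg g by (subst integral_density) (auto simp: k0)
  also have "\<dots> = (LINT y|distr lborel borel ((+) a). g y)"
    by (subst integral_distr) auto
  also have "\<dots> = (LINT y|lborel. g y)" by (simp add: lborel_distr_plus)
  also have "\<dots> = (LINT y|std_gauss. exp (a \<bullet> y - (norm a)\<^sup>2 / 2) * h y)"
    unfolding sg g_def shift by (subst integral_density) (auto simp: k0 mult_ac)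
  finally show "(LINT y|std_gauss. h (a + y)) = (LINT y|std_gauss. exp (a \<bullet> y - (norm a)\<^sup>2 / 2) * h y)" .
qed

text \<open>The counterpart of the translation formula for dilations: a change of variance becomes
  an exponential of the squared norm. It serves integrability, the semigroup law and the time
  derivative.\<close>

lemma nn_integral_std_gauss_scale:
  fixes h :: "'a::euclidean_space \<Rightarrow> ennreal"
  assumes [measurable]: "h \<in> borel_measurable borel" and r: "r > 0"
  shows "(\<integral>\<^sup>+y. h (r *\<^sub>R y) \<partial>std_gauss)
    = ennreal (1 / r ^ DIM('a)) * (\<integral>\<^sup>+y. ennreal (exp ((1 - 1 / r\<^sup>2) * ((norm y)\<^sup>2 / 2))) * h y \<partial>std_gauss)"
proof -
  define g where "g y = ennreal (exp (- (norm y)\<^sup>2 / (2 * r\<^sup>2))) * h y" for y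
  have [measurable]: "g \<in> borel_measurable borel" unfolding g_def by measurable
  define c where "c = ennreal (1 / sqrt (2 * pi) ^ DIM('a))"
  have "(\<integral>\<^sup>+y. h (r *\<^sub>R y) \<partial>std_gauss) = c * (\<integral>\<^sup>+y. ennreal (gauss_kernel y) * h (r *\<^sub>R y) \<partial>lborel)"
    unfolding c_def by (rule nn_integral_std_gauss) measurable
  also have "(\<integral>\<^sup>+y. ennreal (gauss_kernel y) * h (r *\<^sub>R y) \<partial>lborel) = (\<integral>\<^sup>+y. g (r *\<^sub>R y) \<partial>lborel)"
    using r by (intro nn_integral_cong) (simp add: g_def power_mult_distrib)
  also have "\<dots> = ennreal (1 / r ^ DIM('a)) * (\<integral>\<^sup>+y. g y \<partial>lborel)"
    by (rule nn_integral_lborel_scale[OF _ r]) measurable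
  also have "(\<integral>\<^sup>+y. g y \<partial>lborel) = (\<integral>\<^sup>+y. ennreal (gauss_kernel y) * (ennreal (exp ((1 - 1 / r\<^sup>2) * ((norm y)\<^sup>2 / 2))) * h y) \<partial>lborel)"
    by (intro nn_integral_cong)
      (simp add: g_def mult.assoc[symmetric] exp_add[symmetric] field_simps flip: ennreal_mult)
  also have "c * (ennreal (1 / r ^ DIM('a)) * \<dots>) = ennreal (1 / r ^ DIM('a)) * (c * \<dots>)"
    by (simp add: mult_ac)
  also have "c * (\<integral>\<^sup>+y. ennreal (gauss_kernel y) * (ennreal (exp ((1 - 1 / r\<^sup>2) * ((norm y)\<^sup>2 / 2))) * h y) \<partial>lborel)
    = (\<integral>\<^sup>+y. ennreal (exp ((1 - 1 / r\<^sup>2) * ((norm y)\<^sup>2 / 2))) * h y \<partial>std_gauss)"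
    unfolding c_def by (rule nn_integral_std_gauss[symmetric]) measurable
  finally show ?thesis .
qed

lemma integrable_std_gauss_exp_square:
  assumes "\<theta> < 1"
  shows "integrable (std_gauss :: 'a::euclidean_space measure) (\<lambda>y. exp (\<theta> * ((norm y)\<^sup>2 / 2)))"
proof -
  \<comment> \<open>With this dilation, applied to the constant 1, the factor that appears is the
    integrand in question.\<close>
  define r where "r = 1 / sqrt (1 - \<theta>)"
  have r: "r > 0" and r2: "1 - 1 / r\<^sup>2 = \<theta>"
    using assms by (auto simp: r_def power_divide)
  have "(\<integral>\<^sup>+y. 1 \<partial>(std_gauss :: 'a measure)) = ennreal (1 / r ^ DIM('a)) * (\<integral>\<^sup>+(y::'a). ennreal (exp (\<theta> * ((norm y)\<^sup>2 / 2))) * 1 \<partial>std_gauss)"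
    using nn_integral_std_gauss_scale[OF _ r, of "\<lambda>_::'a. 1"] unfolding r2 by simp
  then have "ennreal (1 / r ^ DIM('a)) * (\<integral>\<^sup>+(y::'a). ennreal (exp (\<theta> * ((norm y)\<^sup>2 / 2))) \<partial>std_gauss) = 1"
    by (simp add: std_gauss.emeasure_space_1[simplified])
  then have "(\<integral>\<^sup>+(y::'a). ennreal (exp (\<theta> * ((norm y)\<^sup>2 / 2))) \<partial>std_gauss) < \<infinity>"
    using r by (cases "(\<integral>\<^sup>+(y::'a). ennreal (exp (\<theta> * ((norm y)\<^sup>2 / 2))) \<partial>std_gauss)") (auto simp: ennreal_mult_top)
  then show ?thesis by (intro integrableI_bounded) auto
qed

lemma integrable_std_gauss_exp:
  assumes "\<theta> < 1"
  shows "integrable (std_gauss :: 'a::euclidean_space measure) (\<lambda>y. exp (r * norm y + \<theta> * ((norm y)\<^sup>2 / 2)))"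
proof -
  \<comment> \<open>Half of the room below 1; completing the square absorbs the linear term into
    it.\<close>
  define \<eta> where "\<eta> = (1 - \<theta>) / 2"
  have \<eta>: "\<eta> > 0" "\<theta> + \<eta> < 1" using assms by (auto simp: \<eta>_def field_simps)
  have b: "r * x + \<theta> * (x\<^sup>2 / 2) \<le> r\<^sup>2 / (2 * \<eta>) + (\<theta> + \<eta>) * (x\<^sup>2 / 2)" for x :: real
  proof -
    have "0 \<le> (r - \<eta> * x)\<^sup>2 / (2 * \<eta>)" using \<eta> by simp
    also have "\<dots> = r\<^sup>2 / (2 * \<eta>) + \<eta> * (x\<^sup>2 / 2) - r * x"
      using \<eta> by (simp add: power2_diff field_simps power2_eq_square)
    finally show ?thesis unfolding distrib_right by linarith
  qed
  have "integrable (std_gauss :: 'a measure) (\<lambda>y. exp (r\<^sup>2 / (2 * \<eta>)) * exp ((\<theta> + \<eta>) * ((norm y)\<^sup>2 / 2)))"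
    by (intro integrable_mult_right integrable_std_gauss_exp_square \<eta>)
  then show ?thesis
    by (rule Bochner_Integration.integrable_bound) (auto simp: exp_add[symmetric] intro!: AE_I2 b[simplified])
qed

section \<open>Differentiation under the integral sign\<close>

lemma abs_exp_diff_1_le: "\<bar>exp x - 1\<bar> \<le> \<bar>x\<bar> * exp \<bar>x :: real\<bar>"
proof (cases "x \<ge> 0")
  case True
  have "1 - x \<le> exp (- x)" using exp_ge_add_one_self[of "- x"] by simp
  then have "(1 - x) * exp x \<le> exp (- x) * exp x" by (intro mult_right_mono) auto
  then have "(1 - x) * exp x \<le> 1" by (simp flip: exp_add)
  then show ?thesis using True by (simp add: algebra_simps)
next
  case False
  then have "exp x \<le> 1" by simp
  then have "\<bar>exp x - 1\<bar> \<le> \<bar>x\<bar>" using exp_ge_add_one_self[of x] False by linarith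
  also have "\<dots> \<le> \<bar>x\<bar> * exp \<bar>x\<bar>" by (simp add: mult_le_cancel_left1)
  finally show ?thesis .
qed

lemma
  fixes q \<xi> :: "'b \<Rightarrow> real"
  assumes q[measurable]: "q \<in> borel_measurable M" and \<xi>[measurable]: "\<xi> \<in> borel_measurable M"
    and int: "integrable M (\<lambda>y. q y * exp (\<delta> * \<bar>\<xi> y\<bar>))" and s: "\<bar>s\<bar> < \<delta>"
  shows integrable_laplace: "integrable M (\<lambda>y. q y * exp (s * \<xi> y))"
    and has_derivative_laplace: "((\<lambda>s. LINT y|M. q y * exp (s * \<xi> y)) has_real_derivative (LINT y|M. q y * \<xi> y * exp (s * \<xi> y))) (at s)"
proof -
  have I: "integrable M (\<lambda>y. q y * exp (s * \<xi> y))" if "\<bar>s\<bar> < \<delta>" for s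
  proof (rule Bochner_Integration.integrable_bound[OF int])
    have "s * \<xi> y \<le> \<delta> * \<bar>\<xi> y\<bar>" for y
      using that mult_right_mono[of "\<bar>s\<bar>" \<delta> "\<bar>\<xi> y\<bar>"] abs_ge_self[of "s * \<xi> y"]
      by (simp add: abs_mult)
    then show "AE y in M. norm (q y * exp (s * \<xi> y)) \<le> norm (q y * exp (\<delta> * \<bar>\<xi> y\<bar>))"
      by (auto simp: abs_mult intro!: mult_left_mono)
  qed simp
  from I[OF s] show "integrable M (\<lambda>y. q y * exp (s * \<xi> y))" .
  \<comment> \<open>The room between the modulus of \<open>s\<close> and \<open>\<delta>\<close> is
    used twice: one \<open>\<rho>\<close> bounds the increment of \<open>s\<close>, the other
    absorbs the factor \<open>\<xi> y\<close>.\<close>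
  define \<rho> where "\<rho> = (\<delta> - \<bar>s\<bar>) / 2"
  have \<rho>: "\<rho> > 0" "\<bar>s\<bar> + \<rho> + \<rho> = \<delta>" using s by (auto simp: \<rho>_def)
  have xi_le: "\<bar>x\<bar> \<le> exp (\<rho> * \<bar>x\<bar>) / \<rho>" for x
  proof -
    have "\<rho> * \<bar>x\<bar> \<le> exp (\<rho> * \<bar>x\<bar>)"
      using exp_ge_add_one_self[of "\<rho> * \<bar>x\<bar>"] by linarith
    then show ?thesis using \<rho> by (simp add: field_simps)
  qed
  have bound: "\<bar>x\<bar> * exp ((\<bar>s\<bar> + \<rho>) * \<bar>x\<bar>) \<le> exp (\<delta> * \<bar>x\<bar>) / \<rho>" for x
  proof -
    have "\<bar>x\<bar> * exp ((\<bar>s\<bar> + \<rho>) * \<bar>x\<bar>) \<le> exp (\<rho> * \<bar>x\<bar>) / \<rho> * exp ((\<bar>s\<bar> + \<rho>) * \<bar>x\<bar>)"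
      by (intro mult_right_mono xi_le) auto
    also have "\<dots> = exp (\<delta> * \<bar>x\<bar>) / \<rho>"
      unfolding \<rho>(2)[symmetric] by (simp add: exp_add[symmetric] algebra_simps)
    finally show ?thesis .
  qed
  have intb: "integrable M (\<lambda>y. \<bar>q y\<bar> * (exp (\<delta> * \<bar>\<xi> y\<bar>) / \<rho>))"
    using integrable_divide[OF integrable_abs[OF int], of \<rho>] by (simp add: abs_mult)
  define F where "F s = (LINT y|M. q y * exp (s * \<xi> y))" for s
  define D where "D = (LINT y|M. q y * \<xi> y * exp (s * \<xi> y))"
  have "((\<lambda>h. (F (s + h) - F s) / h) \<longlongrightarrow> D) (at 0 within ball 0 \<rho>)"
    unfolding tendsto_at_iff_sequentially comp_def
  proof (intro allI impI)
    fix X :: "nat \<Rightarrow> real"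
    assume X: "\<forall>i. X i \<in> ball 0 \<rho> - {0}" and X0: "X \<longlonglongrightarrow> 0"
    have X1: "X i \<noteq> 0" "\<bar>X i\<bar> < \<rho>" for i using X[rule_format, of i] by auto
    have Xs: "\<bar>s + X i\<bar> < \<delta>" for i using X1(2)[of i] \<rho> by linarith
    define G where "G i y = q y * exp (s * \<xi> y) * ((exp (X i * \<xi> y) - 1) / X i)" for i y
    have FG: "(F (s + X i) - F s) / X i = (LINT y|M. G i y)" for i
    proof -
      have "F (s + X i) - F s = (LINT y|M. q y * exp ((s + X i) * \<xi> y) - q y * exp (s * \<xi> y))"
        unfolding F_def by (intro Bochner_Integration.integral_diff[symmetric] I s Xs)
      also have "\<dots> / X i = (LINT y|M. (q y * exp ((s + X i) * \<xi> y) - q y * exp (s * \<xi> y)) / X i)"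
        by simp
      also have "\<dots> = (LINT y|M. G i y)"
        by (intro Bochner_Integration.integral_cong refl) (simp add: G_def distrib_right exp_add field_simps)
      finally show ?thesis .
    qed
    have "(\<lambda>i. LINT y|M. G i y) \<longlonglongrightarrow> D"
      unfolding D_def
    proof (rule integral_dominated_convergence[OF _ _ intb])
      show "AE y in M. (\<lambda>i. G i y) \<longlonglongrightarrow> q y * \<xi> y * exp (s * \<xi> y)"
      proof (intro AE_I2)
        fix y
        have "((\<lambda>h. exp (h * \<xi> y)) has_real_derivative \<xi> y) (at 0)"
          by (auto intro!: derivative_eq_intros)
        then have "(\<lambda>h. (exp (h * \<xi> y) - 1) / h) \<midarrow>0\<rightarrow> \<xi> y"
          by (simp add: has_field_derivative_iff)
        then have "(\<lambda>i. (exp (X i * \<xi> y) - 1) / X i) \<longlonglongrightarrow> \<xi> y"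
          by (rule filterlim_compose) (use X0 X1 in \<open>auto simp: filterlim_at\<close>)
        then have "(\<lambda>i. G i y) \<longlonglongrightarrow> q y * exp (s * \<xi> y) * \<xi> y"
          unfolding G_def by (intro tendsto_intros)
        then show "(\<lambda>i. G i y) \<longlonglongrightarrow> q y * \<xi> y * exp (s * \<xi> y)" by (simp add: mult_ac)
      qed
      show "AE y in M. norm (G i y) \<le> \<bar>q y\<bar> * (exp (\<delta> * \<bar>\<xi> y\<bar>) / \<rho>)" for i
      proof (intro AE_I2)
        fix y
        have "\<bar>(exp (X i * \<xi> y) - 1) / X i\<bar> \<le> \<bar>X i * \<xi> y\<bar> * exp \<bar>X i * \<xi> y\<bar> / \<bar>X i\<bar>"
          unfolding abs_divide by (intro divide_right_mono abs_exp_diff_1_le) auto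
        also have "\<dots> = \<bar>\<xi> y\<bar> * exp (\<bar>X i\<bar> * \<bar>\<xi> y\<bar>)"
          using X1[of i] by (simp add: abs_mult)
        also have "\<dots> \<le> \<bar>\<xi> y\<bar> * exp (\<rho> * \<bar>\<xi> y\<bar>)"
          using X1[of i] by (intro mult_left_mono) (auto intro!: mult_right_mono)
        finally have 1: "\<bar>(exp (X i * \<xi> y) - 1) / X i\<bar> \<le> \<bar>\<xi> y\<bar> * exp (\<rho> * \<bar>\<xi> y\<bar>)" .
        have "exp (s * \<xi> y) * \<bar>(exp (X i * \<xi> y) - 1) / X i\<bar> \<le> exp (\<bar>s\<bar> * \<bar>\<xi> y\<bar>) * (\<bar>\<xi> y\<bar> * exp (\<rho> * \<bar>\<xi> y\<bar>))"
          by (intro mult_mono 1) (auto simp flip: abs_mult)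
        also have "\<dots> = \<bar>\<xi> y\<bar> * exp ((\<bar>s\<bar> + \<rho>) * \<bar>\<xi> y\<bar>)"
          by (simp add: exp_add distrib_right)
        also have "\<dots> \<le> exp (\<delta> * \<bar>\<xi> y\<bar>) / \<rho>" by (rule bound)
        finally have "\<bar>q y\<bar> * (exp (s * \<xi> y) * \<bar>(exp (X i * \<xi> y) - 1) / X i\<bar>) \<le> \<bar>q y\<bar> * (exp (\<delta> * \<bar>\<xi> y\<bar>) / \<rho>)"
          by (intro mult_left_mono) auto
        then show "norm (G i y) \<le> \<bar>q y\<bar> * (exp (\<delta> * \<bar>\<xi> y\<bar>) / \<rho>)"
          unfolding G_def by (simp add: abs_mult mult.assoc)
      qed
    qed (auto simp: G_def)
    then show "(\<lambda>i. (F (s + X i) - F s) / X i) \<longlonglongrightarrow> D" unfolding FG .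
  qed
  then have "((\<lambda>h. (F (s + h) - F s) / h) \<longlongrightarrow> D) (at 0)"
    using \<rho> by (subst (asm) at_within_open) auto
  then show "((\<lambda>s. LINT y|M. q y * exp (s * \<xi> y)) has_real_derivative (LINT y|M. q y * \<xi> y * exp (s * \<xi> y))) (at s)"
    unfolding DERIV_def F_def D_def .
qed

subsection \<open>Logarithmic heat flow of Lipschitz functions\<close>

lemma nn_integral_std_gauss_translate:
  fixes h :: "'a::euclidean_space \<Rightarrow> ennreal"
  assumes [measurable]: "h \<in> borel_measurable borel"
  shows "(\<integral>\<^sup>+y. h (a + y) \<partial>std_gauss) = (\<integral>\<^sup>+y. ennreal (exp (a \<bullet> y - (norm a)\<^sup>2 / 2)) * h y \<partial>std_gauss)"
proof -
  define c where "c = ennreal (1 / sqrt (2 * pi) ^ DIM('a))"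
  define g where "g y = ennreal (gauss_kernel (y - a)) * h y" for y
  have [measurable]: "g \<in> borel_measurable borel" unfolding g_def by measurable
  have shift: "gauss_kernel (y - a) = gauss_kernel y * exp (a \<bullet> y - (norm a)\<^sup>2 / 2)" for y
  proof -
    have "- (norm (y - a))\<^sup>2 / 2 = - (norm y)\<^sup>2 / 2 + (a \<bullet> y - (norm a)\<^sup>2 / 2)"
      by (simp add: power2_norm_eq_inner inner_diff_left inner_diff_right inner_commute field_simps)
    then show ?thesis by (simp only: exp_add)
  qed
  have "(\<integral>\<^sup>+y. h (a + y) \<partial>std_gauss) = c * (\<integral>\<^sup>+y. ennreal (gauss_kernel y) * h (a + y) \<partial>lborel)"
    unfolding c_def by (rule nn_integral_std_gauss) measurable
  also have "(\<integral>\<^sup>+y. ennreal (gauss_kernel y) * h (a + y) \<partial>lborel) = (\<integral>\<^sup>+y. g (a + y) \<partial>lborel)"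
    by (simp add: g_def)
  also have "\<dots> = (\<integral>\<^sup>+y. g y \<partial>lborel)" by (rule nn_integral_lborel_translate) measurable
  also have "\<dots> = (\<integral>\<^sup>+y. ennreal (gauss_kernel y) * (ennreal (exp (a \<bullet> y - (norm a)\<^sup>2 / 2)) * h y) \<partial>lborel)"
    unfolding g_def shift by (simp add: ennreal_mult mult.assoc)
  also have "c * \<dots> = (\<integral>\<^sup>+y. ennreal (exp (a \<bullet> y - (norm a)\<^sup>2 / 2)) * h y \<partial>std_gauss)"
    unfolding c_def by (rule nn_integral_std_gauss[symmetric]) measurable
  finally show ?thesis .
qed

lemma nn_integral_std_gauss_mgf:
  "(\<integral>\<^sup>+y. ennreal (exp (a \<bullet> y)) \<partial>std_gauss) = ennreal (exp ((norm (a::'a::euclidean_space))\<^sup>2 / 2))"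
proof -
  have "1 = (\<integral>\<^sup>+(y::'a). 1 \<partial>std_gauss)"
    using std_gauss.emeasure_space_1[where 'a='a] by simp
  also have "\<dots> = (\<integral>\<^sup>+y. ennreal (exp (a \<bullet> y - (norm a)\<^sup>2 / 2)) \<partial>std_gauss)"
    using nn_integral_std_gauss_translate[of "\<lambda>_::'a. 1" a] by simp
  also have "\<dots> = (\<integral>\<^sup>+y. ennreal (exp (- ((norm a)\<^sup>2 / 2))) * ennreal (exp (a \<bullet> y)) \<partial>std_gauss)"
    by (simp flip: ennreal_mult exp_add)
  also have "\<dots> = ennreal (exp (- ((norm a)\<^sup>2 / 2))) * (\<integral>\<^sup>+y. ennreal (exp (a \<bullet> y)) \<partial>std_gauss)"
    by (rule nn_integral_cmult) simp
  finally have "ennreal (exp ((norm a)\<^sup>2 / 2)) * 1 = (ennreal (exp ((norm a)\<^sup>2 / 2)) * ennreal (exp (- ((norm a)\<^sup>2 / 2)))) * (\<integral>\<^sup>+y. ennreal (exp (a \<bullet> y)) \<partial>std_gauss)"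
    by (simp only: mult.assoc)
  also have "ennreal (exp ((norm a)\<^sup>2 / 2)) * ennreal (exp (- ((norm a)\<^sup>2 / 2))) = 1"
    by (simp flip: ennreal_mult exp_add)
  finally show ?thesis by simp
qed

text \<open>No rotation of the product space is needed: translate the inner integral, exchange the order of
  integration and rescale twice.\<close>

lemma nn_integral_std_gauss_convolution:
  fixes \<phi> :: "'a::euclidean_space \<Rightarrow> ennreal"
  assumes [measurable]: "\<phi> \<in> borel_measurable borel" and s: "s > 0" and t: "t > 0"
  shows "(\<integral>\<^sup>+z. \<integral>\<^sup>+y. \<phi> (sqrt s *\<^sub>R z + sqrt t *\<^sub>R y) \<partial>std_gauss \<partial>std_gauss)
    = (\<integral>\<^sup>+y. \<phi> (sqrt (s + t) *\<^sub>R y) \<partial>std_gauss)"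
proof -
  interpret P: pair_sigma_finite "std_gauss :: 'a measure" "std_gauss :: 'a measure" ..
  define c where "c = sqrt s / sqrt t"
  define \<rho> where "\<rho> = sqrt (1 + c\<^sup>2)"
  have \<rho>2: "\<rho>\<^sup>2 = 1 + c\<^sup>2" unfolding \<rho>_def by (rule real_sqrt_pow2) simp
  have \<rho>: "\<rho> > 0" unfolding \<rho>_def by (simp add: add_pos_nonneg)
  have c2: "c\<^sup>2 = s / t" using s t by (simp add: c_def power_divide)
  have tr: "sqrt t * \<rho> = sqrt (s + t)"
    unfolding \<rho>_def c2 using t by (simp add: real_sqrt_mult[symmetric] algebra_simps)
  define w where "w z y = ennreal (exp ((c *\<^sub>R z) \<bullet> y - (norm (c *\<^sub>R z))\<^sup>2 / 2)) * \<phi> (sqrt t *\<^sub>R y)" for z y :: 'a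
  have [measurable]: "case_prod w \<in> borel_measurable (borel \<Otimes>\<^sub>M borel)" unfolding w_def by measurable
  \<comment> \<open>After a dilation by \<open>1 / \<rho>\<close> this is a moment generating
    function. Its value is exactly the factor that a dilation by \<open>\<rho>\<close> creates, so
    the last rescaling below closes the computation.\<close>
  have inner: "(\<integral>\<^sup>+z. ennreal (exp ((c *\<^sub>R z) \<bullet> y - (norm (c *\<^sub>R z))\<^sup>2 / 2)) \<partial>std_gauss)
      = ennreal (1 / \<rho> ^ DIM('a)) * ennreal (exp ((1 - 1 / \<rho>\<^sup>2) * ((norm y)\<^sup>2 / 2)))" for y :: 'a
  proof -
    have r: "1 / \<rho> > 0" and r2: "1 - 1 / (1 / \<rho>)\<^sup>2 = - c\<^sup>2" using \<rho> \<rho>2 by (auto simp: power_divide)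
    have "(\<integral>\<^sup>+z. ennreal (exp ((c / \<rho>) *\<^sub>R y \<bullet> z)) \<partial>std_gauss)
       = (\<integral>\<^sup>+z. ennreal (exp ((c *\<^sub>R ((1 / \<rho>) *\<^sub>R z)) \<bullet> y)) \<partial>std_gauss)"
      by (simp add: inner_commute)
    also have "\<dots> = ennreal (1 / (1 / \<rho>) ^ DIM('a)) * (\<integral>\<^sup>+z. ennreal (exp (- c\<^sup>2 * ((norm z)\<^sup>2 / 2))) * ennreal (exp ((c *\<^sub>R z) \<bullet> y)) \<partial>std_gauss)"
      unfolding r2[symmetric] by (rule nn_integral_std_gauss_scale[OF _ r]) measurable
    also have "(\<integral>\<^sup>+z. ennreal (exp (- c\<^sup>2 * ((norm z)\<^sup>2 / 2))) * ennreal (exp ((c *\<^sub>R z) \<bullet> y)) \<partial>std_gauss)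
        = (\<integral>\<^sup>+z. ennreal (exp ((c *\<^sub>R z) \<bullet> y - (norm (c *\<^sub>R z))\<^sup>2 / 2)) \<partial>std_gauss)"
      by (intro nn_integral_cong) (simp add: power_mult_distrib flip: ennreal_mult exp_add)
    finally have "ennreal (1 / \<rho> ^ DIM('a)) * (\<integral>\<^sup>+z. ennreal (exp ((c / \<rho>) *\<^sub>R y \<bullet> z)) \<partial>std_gauss)
      = (ennreal (1 / \<rho> ^ DIM('a)) * ennreal (1 / (1 / \<rho>) ^ DIM('a))) * (\<integral>\<^sup>+z. ennreal (exp ((c *\<^sub>R z) \<bullet> y - (norm (c *\<^sub>R z))\<^sup>2 / 2)) \<partial>std_gauss)"
      by (simp only: mult.assoc)
    also have "ennreal (1 / \<rho> ^ DIM('a)) * ennreal (1 / (1 / \<rho>) ^ DIM('a)) = 1"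
      using \<rho> by (simp add: power_divide flip: ennreal_mult)
    finally have "(\<integral>\<^sup>+z. ennreal (exp ((c *\<^sub>R z) \<bullet> y - (norm (c *\<^sub>R z))\<^sup>2 / 2)) \<partial>std_gauss)
      = ennreal (1 / \<rho> ^ DIM('a)) * (\<integral>\<^sup>+z. ennreal (exp ((c / \<rho>) *\<^sub>R y \<bullet> z)) \<partial>std_gauss)" by simp
    also have "(\<integral>\<^sup>+z. ennreal (exp ((c / \<rho>) *\<^sub>R y \<bullet> z)) \<partial>std_gauss) = ennreal (exp ((norm ((c / \<rho>) *\<^sub>R y))\<^sup>2 / 2))"
      by (rule nn_integral_std_gauss_mgf)
    also have "(norm ((c / \<rho>) *\<^sub>R y))\<^sup>2 / 2 = (1 - 1 / \<rho>\<^sup>2) * ((norm y)\<^sup>2 / 2)"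
    proof -
      have "\<rho>\<^sup>2 \<noteq> 0" using \<rho> by simp
      then have "c\<^sup>2 / \<rho>\<^sup>2 = 1 - 1 / \<rho>\<^sup>2" using \<rho>2 by (simp add: divide_simps)
      moreover have "(norm ((c / \<rho>) *\<^sub>R y))\<^sup>2 / 2 = (c\<^sup>2 / \<rho>\<^sup>2) * ((norm y)\<^sup>2 / 2)"
        by (simp add: power_mult_distrib power_divide)
      ultimately show ?thesis by simp
    qed
    finally show ?thesis .
  qed
  have "(\<integral>\<^sup>+z. \<integral>\<^sup>+y. \<phi> (sqrt s *\<^sub>R z + sqrt t *\<^sub>R y) \<partial>std_gauss \<partial>std_gauss) = (\<integral>\<^sup>+z. \<integral>\<^sup>+y. w z y \<partial>std_gauss \<partial>std_gauss)"
  proof (rule nn_integral_cong)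
    fix z :: 'a
    have "sqrt s *\<^sub>R z + sqrt t *\<^sub>R y = sqrt t *\<^sub>R (c *\<^sub>R z + y)" for y
      using t by (simp add: c_def scaleR_add_right)
    then show "(\<integral>\<^sup>+y. \<phi> (sqrt s *\<^sub>R z + sqrt t *\<^sub>R y) \<partial>std_gauss) = (\<integral>\<^sup>+y. w z y \<partial>std_gauss)"
      using nn_integral_std_gauss_translate[of "\<lambda>y. \<phi> (sqrt t *\<^sub>R y)" "c *\<^sub>R z"] by (simp add: w_def)
  qed
  also have "\<dots> = (\<integral>\<^sup>+y. \<integral>\<^sup>+z. w z y \<partial>std_gauss \<partial>std_gauss)"
    by (rule P.Fubini'[symmetric]) measurable
  also have "\<dots> = (\<integral>\<^sup>+y. ennreal (1 / \<rho> ^ DIM('a)) * (ennreal (exp ((1 - 1 / \<rho>\<^sup>2) * ((norm y)\<^sup>2 / 2))) * \<phi> (sqrt t *\<^sub>R y)) \<partial>std_gauss)"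
    unfolding w_def by (intro nn_integral_cong, subst nn_integral_multc) (auto simp: inner[simplified] mult.assoc)
  also have "\<dots> = ennreal (1 / \<rho> ^ DIM('a)) * (\<integral>\<^sup>+y. ennreal (exp ((1 - 1 / \<rho>\<^sup>2) * ((norm y)\<^sup>2 / 2))) * \<phi> (sqrt t *\<^sub>R y) \<partial>std_gauss)"
    by (rule nn_integral_cmult) measurable
  also have "\<dots> = (\<integral>\<^sup>+y. \<phi> (sqrt t *\<^sub>R (\<rho> *\<^sub>R y)) \<partial>std_gauss)"
    by (rule nn_integral_std_gauss_scale[OF _ \<rho>, symmetric]) measurable
  finally show ?thesis by (simp add: tr)
qed

lemma std_gauss_integral_pos:
  fixes h :: "'a::euclidean_space \<Rightarrow> real"
  assumes int: "integrable std_gauss h" and pos: "\<And>y. h y > 0"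
  shows "(LINT y|std_gauss. h y) > 0"
proof -
  have "(LINT y|std_gauss. h y) \<ge> 0"
    using pos by (intro Bochner_Integration.integral_nonneg) (auto intro: less_imp_le)
  moreover have "(LINT y|std_gauss. h y) \<noteq> 0"
  proof
    assume "(LINT y|std_gauss. h y) = 0"
    then have "AE y in (std_gauss::'a measure). h y = 0"
      using pos by (subst (asm) integral_nonneg_eq_0_iff_AE[OF int]) (auto intro: less_imp_le)
    then have "AE y in (std_gauss::'a measure). False"
      by eventually_elim (use pos in \<open>simp add: less_le\<close>)
    then show False using std_gauss.AE_False[where 'a='a] by simp
  qed
  ultimately show ?thesis by simp
qed

text \<open>The Gaussian has variance \<open>t\<close>, so the generator is half the Laplacian;
  hence the factors 1/2 in all time derivatives.\<close>

definition lheat :: "real \<Rightarrow> ('a::euclidean_space \<Rightarrow> real) \<Rightarrow> 'a \<Rightarrow> real" where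
  "lheat t u x = ln (LINT y|std_gauss. exp (u (x + sqrt t *\<^sub>R y)))"

text \<open>Expectation under the Gaussian measure tilted by \<open>exp u\<close>, seen from
  \<open>x\<close> at scale \<open>sqrt t\<close>.\<close>

definition tmean :: "real \<Rightarrow> ('a::euclidean_space \<Rightarrow> real) \<Rightarrow> 'a \<Rightarrow> ('a \<Rightarrow> real) \<Rightarrow> real" where
  "tmean t u x h = (LINT y|std_gauss. exp (u (x + sqrt t *\<^sub>R y)) * h y) / (LINT y|std_gauss. exp (u (x + sqrt t *\<^sub>R y)))"

text \<open>The derivative of \<open>lheat\<close> in the direction \<open>a\<close>, as Gaussian
  integration by parts gives it.\<close>

definition lgrad :: "real \<Rightarrow> ('a::euclidean_space \<Rightarrow> real) \<Rightarrow> 'a \<Rightarrow> 'a \<Rightarrow> real" where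
  "lgrad t u x a = tmean t u x (\<lambda>y. y \<bullet> a) / sqrt t"

text \<open>The Hessian of \<open>lheat\<close>: covariance of the tilted measure minus the
  identity, over \<open>t\<close>. The subtracted \<open>a \<bullet> b\<close> stems from the
  Gaussian weight.\<close>

definition lhess :: "real \<Rightarrow> ('a::euclidean_space \<Rightarrow> real) \<Rightarrow> 'a \<Rightarrow> 'a \<Rightarrow> 'a \<Rightarrow> real" where
  "lhess t u x a b = (tmean t u x (\<lambda>y. (y \<bullet> a) * (y \<bullet> b))
     - tmean t u x (\<lambda>y. y \<bullet> a) * tmean t u x (\<lambda>y. y \<bullet> b) - a \<bullet> b) / t"

locale lip =
  fixes u :: "'a::euclidean_space \<Rightarrow> real" and L :: real
  assumes lipschitz: "L-lipschitz_on UNIV u"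
begin

lemma L0: "L \<ge> 0"
  using lipschitz by (rule lipschitz_on_nonneg)

lemma lip_le: "u x \<le> u y + L * norm (x - y)"
  using lipschitz_onD[OF lipschitz, of x y] by (auto simp: dist_norm abs_le_iff)

lemma lip_add: "u (x + y) \<le> u x + L * norm y" "u x - L * norm y \<le> u (x + y)"
  using lip_le[of "x + y" x] lip_le[of x "x + y"] by auto

lemma continuous_u: "continuous_on S u"
  using lipschitz_on_continuous_on[OF lipschitz] continuous_on_subset by blast

lemma measurable_u [measurable]: "u \<in> borel_measurable borel"
  by (rule borel_measurable_continuous_onI) (rule continuous_u)

abbreviation weight :: "real \<Rightarrow> 'a \<Rightarrow> 'a \<Rightarrow> real" where
  "weight t x y \<equiv> exp (u (x + sqrt t *\<^sub>R y))"

lemma weight_le: "t \<ge> 0 \<Longrightarrow> weight t x y \<le> exp (u x) * exp (L * sqrt t * norm y)"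
  and weight_ge: "t \<ge> 0 \<Longrightarrow> exp (u x) * exp (- (L * sqrt t) * norm y) \<le> weight t x y"
  using lip_add[of x "sqrt t *\<^sub>R y"] by (auto simp: mult.assoc simp flip: exp_add)

text \<open>A Lipschitz \<open>u\<close> adds only a linear term to the exponent, which the Gaussian
  decay absorbs. The quadratic term in the bound on \<open>h\<close> is there for the time
  derivative.\<close>

lemma integrable_weight:
  assumes [measurable]: "h \<in> borel_measurable borel" and t: "t \<ge> 0" and \<theta>: "\<theta> < 1"
    and h: "\<And>y. \<bar>h y\<bar> \<le> A * exp (r * norm y + \<theta> * ((norm y)\<^sup>2 / 2))"
  shows "integrable std_gauss (\<lambda>y. weight t x y * h y)"
proof (rule Bochner_Integration.integrable_bound)
  show "integrable (std_gauss::'a measure) (\<lambda>y. exp (u x) * A * exp ((r + L * sqrt t) * norm y + \<theta> * ((norm y)\<^sup>2 / 2)))"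
    by (intro integrable_mult_right integrable_std_gauss_exp \<theta>)
  have "norm (weight t x y * h y) \<le> norm (exp (u x) * A * exp ((r + L * sqrt t) * norm y + \<theta> * ((norm y)\<^sup>2 / 2)))" for y
  proof -
    have "norm (weight t x y * h y) = weight t x y * \<bar>h y\<bar>"
      by (simp add: abs_mult)
    also have "\<dots> \<le> (exp (u x) * exp (L * sqrt t * norm y)) * (A * exp (r * norm y + \<theta> * ((norm y)\<^sup>2 / 2)))"
      using t by (intro mult_mono weight_le h) auto
    also have "\<dots> = exp (u x) * A * exp ((r + L * sqrt t) * norm y + \<theta> * ((norm y)\<^sup>2 / 2))"
      by (simp add: distrib_right exp_add)
    finally show ?thesis by (metis abs_ge_self order_trans real_norm_def)
  qed
  then show "AE y in std_gauss. norm (weight t x y * h y)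
     \<le> norm (exp (u x) * A * exp ((r + L * sqrt t) * norm y + \<theta> * ((norm y)\<^sup>2 / 2)))" by simp
qed measurable

lemma integrable_weight_exp:
  assumes [measurable]: "h \<in> borel_measurable borel" and t: "t \<ge> 0"
    and h: "\<And>y. \<bar>h y\<bar> \<le> A * exp (r * norm y)"
  shows "integrable std_gauss (\<lambda>y. weight t x y * h y)"
  by (rule integrable_weight[where \<theta>=0 and A=A and r=r]) (use assms in auto)

lemma integrable_weight_1: "t \<ge> 0 \<Longrightarrow> integrable std_gauss (\<lambda>y. weight t x y)"
  using integrable_weight_exp[of "\<lambda>_. 1" t 1 0 x] by simp

lemma Z_pos: "t \<ge> 0 \<Longrightarrow> (LINT y|std_gauss. weight t x y) > 0"
  by (intro std_gauss_integral_pos integrable_weight_1) auto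

lemma exp_lheat: "t \<ge> 0 \<Longrightarrow> exp (lheat t u x) = (LINT y|std_gauss. weight t x y)"
  unfolding lheat_def using Z_pos by simp

lemma nn_exp_lheat: "t \<ge> 0 \<Longrightarrow> ennreal (exp (lheat t u x)) = (\<integral>\<^sup>+y. ennreal (weight t x y) \<partial>std_gauss)"
  unfolding exp_lheat by (subst nn_integral_eq_integral[OF integrable_weight_1]) auto

lemma lheat_0 [simp]: "lheat 0 u x = u x"
  by (simp add: lheat_def std_gauss.prob_space[simplified])

text \<open>Averaging translates of \<open>exp u\<close> keeps the constant \<open>L\<close>, so the
  flow can be restarted from any time within the same locale.\<close>

lemma lheat_lipschitz: "t \<ge> 0 \<Longrightarrow> L-lipschitz_on UNIV (lheat t u)"
proof (rule lipschitz_onI)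
  fix x y :: 'a assume t: "t \<ge> 0"
  have *: "lheat t u x \<le> lheat t u y + L * norm (x - y)" for x y
  proof -
    have "exp (lheat t u x) \<le> (LINT z|std_gauss. exp (L * norm (x - y)) * exp (u (y + sqrt t *\<^sub>R z)))"
      unfolding exp_lheat[OF t]
    proof (rule integral_mono)
      show "exp (u (x + sqrt t *\<^sub>R z)) \<le> exp (L * norm (x - y)) * exp (u (y + sqrt t *\<^sub>R z))" for z
        using lip_le[of "x + sqrt t *\<^sub>R z" "y + sqrt t *\<^sub>R z"] by (simp add: exp_add[symmetric])
    qed (intro integrable_mult_right integrable_weight_1 t)+
    also have "\<dots> = exp (lheat t u y + L * norm (x - y))"
      by (simp add: exp_lheat[OF t, symmetric] exp_add)
    finally show ?thesis by simp
  qed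
  show "dist (lheat t u x) (lheat t u y) \<le> L * dist x y"
    using *[of x y] *[of y x] by (simp add: dist_norm abs_le_iff norm_minus_commute)
qed (rule L0)

text \<open>The weight lies between multiples of \<open>exp (u x)\<close> that depend on
  \<open>y\<close> and \<open>T\<close> only, so the bound is uniform in \<open>x\<close>. It bounds
  the deficit from below and later yields coercivity on the fibres.\<close>

lemma lheat_near:
  assumes "T \<ge> 0"
  obtains M where "\<And>t x. 0 \<le> t \<Longrightarrow> t \<le> T \<Longrightarrow> \<bar>lheat t u x - u x\<bar> \<le> M"
proof
  define I where "I r = (LINT (y::'a)|std_gauss. exp (r * norm y))" for r
  have int: "integrable (std_gauss::'a measure) (\<lambda>y. exp (r * norm y))" for r
    using integrable_std_gauss_exp[of 0 r] by simp
  have pos: "I r > 0" for r unfolding I_def by (intro std_gauss_integral_pos int) auto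
  fix t x assume t: "0 \<le> t" "t \<le> T"
  define R where "R = L * sqrt T"
  have LR: "L * sqrt t \<le> R" unfolding R_def using t L0 by (intro mult_left_mono) auto
  have "exp (lheat t u x) \<le> (LINT y|std_gauss. exp (u x) * exp (R * norm (y::'a)))"
    unfolding exp_lheat[OF t(1)]
  proof (rule integral_mono)
    show "weight t x y \<le> exp (u x) * exp (R * norm y)" for y
      using LR by (intro order_trans[OF weight_le[OF t(1)]] mult_left_mono) (auto intro: mult_right_mono)
  qed (intro integrable_mult_right integrable_weight_1 t int)+
  also have "\<dots> = exp (u x + ln (I R))" using pos by (simp add: I_def exp_add)
  finally have 1: "lheat t u x - u x \<le> ln (I R)" by simp
  have "exp (u x + ln (I (- R))) = (LINT y|std_gauss. exp (u x) * exp (- R * norm (y::'a)))"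
    using pos[of "- R"] by (simp add: I_def exp_add)
  also have "\<dots> \<le> exp (lheat t u x)"
    unfolding exp_lheat[OF t(1)]
  proof (rule integral_mono)
    show "exp (u x) * exp (- R * norm y) \<le> weight t x y" for y
      using LR by (intro order_trans[OF _ weight_ge[OF t(1)]] mult_left_mono) (auto intro: mult_right_mono)
  qed (intro integrable_mult_right integrable_weight_1 t int)+
  finally have 2: "ln (I (- R)) \<le> lheat t u x - u x" by simp
  show "\<bar>lheat t u x - u x\<bar> \<le> \<bar>ln (I R)\<bar> + \<bar>ln (I (- R))\<bar>"
    using 1 2 by linarith
qed

text \<open>Time 0 is included because the maximum principle minimises over a closed time
  interval.\<close>

lemma continuous_on_lheat: "continuous_on ({0..} \<times> UNIV) (\<lambda>(t, x). lheat t u x)"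
proof (rule continuous_on_sequentiallyI)
  fix p :: "nat \<Rightarrow> real \<times> 'a" and q
  assume p: "\<forall>n. p n \<in> {0..} \<times> UNIV" and q: "q \<in> {0..} \<times> UNIV" and lim: "p \<longlonglongrightarrow> q"
  define t x where "t n = fst (p n)" and "x n = snd (p n)" for n
  have t: "t n \<ge> 0" for n using p[rule_format, of n] by (auto simp: t_def mem_Times_iff)
  have tl: "t \<longlonglongrightarrow> fst q" and xl: "x \<longlonglongrightarrow> snd q"
    unfolding t_def x_def using lim by (auto intro: tendsto_intros)
  have fq: "fst q \<ge> 0" using q by auto
  obtain T where T: "\<And>n. norm (t n) \<le> T" using tl convergent_imp_Bseq[OF convergentI[OF tl]] by (auto simp: Bseq_def)
  obtain X where X: "\<And>n. norm (x n) \<le> X" using xl convergent_imp_Bseq[OF convergentI[OF xl]] by (auto simp: Bseq_def)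
  have "(\<lambda>n. LINT y|std_gauss. exp (u (x n + sqrt (t n) *\<^sub>R y))) \<longlonglongrightarrow> (LINT y|std_gauss. exp (u (snd q + sqrt (fst q) *\<^sub>R y)))"
  proof (rule integral_dominated_convergence)
    show "integrable (std_gauss::'a measure) (\<lambda>y. exp (u 0 + L * X) * exp ((L * sqrt T) * norm y + 0 * ((norm y)\<^sup>2 / 2)))"
      by (intro integrable_mult_right integrable_std_gauss_exp) simp
    show "AE y in std_gauss. (\<lambda>n. exp (u (x n + sqrt (t n) *\<^sub>R y))) \<longlonglongrightarrow> exp (u (snd q + sqrt (fst q) *\<^sub>R y))"
    proof (intro AE_I2 tendsto_exp)
      fix y :: 'a
      have "(\<lambda>n. x n + sqrt (t n) *\<^sub>R y) \<longlonglongrightarrow> snd q + sqrt (fst q) *\<^sub>R y"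
        by (intro tendsto_intros tl xl)
      then show "(\<lambda>n. u (x n + sqrt (t n) *\<^sub>R y)) \<longlonglongrightarrow> u (snd q + sqrt (fst q) *\<^sub>R y)"
        using continuous_u[of UNIV] by (auto intro: continuous_on_tendsto_compose)
    qed
    show "AE y in std_gauss. norm (exp (u (x n + sqrt (t n) *\<^sub>R y))) \<le> exp (u 0 + L * X) * exp ((L * sqrt T) * norm y + 0 * ((norm y)\<^sup>2 / 2))" for n
    proof (intro AE_I2)
      fix y :: 'a
      have "u (x n + sqrt (t n) *\<^sub>R y) \<le> u (x n) + L * (sqrt (t n) * norm y)"
        using lip_add(1)[of "x n" "sqrt (t n) *\<^sub>R y"] t[of n] by simp
      moreover have "u (x n) \<le> u 0 + L * norm (x n)" using lip_add(1)[of 0 "x n"] by simp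
      moreover have "L * norm (x n) \<le> L * X" using X L0 by (intro mult_left_mono) auto
      moreover have "L * (sqrt (t n) * norm y) \<le> L * (sqrt T * norm y)"
        using T[of n] L0 by (intro mult_left_mono mult_right_mono) auto
      ultimately show "norm (exp (u (x n + sqrt (t n) *\<^sub>R y))) \<le> exp (u 0 + L * X) * exp ((L * sqrt T) * norm y + 0 * ((norm y)\<^sup>2 / 2))"
        by (simp add: exp_add[symmetric] mult.assoc)
    qed
  qed auto
  then have "(\<lambda>n. lheat (t n) u (x n)) \<longlonglongrightarrow> lheat (fst q) u (snd q)"
    unfolding lheat_def using Z_pos[OF fq, of "snd q"] by (intro tendsto_ln) auto
  then show "(\<lambda>n. case p n of (t, x) \<Rightarrow> lheat t u x) \<longlonglongrightarrow> (case q of (t, x) \<Rightarrow> lheat t u x)"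
    by (simp add: t_def x_def case_prod_beta)
qed

lemma lheat_semigroup:
  assumes s: "s > 0" and t: "t > 0"
  shows "lheat s (lheat t u) x = lheat (s + t) u x"
proof -
  interpret H: lip "lheat t u" L
    by standard (use lheat_lipschitz t in auto)
  have "ennreal (exp (lheat s (lheat t u) x)) = (\<integral>\<^sup>+z. \<integral>\<^sup>+y. ennreal (exp (u (x + (sqrt s *\<^sub>R z + sqrt t *\<^sub>R y)))) \<partial>std_gauss \<partial>std_gauss)"
    using s t by (simp add: H.nn_exp_lheat nn_exp_lheat add.assoc)
  also have "\<dots> = (\<integral>\<^sup>+y. ennreal (exp (u (x + sqrt (s + t) *\<^sub>R y))) \<partial>std_gauss)"
    by (rule nn_integral_std_gauss_convolution[OF _ s t]) measurable
  also have "\<dots> = ennreal (exp (lheat (s + t) u x))"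
    using s t by (simp add: nn_exp_lheat)
  finally show ?thesis by simp
qed

end

section \<open>Space and time derivatives of the logarithmic heat flow\<close>

context lip
begin

text \<open>Cameron-Martin along \<open>a\<close>: the dependence on the base point turns into a
  Laplace parameter \<open>s\<close>, an explicit Gaussian factor and a shift inside
  \<open>q\<close>.\<close>

lemma weight_shift:
  assumes t: "t > 0" and [measurable]: "q \<in> borel_measurable borel"
  shows "(LINT y|std_gauss. weight t (x + s *\<^sub>R a) y * q y)
    = exp (- (s\<^sup>2 * (norm a)\<^sup>2 / (2 * t)))
      * (LINT y|std_gauss. weight t x y * q (y - (s / sqrt t) *\<^sub>R a) * exp (s * ((a \<bullet> y) / sqrt t)))"
proof -
  define c where "c = (s / sqrt t) *\<^sub>R a"
  define h where "h y = weight t x y * q (y - c)" for y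
  have [measurable]: "h \<in> borel_measurable borel" unfolding h_def by measurable
  have sc: "sqrt t *\<^sub>R c = s *\<^sub>R a" using t by (simp add: c_def)
  have nc: "(norm c)\<^sup>2 / 2 = s\<^sup>2 * (norm a)\<^sup>2 / (2 * t)"
    using t by (simp add: c_def power_mult_distrib power_divide)
  have ca: "c \<bullet> y = s * ((a \<bullet> y) / sqrt t)" for y by (simp add: c_def)
  have "h (c + y) = weight t (x + s *\<^sub>R a) y * q y" for y
    by (simp add: h_def scaleR_add_right sc add.assoc)
  then have "(LINT y|std_gauss. weight t (x + s *\<^sub>R a) y * q y) = (LINT y|std_gauss. h (c + y))"
    by simp
  also have "\<dots> = (LINT y|std_gauss. exp (c \<bullet> y - (norm c)\<^sup>2 / 2) * h y)"
    by (rule integral_std_gauss_translate) measurable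
  also have "\<dots> = (LINT y|std_gauss. exp (- (s\<^sup>2 * (norm a)\<^sup>2 / (2 * t))) * (h y * exp (s * ((a \<bullet> y) / sqrt t))))"
    unfolding nc ca diff_conv_add_uminus exp_add by (simp add: mult_ac)
  also have "\<dots> = exp (- (s\<^sup>2 * (norm a)\<^sup>2 / (2 * t))) * (LINT y|std_gauss. h y * exp (s * ((a \<bullet> y) / sqrt t)))"
    by simp
  finally show ?thesis unfolding h_def c_def .
qed

lemma
  assumes t: "t > 0" and [measurable]: "q \<in> borel_measurable borel"
    and q: "\<And>y. \<bar>q y\<bar> \<le> A * exp (r * norm y)"
  shows weight_laplace_integrable: "\<bar>s\<bar> < 1 \<Longrightarrow> integrable std_gauss (\<lambda>y. weight t x y * q y * exp (s * ((a \<bullet> y) / sqrt t)))"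
    and weight_laplace_deriv: "((\<lambda>s. LINT y|std_gauss. weight t x y * q y * exp (s * ((a \<bullet> y) / sqrt t)))
    has_real_derivative (LINT y|std_gauss. weight t x y * (q y * ((a \<bullet> y) / sqrt t)))) (at 0)"
proof -
  have int: "integrable std_gauss (\<lambda>y. (weight t x y * q y) * exp (1 * \<bar>(a \<bullet> y) / sqrt t\<bar>))"
    unfolding mult.assoc
  proof (rule integrable_weight_exp)
    fix y :: 'a
    have "\<bar>a \<bullet> y\<bar> / sqrt t \<le> norm a / sqrt t * norm y"
      using Cauchy_Schwarz_ineq2[of a y] t by (simp add: divide_right_mono)
    then have "\<bar>q y\<bar> * exp (\<bar>a \<bullet> y\<bar> / sqrt t) \<le> (A * exp (r * norm y)) * exp (norm a / sqrt t * norm y)"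
      by (intro mult_mono q) (auto intro: order_trans[OF abs_ge_zero q])
    then show "\<bar>q y * exp (1 * \<bar>(a \<bullet> y) / sqrt t\<bar>)\<bar> \<le> A * exp ((r + norm a / sqrt t) * norm y)"
      using t by (simp add: abs_mult distrib_right exp_add)
  qed (use t in auto)
  note L = integrable_laplace[OF _ _ int] has_derivative_laplace[OF _ _ int, of 0]
  show "integrable std_gauss (\<lambda>y. weight t x y * q y * exp (s * ((a \<bullet> y) / sqrt t)))" if "\<bar>s\<bar> < 1"
    by (rule L(1)) (use that in auto)
  show "((\<lambda>s. LINT y|std_gauss. weight t x y * q y * exp (s * ((a \<bullet> y) / sqrt t)))
    has_real_derivative (LINT y|std_gauss. weight t x y * (q y * ((a \<bullet> y) / sqrt t)))) (at 0)"
    using L(2) by (simp add: mult.assoc)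
qed

lemma inner_exp_bound: "\<bar>y \<bullet> b\<bar> \<le> norm b * exp (1 * norm (y::'a))"
proof -
  have "norm y \<le> exp (norm y)" using exp_ge_add_one_self[of "norm y"] by linarith
  then have "norm b * norm y \<le> norm b * exp (norm y)" by (intro mult_left_mono) auto
  then show ?thesis using Cauchy_Schwarz_ineq2[of y b] by (simp add: mult.commute)
qed

lemma inner2_exp_bound: "\<bar>(y \<bullet> a) * (y \<bullet> b)\<bar> \<le> (norm a * norm b) * exp (2 * norm (y::'a))"
proof -
  have "\<bar>(y \<bullet> a) * (y \<bullet> b)\<bar> \<le> (norm a * exp (1 * norm y)) * (norm b * exp (1 * norm y))"
    unfolding abs_mult by (intro mult_mono inner_exp_bound) auto
  then show ?thesis by (simp add: exp_add[symmetric] mult_ac)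
qed

lemma integrable_weight_inner:
  "t > 0 \<Longrightarrow> integrable std_gauss (\<lambda>y. weight t x y * (y \<bullet> b))"
  by (rule integrable_weight_exp[where A="norm b" and r=1]) (use inner_exp_bound in auto)

lemma integrable_weight_inner2:
  "t > 0 \<Longrightarrow> integrable std_gauss (\<lambda>y. weight t x y * ((y \<bullet> a) * (y \<bullet> b)))"
  by (rule integrable_weight_exp[where A="norm a * norm b" and r=2]) (use inner2_exp_bound in auto)

lemma tmean_add_scale:
  assumes t: "t > 0" and "integrable std_gauss (\<lambda>y. weight t x y * g y)"
    "integrable std_gauss (\<lambda>y. weight t x y * h y)"
  shows "tmean t u x (\<lambda>y. g y + r * h y) = tmean t u x g + r * tmean t u x h"
proof -
  have "(LINT y|std_gauss. weight t x y * (g y + r * h y))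
     = (LINT y|std_gauss. weight t x y * g y + r * (weight t x y * h y))"
    by (simp add: algebra_simps)
  also have "\<dots> = (LINT y|std_gauss. weight t x y * g y) + r * (LINT y|std_gauss. weight t x y * h y)"
    using assms by simp
  finally show ?thesis by (simp add: tmean_def add_divide_distrib)
qed

lemma linear_lgrad:
  assumes t: "t > 0"
  shows "linear (lgrad t u x)"
proof -
  have *: "lgrad t u x (a + r *\<^sub>R b) = lgrad t u x a + r * lgrad t u x b" for a b r
    unfolding lgrad_def using tmean_add_scale[OF t integrable_weight_inner[OF t] integrable_weight_inner[OF t], of x a r b]
    by (simp add: inner_add_right add_divide_distrib)
  have 0: "lgrad t u x 0 = 0" using *[of 0 1 0] by simp
  show ?thesis using *[of _ 1] *[of 0] 0 by (intro linearI) auto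
qed

lemma lhess_sym: "lhess t u x a b = lhess t u x b a"
  by (simp add: lhess_def mult.commute inner_commute)

lemma linear_lhess:
  assumes t: "t > 0"
  shows "linear (lhess t u x a)"
proof -
  have *: "lhess t u x a (b + r *\<^sub>R c) = lhess t u x a b + r * lhess t u x a c" for b c r
  proof -
    have 1: "tmean t u x (\<lambda>y. y \<bullet> (b + r *\<^sub>R c)) = tmean t u x (\<lambda>y. y \<bullet> b) + r * tmean t u x (\<lambda>y. y \<bullet> c)"
      using tmean_add_scale[OF t integrable_weight_inner[OF t] integrable_weight_inner[OF t], of x b r c]
      by (simp add: inner_add_right)
    have 2: "tmean t u x (\<lambda>y. (y \<bullet> a) * (y \<bullet> (b + r *\<^sub>R c))) = tmean t u x (\<lambda>y. (y \<bullet> a) * (y \<bullet> b)) + r * tmean t u x (\<lambda>y. (y \<bullet> a) * (y \<bullet> c))"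
      using tmean_add_scale[OF t integrable_weight_inner2[OF t] integrable_weight_inner2[OF t], of x a b r a c]
      by (simp add: inner_add_right algebra_simps)
    show ?thesis unfolding lhess_def 1 2 using t
      by (simp add: inner_add_right divide_simps) (simp add: algebra_simps)
  qed
  have 0: "lhess t u x a 0 = 0" using *[of 0 1 0] by simp
  show ?thesis using *[of _ 1] *[of 0] 0 by (intro linearI) auto
qed

lemma lheat_has_derivative_0:
  assumes t: "t > 0"
  shows "((\<lambda>s. lheat t u (x + s *\<^sub>R a)) has_real_derivative lgrad t u x a) (at 0)"
proof -
  define F where "F s = (LINT y|std_gauss. weight t x y * 1 * exp (s * ((a \<bullet> y) / sqrt t)))" for s
  define Z where "Z = (LINT y|std_gauss. weight t x y)"
  have Z: "Z > 0" unfolding Z_def using Z_pos t by simp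
  have F0: "F 0 = Z" by (simp add: F_def Z_def)
  define N where "N = (LINT y|std_gauss. weight t x y * (y \<bullet> a))"
  have F': "(F has_real_derivative N / sqrt t) (at 0)"
    using weight_laplace_deriv[OF t, of "\<lambda>_. 1" 1 0 x a] unfolding F_def[abs_def] N_def by (simp add: inner_commute)
  have eq: "lheat t u (x + s *\<^sub>R a) = ln (exp (- (s\<^sup>2 * (norm a)\<^sup>2 / (2 * t))) * F s)" for s
    unfolding lheat_def F_def using weight_shift[OF t, of "\<lambda>_. 1" x s a] by simp
  have "((\<lambda>s. ln (exp (- (s\<^sup>2 * (norm a)\<^sup>2 / (2 * t))) * F s)) has_real_derivative N / sqrt t / Z) (at 0)"
    using Z F0 t by (auto intro!: derivative_eq_intros F')
  then show ?thesis unfolding eq lgrad_def tmean_def N_def Z_def by (simp add: mult.commute)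
qed

lemma lgrad_has_derivative_0:
  assumes t: "t > 0"
  shows "((\<lambda>s. lgrad t u (x + s *\<^sub>R a) b) has_real_derivative lhess t u x a b) (at 0)"
proof -
  define W where "W q s = (LINT y|std_gauss. weight t x y * q y * exp (s * ((a \<bullet> y) / sqrt t)))" for q s
  define F where "F = W (\<lambda>_. 1)"
  define G where "G = W (\<lambda>y. y \<bullet> b)"
  define Z where "Z = (LINT y|std_gauss. weight t x y)"
  have Z: "Z > 0" unfolding Z_def using Z_pos t by simp
  define e where "e s = exp (- (s\<^sup>2 * (norm a)\<^sup>2 / (2 * t)))" for s
  have e: "e s > 0" for s by (simp add: e_def)
  have F0: "F 0 = Z" by (simp add: F_def W_def Z_def)
  define Na where "Na = (LINT y|std_gauss. weight t x y * (y \<bullet> a))"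
  define Nb where "Nb = (LINT y|std_gauss. weight t x y * (y \<bullet> b))"
  define Nab where "Nab = (LINT y|std_gauss. weight t x y * ((y \<bullet> a) * (y \<bullet> b)))"
  have G0: "G 0 = Nb" by (simp add: G_def W_def Nb_def)
  have F': "(F has_real_derivative Na / sqrt t) (at 0)"
    using weight_laplace_deriv[OF t, of "\<lambda>_. 1" 1 0 x a] unfolding F_def W_def[abs_def] Na_def by (simp add: inner_commute)
  have G': "(G has_real_derivative Nab / sqrt t) (at 0)"
    using weight_laplace_deriv[OF t _ inner_exp_bound, of b x a] unfolding G_def W_def[abs_def] Nab_def
    by (simp add: inner_commute mult_ac)
  have Fpos: "F s > 0" if "\<bar>s\<bar> < 1" for s
    unfolding F_def W_def
    by (intro std_gauss_integral_pos weight_laplace_integrable[OF t, where A=1 and r=0]) (use that in auto)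
  \<comment> \<open>The factor \<open>e s\<close> cancels in the quotient \<open>lgrad\<close>; the
    shift inside the numerator leaves the term that becomes \<open>- (a \<bullet> b)\<close> in the
    Hessian.\<close>
  have eqF: "(LINT y|std_gauss. weight t (x + s *\<^sub>R a) y) = e s * F s" for s
    using weight_shift[OF t, of "\<lambda>_. 1" x s a] by (simp add: e_def F_def W_def)
  have eqG: "(LINT y|std_gauss. weight t (x + s *\<^sub>R a) y * (y \<bullet> b)) = e s * (G s - s / sqrt t * (a \<bullet> b) * F s)"
    if s: "\<bar>s\<bar> < 1" for s
  proof -
    have "(LINT y|std_gauss. weight t x y * ((y - (s / sqrt t) *\<^sub>R a) \<bullet> b) * exp (s * ((a \<bullet> y) / sqrt t)))
      = (LINT y|std_gauss. weight t x y * (y \<bullet> b) * exp (s * ((a \<bullet> y) / sqrt t))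
         - (s / sqrt t * (a \<bullet> b)) * (weight t x y * 1 * exp (s * ((a \<bullet> y) / sqrt t))))"
      by (simp add: inner_diff_left algebra_simps)
    also have "\<dots> = G s - (s / sqrt t * (a \<bullet> b)) * F s"
    proof -
      have 1: "integrable std_gauss (\<lambda>y. weight t x y * (y \<bullet> b) * exp (s * ((a \<bullet> y) / sqrt t)))"
        by (rule weight_laplace_integrable[OF t _ inner_exp_bound s]) measurable
      have 2: "integrable std_gauss (\<lambda>y. weight t x y * 1 * exp (s * ((a \<bullet> y) / sqrt t)))"
        by (rule weight_laplace_integrable[OF t, where A=1 and r=0]) (use s in auto)
      show ?thesis unfolding G_def F_def W_def
        using Bochner_Integration.integral_diff[OF 1 integrable_mult_right[OF 2, of "s / sqrt t * (a \<bullet> b)"]]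
        by (simp only: integral_mult_right_zero)
    qed
    finally show ?thesis using weight_shift[OF t, of "\<lambda>y. y \<bullet> b" x s a] by (simp add: e_def)
  qed
  have eq: "lgrad t u (x + s *\<^sub>R a) b = (G s / F s - s / sqrt t * (a \<bullet> b)) / sqrt t" if s: "\<bar>s\<bar> < 1" for s
    unfolding lgrad_def tmean_def eqF eqG[OF s] using e[of s] Fpos[OF s] by (simp add: diff_divide_distrib)
  have "((\<lambda>s. (G s / F s - s / sqrt t * (a \<bullet> b)) / sqrt t) has_real_derivative
      ((Nab / sqrt t * Z - Nb * (Na / sqrt t)) / (Z * Z) - 1 / sqrt t * (a \<bullet> b)) / sqrt t) (at 0)"
  proof -
    have "((\<lambda>s. G s / F s) has_real_derivative (Nab / sqrt t * F 0 - G 0 * (Na / sqrt t)) / (F 0 * F 0)) (at 0)"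
      using Z F0 by (intro DERIV_divide F' G') auto
    moreover have "((\<lambda>s. s / sqrt t * (a \<bullet> b)) has_real_derivative 1 / sqrt t * (a \<bullet> b)) (at 0)"
      by (intro DERIV_cmult_right DERIV_cdivide DERIV_ident)
    ultimately show ?thesis
      unfolding F0 G0 by (intro DERIV_cdivide DERIV_diff)
  qed
  moreover have "((Nab / sqrt t * Z - Nb * (Na / sqrt t)) / (Z * Z) - 1 / sqrt t * (a \<bullet> b)) / sqrt t = lhess t u x a b"
  proof -
    have "lhess t u x a b = (Nab / Z - (Na / Z) * (Nb / Z) - a \<bullet> b) / (sqrt t * sqrt t)"
      unfolding lhess_def tmean_def Nab_def Na_def Nb_def Z_def using t by simp
    also have "\<dots> = ((Nab / sqrt t * Z - Nb * (Na / sqrt t)) / (Z * Z) - 1 / sqrt t * (a \<bullet> b)) / sqrt t"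
      using Z t by (simp add: divide_simps del: real_sqrt_mult_self)
    finally show ?thesis by simp
  qed
  ultimately have "((\<lambda>s. (G s / F s - s / sqrt t * (a \<bullet> b)) / sqrt t) has_real_derivative lhess t u x a b) (at 0)"
    by simp
  moreover have "\<forall>\<^sub>F s in nhds 0. lgrad t u (x + s *\<^sub>R a) b = (G s / F s - s / sqrt t * (a \<bullet> b)) / sqrt t"
    unfolding eventually_nhds_metric by (intro exI[of _ 1]) (auto simp: eq)
  ultimately show ?thesis
    by (subst DERIV_cong_ev[OF refl _ refl]) auto
qed

lemma lheat_has_derivative:
  assumes t: "t > 0"
  shows "((\<lambda>s. lheat t u (x + s *\<^sub>R a)) has_real_derivative lgrad t u (x + s *\<^sub>R a) a) (at s)"
proof -
  have "((\<lambda>r. lheat t u (x + (s + r) *\<^sub>R a)) has_real_derivative lgrad t u (x + s *\<^sub>R a) a) (at 0)"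
    using lheat_has_derivative_0[OF t, of "x + s *\<^sub>R a" a] by (simp add: scaleR_add_left add.assoc)
  then show ?thesis
    using DERIV_shift[of "\<lambda>s. lheat t u (x + s *\<^sub>R a)" _ 0 s] by (simp add: add.commute)
qed

lemma lgrad_has_derivative:
  assumes t: "t > 0"
  shows "((\<lambda>s. lgrad t u (x + s *\<^sub>R a) b) has_real_derivative lhess t u (x + s *\<^sub>R a) a b) (at s)"
proof -
  have "((\<lambda>r. lgrad t u (x + (s + r) *\<^sub>R a) b) has_real_derivative lhess t u (x + s *\<^sub>R a) a b) (at 0)"
    using lgrad_has_derivative_0[OF t, of "x + s *\<^sub>R a" a b] by (simp add: scaleR_add_left add.assoc)
  then show ?thesis
    using DERIV_shift[of "\<lambda>s. lgrad t u (x + s *\<^sub>R a) b" _ 0 s] by (simp add: add.commute)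
qed

lemma lgrad_bound:
  assumes t: "t > 0"
  shows "\<bar>lgrad t u x a\<bar> \<le> L * norm a"
proof (rule tendsto_upperbound)
  show "((\<lambda>h. \<bar>(lheat t u (x + h *\<^sub>R a) - lheat t u (x + 0 *\<^sub>R a)) / h\<bar>) \<longlongrightarrow> \<bar>lgrad t u x a\<bar>) (at 0)"
    using lheat_has_derivative_0[OF t, of x a] by (intro tendsto_rabs) (simp add: has_field_derivative_iff)
  have lp: "L-lipschitz_on UNIV (lheat t u)" using t by (intro lheat_lipschitz) auto
  have "\<bar>(lheat t u (x + h *\<^sub>R a) - lheat t u (x + 0 *\<^sub>R a)) / h\<bar> \<le> L * norm a" if "h \<noteq> 0" for h
    using lipschitz_onD[OF lp, of "x + h *\<^sub>R a" x] that by (simp add: dist_norm divide_simps mult_ac)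
  then show "\<forall>\<^sub>F h in at 0. \<bar>(lheat t u (x + h *\<^sub>R a) - lheat t u (x + 0 *\<^sub>R a)) / h\<bar> \<le> L * norm a"
    by (auto simp: eventually_at_filter)
qed simp

text \<open>The squared first moments cancel between Hessian and gradient. What remains is the
  second moment that the time derivative produces.\<close>

lemma trace_lhess:
  assumes t: "t > 0"
  shows "(\<Sum>b\<in>Basis. lhess t u x b b + (lgrad t u x b)\<^sup>2) = (tmean t u x (\<lambda>y. (norm y)\<^sup>2) - DIM('a)) / t"
proof -
  have "(LINT y|std_gauss. weight t x y * (norm y)\<^sup>2)
     = (LINT y|std_gauss. (\<Sum>b\<in>Basis. weight t x y * ((y \<bullet> b) * (y \<bullet> b))))"
  proof (intro Bochner_Integration.integral_cong refl)
    fix y :: 'a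
    have "(norm y)\<^sup>2 = (\<Sum>b\<in>Basis. (y \<bullet> b) * (y \<bullet> b))"
      unfolding power2_norm_eq_inner by (rule euclidean_inner)
    then show "weight t x y * (norm y)\<^sup>2 = (\<Sum>b\<in>Basis. weight t x y * ((y \<bullet> b) * (y \<bullet> b)))"
      by (simp add: sum_distrib_left)
  qed
  also have "\<dots> = (\<Sum>b\<in>Basis. LINT y|std_gauss. weight t x y * ((y \<bullet> b) * (y \<bullet> b)))"
    by (intro Bochner_Integration.integral_sum integrable_weight_inner2 t)
  finally have m: "tmean t u x (\<lambda>y. (norm y)\<^sup>2) = (\<Sum>b\<in>Basis. tmean t u x (\<lambda>y. (y \<bullet> b) * (y \<bullet> b)))"
    by (simp add: tmean_def sum_divide_distrib)
  have "(\<Sum>b\<in>Basis. lhess t u x b b + (lgrad t u x b)\<^sup>2) = (\<Sum>b\<in>Basis. (tmean t u x (\<lambda>y. (y \<bullet> b) * (y \<bullet> b)) - 1) / t)"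
    using t by (intro sum.cong refl) (simp add: lhess_def lgrad_def power_divide power2_eq_square diff_divide_distrib)
  then show ?thesis by (simp add: m sum_divide_distrib[symmetric] sum_subtractf)
qed

text \<open>The heat equation for the logarithm. Dilating the Gaussian turns time \<open>s\<close>
  into the Laplace parameter \<open>1 - t / s\<close> of half the squared norm, which is 0 at
  \<open>s = t\<close>; \<open>trace_lhess\<close> identifies the resulting second moment.\<close>

lemma lheat_time_derivative:
  assumes t: "t > 0"
  shows "((\<lambda>s. lheat s u x) has_real_derivative (\<Sum>b\<in>Basis. lhess t u x b b + (lgrad t u x b)\<^sup>2) / 2) (at t)"
proof -
  let ?n = "real DIM('a)"
  define \<xi> where "\<xi> y = (norm y)\<^sup>2 / 2" for y :: 'a
  define F where "F s = (LINT y|std_gauss. weight t x y * exp (s * \<xi> y))" for s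
  define Z where "Z = (LINT y|std_gauss. weight t x y)"
  define N where "N = (LINT y|std_gauss. weight t x y * (norm y)\<^sup>2)"
  have Z: "Z > 0" unfolding Z_def using Z_pos t by simp
  have F0: "F 0 = Z" by (simp add: F_def Z_def)
  \<comment> \<open>Every factor below 1 in front of half the squared norm is integrable; 1/2 leaves
    an interval around the parameter 0.\<close>
  have int: "integrable std_gauss (\<lambda>y. weight t x y * exp (1 / 2 * \<bar>\<xi> y\<bar>))"
    unfolding \<xi>_def
    by (rule integrable_weight[where \<theta>="1/2" and A=1 and r=0]) (use t in auto)
  have "(F has_real_derivative (LINT y|std_gauss. weight t x y * \<xi> y * exp (0 * \<xi> y))) (at 0)"
    unfolding F_def[abs_def]
    by (rule has_derivative_laplace[OF _ _ int]) (auto simp: \<xi>_def)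
  then have F': "(F has_real_derivative N / 2) (at 0)"
    unfolding N_def \<xi>_def by simp
  have eq: "lheat s u x = ln (F (1 - t / s)) - ?n / 2 * ln (s / t)" if s: "s > 0" for s
  proof -
    define r where "r = sqrt (s / t)"
    have r: "r > 0" and r2: "r\<^sup>2 = s / t" and sr: "sqrt s = sqrt t * r"
      using s t by (auto simp: r_def real_sqrt_divide power_divide)
    have th: "1 - t / s < 1" using s t by simp
    have int: "integrable std_gauss (\<lambda>y. weight t x y * exp ((1 - t / s) * \<xi> y))"
      unfolding \<xi>_def by (rule integrable_weight[OF _ _ th, where A=1 and r=0]) (use t in auto)
    have Fpos: "F (1 - t / s) > 0"
      unfolding F_def by (intro std_gauss_integral_pos int) auto
    have "ennreal (exp (lheat s u x)) = (\<integral>\<^sup>+y. ennreal (exp (u (x + sqrt t *\<^sub>R (r *\<^sub>R y)))) \<partial>std_gauss)"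
      using s by (simp add: nn_exp_lheat sr)
    also have "\<dots> = ennreal (1 / r ^ DIM('a)) * (\<integral>\<^sup>+y. ennreal (exp ((1 - 1 / r\<^sup>2) * ((norm y)\<^sup>2 / 2))) * ennreal (weight t x y) \<partial>std_gauss)"
      by (rule nn_integral_std_gauss_scale[OF _ r]) measurable
    also have "(\<integral>\<^sup>+y. ennreal (exp ((1 - 1 / r\<^sup>2) * ((norm y)\<^sup>2 / 2))) * ennreal (weight t x y) \<partial>std_gauss)
       = (\<integral>\<^sup>+y. ennreal (weight t x y * exp ((1 - t / s) * \<xi> y)) \<partial>std_gauss)"
      unfolding r2 \<xi>_def by (simp add: mult.commute flip: ennreal_mult)
    also have "\<dots> = ennreal (F (1 - t / s))"
      unfolding F_def by (rule nn_integral_eq_integral[OF int]) auto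
    finally have "exp (lheat s u x) = 1 / r ^ DIM('a) * F (1 - t / s)"
      using r Fpos by (simp flip: ennreal_mult)
    then have "lheat s u x = ln (1 / r ^ DIM('a) * F (1 - t / s))"
      by (metis ln_exp)
    also have "\<dots> = ln (F (1 - t / s)) - ?n * ln r"
      using r Fpos by (simp add: ln_mult ln_div ln_realpow)
    also have "ln r = ln (s / t) / 2"
      unfolding r_def using s t by (simp add: ln_sqrt)
    finally show ?thesis by simp
  qed
  have F1: "(F has_real_derivative N / 2) (at (1 - t / t))" using F' t by simp
  have F10: "F (1 - t / t) = Z" using F0 t by simp
  have "((\<lambda>s. 1 - t / s) has_real_derivative 1 / t) (at t)"
    using t by (auto intro!: derivative_eq_intros simp: power2_eq_square)
  from DERIV_chain2[OF F1 this] have 1: "((\<lambda>s. F (1 - t / s)) has_real_derivative N / 2 * (1 / t)) (at t)" .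
  have "((\<lambda>s. ln (F (1 - t / s)) - ?n / 2 * ln (s / t)) has_real_derivative
      (N / 2 * (1 / t)) / Z - ?n / 2 * (1 / t)) (at t)"
    using t Z F10 by (auto intro!: derivative_eq_intros 1)
  moreover have "(N / 2 * (1 / t)) / Z - ?n / 2 * (1 / t) = (\<Sum>b\<in>Basis. lhess t u x b b + (lgrad t u x b)\<^sup>2) / 2"
    unfolding trace_lhess[OF t] tmean_def N_def[symmetric] Z_def[symmetric] using t Z by (simp add: field_simps)
  ultimately have "((\<lambda>s. ln (F (1 - t / s)) - ?n / 2 * ln (s / t)) has_real_derivative
      (\<Sum>b\<in>Basis. lhess t u x b b + (lgrad t u x b)\<^sup>2) / 2) (at t)" by (simp only:)
  moreover have "\<forall>\<^sub>F s in nhds t. lheat s u x = ln (F (1 - t / s)) - ?n / 2 * ln (s / t)"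
    using eventually_nhds_in_open[of "{0<..}" t] t by (auto elim!: eventually_mono simp: eq)
  ultimately show ?thesis
    by (subst DERIV_cong_ev[OF refl _ refl]) auto
qed

text \<open>Meant for functions of \<open>orth_proj (E i)\<close>, which are constant along the
  complement of \<open>E i\<close>: their flows are constant there too, and the Hessian has no
  entries in these directions.\<close>

lemma
  assumes inv: "\<And>x s. u (x + s *\<^sub>R e) = u x"
  shows lheat_invariant: "lheat t u (x + s *\<^sub>R e) = lheat t u x"
    and lhess_invariant: "t > 0 \<Longrightarrow> lhess t u x e b = 0"
proof -
  have *: "u (x + s *\<^sub>R e + sqrt t *\<^sub>R y) = u (x + sqrt t *\<^sub>R y)" for x s y
    using inv[of "x + sqrt t *\<^sub>R y" s] by (simp add: add_ac)
  show "lheat t u (x + s *\<^sub>R e) = lheat t u x"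
    unfolding lheat_def * ..
  assume t: "t > 0"
  have "lgrad t u (x + s *\<^sub>R e) b = lgrad t u x b" for s
    unfolding lgrad_def tmean_def * ..
  then have "((\<lambda>s::real. lgrad t u x b) has_real_derivative lhess t u x e b) (at 0)"
    using lgrad_has_derivative_0[OF t, of x e b] by simp
  then show "lhess t u x e b = 0"
    using DERIV_unique DERIV_const by blast
qed

end

subsection \<open>Maximum principle for the deficit\<close>

lemma second_derivative_test:
  fixes \<psi> \<psi>' :: "real \<Rightarrow> real"
  assumes d1: "\<And>s. (\<psi> has_real_derivative \<psi>' s) (at s)" and d2: "(\<psi>' has_real_derivative D) (at 0)"
    and min: "\<And>s. \<psi> 0 \<le> \<psi> s"
  shows "\<psi>' 0 = 0" "D \<ge> 0"
proof -
  show z: "\<psi>' 0 = 0"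
    by (rule DERIV_local_min[OF d1[of 0], of 1]) (use min in auto)
  show "D \<ge> 0"
  proof (rule ccontr)
    assume "\<not> D \<ge> 0"
    then obtain d where d: "d > 0" "\<And>h. h > 0 \<Longrightarrow> h < d \<Longrightarrow> \<psi>' (0 + h) < \<psi>' 0"
      using DERIV_neg_dec_right[OF d2] by auto
    have "\<exists>z. 0 < z \<and> z < d / 2 \<and> \<psi> (d / 2) - \<psi> 0 = (d / 2 - 0) * \<psi>' z"
      using d(1) by (intro MVT2) (auto intro: d1)
    then obtain z where z': "0 < z" "z < d / 2" "\<psi> (d / 2) - \<psi> 0 = d / 2 * \<psi>' z" by auto
    then have "\<psi>' z < 0" using d(2)[of z] z by simp
    then have "d / 2 * \<psi>' z < 0" using d(1) by (simp add: mult_pos_neg)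
    then show False using min[of "d / 2"] z'(3) by simp
  qed
qed

lemma quadratic_nonneg_imp_linear_0:
  fixes \<alpha> \<beta> :: real
  assumes "\<And>r. 0 \<le> 2 * r * \<alpha> + r\<^sup>2 * \<beta>"
  shows "\<alpha> = 0"
proof (rule ccontr)
  assume a: "\<alpha> \<noteq> 0"
  \<comment> \<open>A positive number above \<open>\<beta>\<close>: at
    \<open>r = - \<alpha> / m\<close> the parabola is a positive multiple of
    \<open>\<beta> - 2 * m\<close>, which is negative.\<close>
  define m where "m = \<bar>\<beta>\<bar> + 1"
  have m: "m > 0" "\<beta> < m" by (auto simp: m_def)
  have "0 \<le> 2 * (- \<alpha> / m) * \<alpha> + (- \<alpha> / m)\<^sup>2 * \<beta>" by (rule assms)
  also have "\<dots> = \<alpha>\<^sup>2 / m\<^sup>2 * (\<beta> - 2 * m)"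
    using m by (simp add: field_simps power2_eq_square)
  also have "\<dots> < 0" using a m by (intro mult_pos_neg) auto
  finally show False by simp
qed

lemma linear_real_represent:
  fixes f :: "'a::euclidean_space \<Rightarrow> real"
  assumes "linear f"
  shows "f a = (\<Sum>b\<in>Basis. f b *\<^sub>R b) \<bullet> a" "(norm (\<Sum>b\<in>Basis. f b *\<^sub>R b))\<^sup>2 = (\<Sum>b\<in>Basis. (f b)\<^sup>2)"
proof -
  have *: "f a = (\<Sum>b\<in>Basis. f b *\<^sub>R b) \<bullet> a" for a
  proof -
    have "f a = f (\<Sum>b\<in>Basis. (a \<bullet> b) *\<^sub>R b)" by (simp add: euclidean_representation)
    also have "\<dots> = (\<Sum>b\<in>Basis. (a \<bullet> b) * f b)"
      by (simp add: linear_sum[OF assms] linear_scale[OF assms])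
    also have "\<dots> = (\<Sum>b\<in>Basis. f b * (b \<bullet> a))"
      by (simp only: inner_commute mult.commute)
    finally show ?thesis by (simp add: inner_sum_left)
  qed
  then show "f a = (\<Sum>b\<in>Basis. f b *\<^sub>R b) \<bullet> a" .
  have "(norm (\<Sum>b\<in>Basis. f b *\<^sub>R b))\<^sup>2 = (\<Sum>b\<in>Basis. ((\<Sum>b\<in>Basis. f b *\<^sub>R b) \<bullet> b) * ((\<Sum>b\<in>Basis. f b *\<^sub>R b) \<bullet> b))"
    unfolding power2_norm_eq_inner by (rule euclidean_inner)
  also have "\<dots> = (\<Sum>b\<in>Basis. (f b)\<^sup>2)"
    by (simp add: *[symmetric] power2_eq_square)
  finally show "(norm (\<Sum>b\<in>Basis. f b *\<^sub>R b))\<^sup>2 = (\<Sum>b\<in>Basis. (f b)\<^sup>2)" .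
qed

lemma continuous_on_coordinate_snd: "continuous_on X (\<lambda>p :: 'b::topological_space \<times> ('i \<Rightarrow> 'a::topological_space). snd p i)"
proof -
  have "continuous_on X (snd :: 'b \<times> ('i \<Rightarrow> 'a) \<Rightarrow> _)" by (intro continuous_intros)
  from continuous_on_compose2[OF continuous_on_product_coordinates[of i] this] show ?thesis by simp
qed

lemma bilinear_form_expand:
  fixes h :: "'a::real_vector \<Rightarrow> 'a \<Rightarrow> real"
  assumes lin: "\<And>a. linear (h a)" and sym: "\<And>a b. h a b = h b a"
  shows "h (b + r *\<^sub>R w) (b + r *\<^sub>R w) = h b b + 2 * r * h b w + r\<^sup>2 * h w w"
proof -
  have *: "h z (b + r *\<^sub>R w) = h z b + r * h z w" for z
    using lin[of z] by (simp add: linear_add linear_scale)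
  have "h (b + r *\<^sub>R w) (b + r *\<^sub>R w) = h b (b + r *\<^sub>R w) + r * h w (b + r *\<^sub>R w)"
    unfolding * sym[of "b + r *\<^sub>R w"] ..
  then show ?thesis unfolding * sym[of w b] by (simp add: power2_eq_square algebra_simps)
qed

text \<open>Tychonoff. Families are total functions on the index type, so the boxes used later pin
  the coordinates outside \<open>I\<close> to 0.\<close>

lemma compact_fun_box:
  fixes D :: "'i \<Rightarrow> 'a::topological_space set"
  assumes "\<And>i. compact (D i)"
  shows "compact (Pi\<^sub>E UNIV D)"
proof -
  have "compactin (product_topology (\<lambda>_. euclidean) UNIV) (Pi\<^sub>E UNIV D)"
    using assms by (simp add: compactin_PiE)
  then show ?thesis by (simp add: euclidean_product_topology)
qed

section \<open>Decompositions of the identity and the deficit\<close>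

locale tight_frame =
  fixes I :: "'i set" and E :: "'i \<Rightarrow> 'a::euclidean_space set" and c :: "'i \<Rightarrow> real"
  assumes finI: "finite I" and subE: "\<And>i. i \<in> I \<Longrightarrow> subspace (E i)"
    and cpos: "\<And>i. i \<in> I \<Longrightarrow> c i > 0"
    and frame: "\<And>x. (\<Sum>i\<in>I. c i *\<^sub>R orth_proj (E i) x) = x"
begin

text \<open>A left inverse of the diagonal embedding, by \<open>S_const\<close>. The deficit
  compares \<open>u\<close> at \<open>S x\<close> with the functions \<open>v i\<close> at the
  points \<open>x i\<close>.\<close>

definition S :: "('i \<Rightarrow> 'a) \<Rightarrow> 'a" where
  "S x = (\<Sum>i\<in>I. c i *\<^sub>R orth_proj (E i) (x i))"

lemma S_const: "S (\<lambda>_. x) = x"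
  by (simp add: S_def frame)

lemma S_add_scale: "S (\<lambda>i. x i + s *\<^sub>R d i) = S x + s *\<^sub>R S d"
proof -
  have "c i *\<^sub>R orth_proj (E i) (x i + s *\<^sub>R d i) = c i *\<^sub>R orth_proj (E i) (x i) + s *\<^sub>R (c i *\<^sub>R orth_proj (E i) (d i))"
    if "i \<in> I" for i
    using linear_orth_proj[OF subE[OF that]] by (simp add: linear_add linear_scale algebra_simps)
  then show ?thesis by (simp add: S_def sum.distrib scaleR_sum_right)
qed

lemma S_single:
  assumes i: "i \<in> I"
  shows "S (\<lambda>j. if j = i then a else 0) = c i *\<^sub>R orth_proj (E i) a"
proof -
  have "S (\<lambda>j. if j = i then a else 0) = (\<Sum>j\<in>I. if j = i then c i *\<^sub>R orth_proj (E i) a else 0)"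
    unfolding S_def using linear_0[OF linear_orth_proj[OF subE]] by (intro sum.cong) auto
  then show ?thesis using i finI by simp
qed

lemma S_cong: "(\<And>i. i \<in> I \<Longrightarrow> x i = y i) \<Longrightarrow> S x = S y"
  by (simp add: S_def)

text \<open>Pair the decomposition of the identity with \<open>x\<close>. This identity balances the
  squared gradients in the time derivative of the deficit.\<close>

lemma norm_frame: "(norm x)\<^sup>2 = (\<Sum>i\<in>I. c i * (norm (orth_proj (E i) x))\<^sup>2)"
proof -
  have "(norm x)\<^sup>2 = (\<Sum>i\<in>I. c i *\<^sub>R orth_proj (E i) x) \<bullet> x"
    unfolding frame by (rule power2_norm_eq_inner)
  also have "\<dots> = (\<Sum>i\<in>I. c i * (orth_proj (E i) x \<bullet> x))"
    by (simp add: inner_sum_left)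
  also have "\<dots> = (\<Sum>i\<in>I. c i * (norm (orth_proj (E i) x))\<^sup>2)"
    unfolding power2_norm_eq_inner using inner_orth_proj[OF subE, of _ x x] by (intro sum.cong) auto
  finally show ?thesis .
qed

lemma continuous_on_S: "continuous_on X (S :: ('i \<Rightarrow> 'a) \<Rightarrow> 'a)"
  unfolding S_def
proof (intro continuous_on_sum continuous_on_scaleR continuous_on_const)
  fix i assume "i \<in> I"
  then have "continuous_on UNIV (orth_proj (E i))"
    using linear_orth_proj[OF subE] by (simp add: linear_continuous_on linear_conv_bounded_linear)
  moreover have "continuous_on X (\<lambda>x. (x :: 'i \<Rightarrow> 'a) i)"
    by (rule continuous_on_subset[OF continuous_on_product_coordinates]) simp
  ultimately show "continuous_on X (\<lambda>x. orth_proj (E i) ((x :: 'i \<Rightarrow> 'a) i))"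
    by (rule continuous_on_compose2) simp
qed

end

locale tight_frame_lip = tight_frame I E c + U: lip u L
  for I :: "'i set" and E :: "'i \<Rightarrow> 'a::euclidean_space set" and c :: "'i \<Rightarrow> real"
    and u :: "'a \<Rightarrow> real" and L :: real +
  fixes v :: "'i \<Rightarrow> 'a \<Rightarrow> real"
  assumes lipv: "\<And>i. i \<in> I \<Longrightarrow> lip (v i) L"
begin

text \<open>The deficit in the functional inequality at time \<open>t\<close>; it solves a linear parabolic equation whose
  second order part only involves the diagonal directions.\<close>

definition C :: "real \<Rightarrow> ('i \<Rightarrow> 'a) \<Rightarrow> real" where
  "C t x = lheat t u (S x) - (\<Sum>i\<in>I. c i * lheat t (v i) (x i))"

text \<open>The derivative of \<open>C t\<close> at \<open>x\<close> along the family
  \<open>d\<close>; \<open>Q\<close> below is the second derivative.\<close>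

definition G :: "real \<Rightarrow> ('i \<Rightarrow> 'a) \<Rightarrow> ('i \<Rightarrow> 'a) \<Rightarrow> real" where
  "G t x d = lgrad t u (S x) (S d) - (\<Sum>i\<in>I. c i * lgrad t (v i) (x i) (d i))"

definition Q :: "real \<Rightarrow> ('i \<Rightarrow> 'a) \<Rightarrow> ('i \<Rightarrow> 'a) \<Rightarrow> real" where
  "Q t x d = lhess t u (S x) (S d) (S d) - (\<Sum>i\<in>I. c i * lhess t (v i) (x i) (d i) (d i))"

text \<open>The time derivative of \<open>C\<close>. As \<open>S\<close> fixes constant families,
  the Laplacians of \<open>u\<close> and of the \<open>v i\<close> combine into \<open>Q\<close>
  along the diagonal; the squared gradients are rewritten in \<open>dC_eq\<close>.\<close>

definition dC :: "real \<Rightarrow> ('i \<Rightarrow> 'a) \<Rightarrow> real" where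
  "dC t x = (\<Sum>b\<in>Basis. Q t x (\<lambda>_. b)) / 2 +
     ((\<Sum>b\<in>Basis. (lgrad t u (S x) b)\<^sup>2) - (\<Sum>i\<in>I. c i * (\<Sum>b\<in>Basis. (lgrad t (v i) (x i) b)\<^sup>2))) / 2"

lemma C_cong: "(\<And>i. i \<in> I \<Longrightarrow> x i = y i) \<Longrightarrow> C t x = C t y"
  using S_cong[of x y] by (simp add: C_def)

lemma C_has_derivative:
  assumes t: "t > 0"
  shows "((\<lambda>s. C t (\<lambda>i. x i + s *\<^sub>R d i)) has_real_derivative G t (\<lambda>i. x i + s *\<^sub>R d i) d) (at s)"
  unfolding C_def G_def S_add_scale
  by (intro DERIV_diff DERIV_sum DERIV_cmult U.lheat_has_derivative[OF t] lip.lheat_has_derivative[OF lipv t])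

lemma G_has_derivative:
  assumes t: "t > 0"
  shows "((\<lambda>s. G t (\<lambda>i. x i + s *\<^sub>R d i) d) has_real_derivative Q t x d) (at 0)"
  unfolding G_def Q_def S_add_scale
  by (intro DERIV_diff DERIV_sum DERIV_cmult U.lgrad_has_derivative_0[OF t] lip.lgrad_has_derivative_0[OF lipv t])

lemma C_time_derivative:
  assumes t: "t > 0"
  shows "((\<lambda>s. C s x) has_real_derivative dC t x) (at t)"
proof -
  have "((\<lambda>s. C s x) has_real_derivative
     (\<Sum>b\<in>Basis. lhess t u (S x) b b + (lgrad t u (S x) b)\<^sup>2) / 2
     - (\<Sum>i\<in>I. c i * ((\<Sum>b\<in>Basis. lhess t (v i) (x i) b b + (lgrad t (v i) (x i) b)\<^sup>2) / 2))) (at t)"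
    unfolding C_def
    by (intro DERIV_diff DERIV_sum DERIV_cmult U.lheat_time_derivative[OF t] lip.lheat_time_derivative[OF lipv t])
  moreover have "(\<Sum>b\<in>Basis. \<Sum>i\<in>I. c i * lhess t (v i) (x i) b b) = (\<Sum>i\<in>I. c i * (\<Sum>b\<in>Basis. lhess t (v i) (x i) b b))"
    by (subst sum.swap) (simp add: sum_distrib_left)
  moreover have "(\<Sum>i\<in>I. c i * ((\<Sum>b\<in>Basis. lhess t (v i) (x i) b b + (lgrad t (v i) (x i) b)\<^sup>2) / 2))
    = ((\<Sum>i\<in>I. c i * (\<Sum>b\<in>Basis. lhess t (v i) (x i) b b)) + (\<Sum>i\<in>I. c i * (\<Sum>b\<in>Basis. (lgrad t (v i) (x i) b)\<^sup>2))) / 2"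
    unfolding sum.distrib[symmetric] sum_divide_distrib[where A=I] distrib_left[symmetric] by simp
  ultimately show ?thesis
    by (elim DERIV_cong) (simp add: dC_def Q_def S_const sum.distrib sum_subtractf diff_divide_distrib add_divide_distrib)
qed

definition p :: "real \<Rightarrow> ('i \<Rightarrow> 'a) \<Rightarrow> 'a" where
  "p t x = (\<Sum>b\<in>Basis. lgrad t u (S x) b *\<^sub>R b)"

definition q :: "real \<Rightarrow> ('i \<Rightarrow> 'a) \<Rightarrow> 'i \<Rightarrow> 'a" where
  "q t x i = (\<Sum>b\<in>Basis. lgrad t (v i) (x i) b *\<^sub>R b)"

lemma
  assumes t: "t > 0"
  shows lgrad_p: "lgrad t u (S x) a = p t x \<bullet> a" and norm_p: "(norm (p t x))\<^sup>2 = (\<Sum>b\<in>Basis. (lgrad t u (S x) b)\<^sup>2)"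
    and lgrad_q: "i \<in> I \<Longrightarrow> lgrad t (v i) (x i) a = q t x i \<bullet> a"
    and norm_q: "i \<in> I \<Longrightarrow> (norm (q t x i))\<^sup>2 = (\<Sum>b\<in>Basis. (lgrad t (v i) (x i) b)\<^sup>2)"
  unfolding p_def q_def
  by (rule linear_real_represent U.linear_lgrad[OF t] lip.linear_lgrad[OF lipv t] | assumption)+

lemma
  assumes t: "t > 0"
  shows norm_p_le: "norm (p t x) \<le> L" and norm_q_le: "i \<in> I \<Longrightarrow> norm (q t x i) \<le> L"
proof -
  have *: "norm z \<le> L" if "\<And>a. \<bar>z \<bullet> a\<bar> \<le> L * norm a" for z :: 'a
  proof (cases "z = 0")
    case False
    have "norm z * norm z \<le> L * norm z"
      using that[of z] by (simp flip: power2_norm_eq_inner add: power2_eq_square)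
    then show ?thesis using False by simp
  qed (simp add: U.L0)
  show "norm (p t x) \<le> L"
    using U.lgrad_bound[OF t, of "S x"] by (intro *) (simp add: lgrad_p[OF t])
  show "norm (q t x i) \<le> L" if "i \<in> I"
    using lip.lgrad_bound[OF lipv[OF that] t, of "x i"] by (intro *) (simp add: lgrad_q[OF t that])
qed

text \<open>Moving one coordinate isolates the difference of the projected gradient of
  \<open>u\<close> and the gradient of \<open>v i\<close>, the very factor that appears in
  \<open>dC_eq\<close>.\<close>

lemma G_single:
  assumes t: "t > 0" and i: "i \<in> I"
  shows "G t x (\<lambda>j. if j = i then a else 0) = c i * ((orth_proj (E i) (p t x) - q t x i) \<bullet> a)"
proof -
  have "(\<Sum>j\<in>I. c j * lgrad t (v j) (x j) (if j = i then a else 0)) = (\<Sum>j\<in>I. if j = i then c i * (q t x i \<bullet> a) else 0)"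
    using lgrad_q[OF t] by (intro sum.cong) auto
  then show ?thesis
    unfolding G_def S_single[OF i] lgrad_p[OF t] using i finI orth_proj_sym[OF subE[OF i], of "p t x" a]
    by (simp add: inner_diff_left algebra_simps)
qed

text \<open>\<open>norm_frame\<close> distributes the squared norm of \<open>p\<close> over the
  projections, so the gradient terms become differences of squares. Each has a factor that vanishes
  with the first derivatives of \<open>C\<close>.\<close>

lemma dC_eq:
  assumes t: "t > 0"
  shows "dC t x = (\<Sum>b\<in>Basis. Q t x (\<lambda>_. b)) / 2 +
     (\<Sum>i\<in>I. c i * ((orth_proj (E i) (p t x) - q t x i) \<bullet> (orth_proj (E i) (p t x) + q t x i))) / 2"
proof -
  have "(\<Sum>b\<in>Basis. (lgrad t u (S x) b)\<^sup>2) = (\<Sum>i\<in>I. c i * (norm (orth_proj (E i) (p t x)))\<^sup>2)"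
    unfolding norm_p[OF t, symmetric] by (rule norm_frame)
  moreover have "(\<Sum>i\<in>I. c i * (\<Sum>b\<in>Basis. (lgrad t (v i) (x i) b)\<^sup>2)) = (\<Sum>i\<in>I. c i * (norm (q t x i))\<^sup>2)"
    using norm_q[OF t] by (intro sum.cong) auto
  moreover have "(y - z) \<bullet> (y + z) = (norm y)\<^sup>2 - (norm z)\<^sup>2" for y z :: 'a
    unfolding power2_norm_eq_inner inner_diff_left inner_add_right by (simp add: inner_commute[of z y])
  ultimately show ?thesis
    unfolding dC_def by (simp add: right_diff_distrib sum_subtractf)
qed

text \<open>The deficit is nonnegative at time 0, and each flow stays within a distance of its start
  that is uniform in space.\<close>

lemma C_lower_bound:
  assumes init: "\<And>x. (\<Sum>i\<in>I. c i * v i (x i)) \<le> u (S x)" and T: "T \<ge> 0"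
  obtains M where "M > 0" "\<And>t x. 0 \<le> t \<Longrightarrow> t \<le> T \<Longrightarrow> - M \<le> C t x"
proof -
  obtain M0 where M0: "\<And>t x. 0 \<le> t \<Longrightarrow> t \<le> T \<Longrightarrow> \<bar>lheat t u x - u x\<bar> \<le> M0"
    using U.lheat_near[OF T] by blast
  have "\<exists>M. \<forall>t x. 0 \<le> t \<longrightarrow> t \<le> T \<longrightarrow> \<bar>lheat t (v i) x - v i x\<bar> \<le> M" if "i \<in> I" for i
    using lip.lheat_near[OF lipv[OF that] T] by metis
  then obtain Mi where Mi: "\<And>i t x. i \<in> I \<Longrightarrow> 0 \<le> t \<Longrightarrow> t \<le> T \<Longrightarrow> \<bar>lheat t (v i) x - v i x\<bar> \<le> Mi i"
    by metis
  show ?thesis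
  proof
    have "0 \<le> M0" using M0[of 0 0] T by simp
    moreover have "0 \<le> Mi i" if "i \<in> I" for i using Mi[OF that, of 0 0] T by simp
    ultimately show "0 < M0 + (\<Sum>i\<in>I. c i * Mi i) + 1"
      using cpos by (intro add_nonneg_pos add_nonneg_nonneg sum_nonneg mult_nonneg_nonneg) (auto intro: less_imp_le)
    fix t x assume t: "0 \<le> t" "t \<le> T"
    have "(\<Sum>i\<in>I. c i * lheat t (v i) (x i)) \<le> (\<Sum>i\<in>I. c i * (v i (x i) + Mi i))"
    proof (intro sum_mono mult_left_mono)
      fix i assume i: "i \<in> I"
      show "lheat t (v i) (x i) \<le> v i (x i) + Mi i" using Mi[OF i t, of "x i"] by linarith
      show "0 \<le> c i" using cpos[OF i] by simp
    qed
    also have "\<dots> = (\<Sum>i\<in>I. c i * v i (x i)) + (\<Sum>i\<in>I. c i * Mi i)" by (simp add: distrib_left sum.distrib)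
    also have "\<dots> \<le> u (S x) + (\<Sum>i\<in>I. c i * Mi i)" using init by simp
    also have "u (S x) \<le> lheat t u (S x) + M0" using M0[OF t, of "S x"] by linarith
    finally show "- (M0 + (\<Sum>i\<in>I. c i * Mi i) + 1) \<le> C t x" by (simp add: C_def)
  qed
qed

lemma continuous_on_C: "continuous_on ({0..} \<times> UNIV) (\<lambda>(t, x). C t x)"
proof -
  have S: "continuous_on ({0..} \<times> UNIV) (\<lambda>p :: real \<times> ('i \<Rightarrow> 'a). (fst p, S (snd p)))"
    by (intro continuous_intros continuous_on_compose2[OF continuous_on_S[of UNIV]]) auto
  have 1: "continuous_on ({0..} \<times> UNIV) (\<lambda>p. lheat (fst p) u (S (snd p)))"
    using continuous_on_compose2[OF U.continuous_on_lheat S] by (simp add: case_prod_beta mem_Times_iff image_subset_iff)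
  have 2: "continuous_on ({0..} \<times> UNIV) (\<lambda>p. lheat (fst p) (v i) ((snd p :: 'i \<Rightarrow> 'a) i))" if "i \<in> I" for i
  proof -
    have "continuous_on ({0..} \<times> UNIV) (\<lambda>p :: real \<times> ('i \<Rightarrow> 'a). (fst p, snd p i))"
      by (intro continuous_intros continuous_on_coordinate_snd)
    from continuous_on_compose2[OF lip.continuous_on_lheat[OF lipv[OF that]] this]
    show ?thesis by (simp add: case_prod_beta mem_Times_iff image_subset_iff)
  qed
  show ?thesis
    unfolding C_def case_prod_beta by (intro continuous_intros 1 2)
qed

text \<open>Suppose a negative value. A small quadratic penalty makes the minimum attained, and a
  penalty linear in time makes the inequalities strict. The minimum of \<open>H\<close> is negative,
  hence at a positive time; there the first derivatives of \<open>C\<close> almost vanish and the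
  second ones are almost nonnegative, so \<open>dC\<close> is at least a small negative number,
  while minimality in time forces \<open>dC\<close> to be at most \<open>- \<kappa>\<close>.\<close>

theorem maximum_principle:
  assumes init: "\<And>x. (\<Sum>i\<in>I. c i * v i (x i)) \<le> u (S x)" and t: "t \<ge> 0"
  shows "C t x \<ge> 0"
proof (rule ccontr)
  assume neg: "\<not> C t x \<ge> 0"
  define y where "y i = (if i \<in> I then x i else 0)" for i
  have Cy: "C t y < 0" using neg C_cong[of x y t] by (simp add: y_def)
  have C0: "C 0 z \<ge> 0" for z
    using init[of z] lip.lheat_0[OF lipv] by (simp add: C_def cong: sum.cong)
  have tpos: "t > 0" using t C0[of y] Cy by (cases "t = 0") auto
  \<comment> \<open>A third of the gap: either penalty costs at most \<open>\<eta>\<close> at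
    \<open>(t, y)\<close>, so \<open>H\<close> stays negative there.\<close>
  define \<eta> where "\<eta> = - C t y / 3"
  have \<eta>: "\<eta> > 0" "C t y = - 3 * \<eta>" using Cy by (auto simp: \<eta>_def)
  define \<kappa> where "\<kappa> = \<eta> / t"
  have \<kappa>: "\<kappa> > 0" "\<kappa> * t = \<eta>" using \<eta> tpos by (auto simp: \<kappa>_def)
  obtain M where M: "M > 0" "\<And>s z. 0 \<le> s \<Longrightarrow> s \<le> t \<Longrightarrow> - M \<le> C s z"
    using C_lower_bound[OF init t] by blast
  define N where "N z = (\<Sum>i\<in>I. (norm (z i))\<^sup>2)" for z :: "'i \<Rightarrow> 'a"
  define m where "m = real (card I)"
  define n where "n = real DIM('a)"
  \<comment> \<open>The weight \<open>e\<close> has to be small in two ways: its penalty at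
    \<open>y\<close> stays below \<open>\<eta>\<close>, and the error it causes in \<open>dC\<close>
    at the minimum stays below \<open>\<kappa>\<close>.\<close>
  have "((\<lambda>e. e * N y) \<longlongrightarrow> 0 * N y) (at_right 0)"
    by (intro tendsto_intros)
  then have 1: "\<forall>\<^sub>F e in at_right 0. e * N y < \<eta>" using \<eta>(1) by (intro order_tendstoD) auto
  have "((\<lambda>e. e * (m * n) + 2 * L * m * sqrt (e * M)) \<longlongrightarrow> 0 * (m * n) + 2 * L * m * sqrt (0 * M)) (at_right 0)"
    by (intro tendsto_intros)
  then have 2: "\<forall>\<^sub>F e in at_right 0. e * (m * n) + 2 * L * m * sqrt (e * M) < \<kappa>" using \<kappa>(1) by (intro order_tendstoD) auto
  have 3: "\<forall>\<^sub>F e::real in at_right 0. e > 0" by (simp add: eventually_at_right_less)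
  have "\<exists>e. e * N y < \<eta> \<and> e * (m * n) + 2 * L * m * sqrt (e * M) < \<kappa> \<and> (e::real) > 0"
    using eventually_conj[OF 1 eventually_conj[OF 2 3]] by (intro eventually_happens'[OF trivial_limit_at_right_real]) auto
  then obtain e where e: "e * N y < \<eta>" "e * (m * n) + 2 * L * m * sqrt (e * M) < \<kappa>" "e > 0" by blast
  define H where "H s z = C s z + e * N z + \<kappa> * s" for s z
  have Hy: "H t y < 0" using e(1) \<eta> \<kappa> by (simp add: H_def)
  \<comment> \<open>Beyond this radius the penalty outweighs the lower bound \<open>- M\<close> of
    the deficit.\<close>
  define R where "R = sqrt (M / e)"
  have R: "R > 0" "e * R\<^sup>2 = M" using M e(3) by (auto simp: R_def)
  define D where "D = {0..t} \<times> Pi\<^sub>E UNIV (\<lambda>i. if i \<in> I then cball (0::'a) R else {0})"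
  have big: "H s z \<ge> 0" if "0 \<le> s" "s \<le> t" "i \<in> I" "norm (z i) > R" for s z i
  proof -
    have "R\<^sup>2 \<le> (norm (z i))\<^sup>2" using that(4) R by (intro power_mono) auto
    also have "\<dots> \<le> N z" unfolding N_def by (rule member_le_sum[OF that(3)]) (use finI in auto)
    finally have "M \<le> e * N z" using e(3) R(2) mult_left_mono[of "R\<^sup>2" "N z" e] by simp
    then show ?thesis using M(2)[OF that(1,2), of z] \<kappa>(1) that(1) by (simp add: H_def)
  qed
  have inD: "z \<in> Pi\<^sub>E UNIV (\<lambda>i. if i \<in> I then cball 0 R else {0})"
    if "\<And>i. i \<in> I \<Longrightarrow> norm (z i) \<le> R" "\<And>i. i \<notin> I \<Longrightarrow> z i = 0" for z :: "'i \<Rightarrow> 'a"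
    using that by auto
  have "compact D" unfolding D_def by (intro compact_Times compact_fun_box compact_Icc) auto
  moreover have yD: "(t, y) \<in> D"
  proof -
    have "norm (y i) \<le> R" if "i \<in> I" for i
      using big[OF t order_refl that, of y] Hy by fastforce
    then show ?thesis unfolding D_def using t by (auto simp: y_def)
  qed
  moreover have "continuous_on D (\<lambda>(s, z). H s z)"
  proof -
    have "continuous_on D (\<lambda>(s, z). C s z)"
      by (rule continuous_on_subset[OF continuous_on_C]) (auto simp: D_def)
    then show ?thesis
      unfolding H_def N_def case_prod_beta by (intro continuous_intros continuous_on_coordinate_snd) auto
  qed
  ultimately obtain s z where sz: "(s, z) \<in> D" and minD: "\<And>s' z'. (s', z') \<in> D \<Longrightarrow> H s z \<le> H s' z'"
    using continuous_attains_inf[of D "\<lambda>(s, z). H s z"] by fastforce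
  have s: "0 \<le> s" "s \<le> t" using sz by (auto simp: D_def)
  have Hneg: "H s z < 0" using minD[OF yD] Hy by simp
  have Nz: "e * N z < M"
  proof -
    have "\<kappa> * s \<ge> 0" using \<kappa>(1) s(1) by simp
    then show ?thesis using Hneg M(2)[OF s, of z] unfolding H_def by linarith
  qed
  have spos: "s > 0"
  proof (rule ccontr)
    assume "\<not> s > 0"
    then have "s = 0" using s by simp
    moreover have "N z \<ge> 0" unfolding N_def by (intro sum_nonneg) auto
    moreover from this e(3) have "e * N z \<ge> 0" by simp
    ultimately show False using Hneg C0[of z] unfolding H_def by simp
  qed
  have min: "H s z \<le> H s' z'" if "0 \<le> s'" "s' \<le> t" for s' z'
  proof (cases "\<forall>i\<in>I. norm (z' i) \<le> R")
    case True
    define w where "w i = (if i \<in> I then z' i else 0)" for i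
    have "(s', w) \<in> D" unfolding D_def using that True by (auto simp: w_def)
    moreover have "H s' w = H s' z'"
      using C_cong[of w z' s'] by (simp add: H_def w_def N_def)
    ultimately show ?thesis using minD by metis
  next
    case False
    then show ?thesis using big[OF that, of _ z'] Hneg by fastforce
  qed
  \<comment> \<open>The minimum may sit at the final time \<open>s = t\<close>, so it is compared
    with earlier times only; this gives an inequality and not an equation.\<close>
  have dt: "dC s z \<le> - \<kappa>"
  proof (rule ccontr)
    assume "\<not> dC s z \<le> - \<kappa>"
    moreover have "((\<lambda>s. H s z) has_real_derivative dC s z + \<kappa>) (at s)"
      unfolding H_def by (auto intro!: derivative_eq_intros C_time_derivative spos)
    ultimately obtain d where d: "d > 0" "\<And>h. h > 0 \<Longrightarrow> h < d \<Longrightarrow> H (s - h) z < H s z"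
      using DERIV_pos_inc_left[of "\<lambda>s. H s z" "dC s z + \<kappa>" s] by auto
    define h where "h = min (d / 2) s"
    have "h > 0" "h < d" "h \<le> s" using d(1) spos by (auto simp: h_def)
    then show False using d(2)[of h] min[of "s - h" z] s by simp
  qed
  define dN where "dN w d = (\<Sum>i\<in>I. 2 * (w i \<bullet> d i))" for w d :: "'i \<Rightarrow> 'a"
  have Nd: "((\<lambda>r. N (\<lambda>i. z i + r *\<^sub>R d i)) has_real_derivative dN (\<lambda>i. z i + r *\<^sub>R d i) d) (at r)" for d r
  proof -
    have "(norm (z i + r *\<^sub>R d i))\<^sup>2 = (norm (z i))\<^sup>2 + 2 * r * (z i \<bullet> d i) + r\<^sup>2 * (norm (d i))\<^sup>2" for i r
      unfolding power2_norm_eq_inner by (simp add: inner_add_left inner_add_right inner_commute power2_eq_square)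
    moreover have "((\<lambda>r. (norm (z i))\<^sup>2 + 2 * r * (z i \<bullet> d i) + r\<^sup>2 * (norm (d i))\<^sup>2) has_real_derivative
       2 * ((z i + r *\<^sub>R d i) \<bullet> d i)) (at r)" for i
      by (auto intro!: derivative_eq_intros simp: inner_add_left power2_norm_eq_inner)
    ultimately show ?thesis unfolding N_def dN_def by (intro DERIV_sum) simp
  qed
  have dNd: "((\<lambda>r. dN (\<lambda>i. z i + r *\<^sub>R d i) d) has_real_derivative (\<Sum>i\<in>I. 2 * (norm (d i))\<^sup>2)) (at 0)" for d
    unfolding dN_def
    by (intro DERIV_sum) (auto intro!: derivative_eq_intros simp: inner_add_left power2_norm_eq_inner)
  have crit: "G s z d + e * dN z d = 0" "0 \<le> Q s z d + e * (\<Sum>i\<in>I. 2 * (norm (d i))\<^sup>2)" for d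
  proof -
    define \<psi> where "\<psi> r = H s (\<lambda>i. z i + r *\<^sub>R d i)" for r
    define \<psi>' where "\<psi>' r = G s (\<lambda>i. z i + r *\<^sub>R d i) d + e * dN (\<lambda>i. z i + r *\<^sub>R d i) d" for r
    have d1: "(\<psi> has_real_derivative \<psi>' r) (at r)" for r
      unfolding \<psi>_def[abs_def] \<psi>'_def H_def
      by (auto intro!: derivative_eq_intros C_has_derivative Nd spos)
    have d2: "(\<psi>' has_real_derivative Q s z d + e * (\<Sum>i\<in>I. 2 * (norm (d i))\<^sup>2)) (at 0)"
      unfolding \<psi>'_def[abs_def]
      by (intro DERIV_add DERIV_cmult G_has_derivative dNd spos)
    have m0: "\<psi> 0 \<le> \<psi> r" for r unfolding \<psi>_def using min[OF s] by simp
    show "G s z d + e * dN z d = 0" "0 \<le> Q s z d + e * (\<Sum>i\<in>I. 2 * (norm (d i))\<^sup>2)"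
      using second_derivative_test[OF d1 d2 m0] by (auto simp: \<psi>'_def)
  qed
  have trace: "(\<Sum>b\<in>Basis. Q s z (\<lambda>_. b)) \<ge> - 2 * e * (m * n)"
  proof -
    have "(\<Sum>b\<in>(Basis::'a set). - 2 * e * m) \<le> (\<Sum>b\<in>Basis. Q s z (\<lambda>_. b))"
    proof (rule sum_mono)
      fix b :: 'a assume "b \<in> Basis"
      then show "- 2 * e * m \<le> Q s z (\<lambda>_. b)" using crit(2)[of "\<lambda>_. b"] by (simp add: m_def)
    qed
    then show ?thesis by (simp add: n_def mult_ac)
  qed
  \<comment> \<open>At the minimum the first derivatives of \<open>C\<close> are opposite to those
    of the penalty, of size \<open>e * norm (z i)\<close>. Since \<open>e * N z < M\<close>, this is
    at most \<open>sqrt (e * M)\<close>; the other factor is at most \<open>2 * L\<close> by the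
    Lipschitz bounds.\<close>
  have energy: "(\<Sum>i\<in>I. c i * ((orth_proj (E i) (p s z) - q s z i) \<bullet> (orth_proj (E i) (p s z) + q s z i))) \<ge> - 4 * L * m * sqrt (e * M)"
  proof -
    have "- 4 * L * sqrt (e * M) \<le> c i * ((orth_proj (E i) (p s z) - q s z i) \<bullet> (orth_proj (E i) (p s z) + q s z i))" if i: "i \<in> I" for i
    proof -
      define a where "a = orth_proj (E i) (p s z) + q s z i"
      have "dN z (\<lambda>j. if j = i then a else 0) = (\<Sum>j\<in>I. if j = i then 2 * (z i \<bullet> a) else 0)"
        unfolding dN_def by (intro sum.cong) auto
      also have "\<dots> = 2 * (z i \<bullet> a)" using i finI by simp
      finally have "c i * ((orth_proj (E i) (p s z) - q s z i) \<bullet> a) = - 2 * (e * (z i \<bullet> a))"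
        using crit(1)[of "\<lambda>j. if j = i then a else 0"] unfolding G_single[OF spos i] by simp
      moreover have "e * (z i \<bullet> a) \<le> sqrt (e * M) * (2 * L)"
      proof -
        have "e * (norm (z i))\<^sup>2 \<le> e * N z"
          unfolding N_def using e(3) by (intro mult_left_mono member_le_sum[OF i]) (use finI in auto)
        then have "e * (norm (z i))\<^sup>2 \<le> M" using Nz by simp
        then have "e * (e * (norm (z i))\<^sup>2) \<le> e * M" using e(3) by (intro mult_left_mono) auto
        then have "(e * norm (z i))\<^sup>2 \<le> e * M" by (simp add: power_mult_distrib power2_eq_square mult_ac)
        then have 1: "e * norm (z i) \<le> sqrt (e * M)" by (rule real_le_rsqrt)
        have 2: "norm a \<le> 2 * L"
          unfolding a_def using norm_p_le[OF spos, of z] norm_q_le[OF spos i, of z] norm_orth_proj_le[OF subE[OF i], of "p s z"]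
            norm_triangle_ineq[of "orth_proj (E i) (p s z)" "q s z i"] by linarith
        have "e * (z i \<bullet> a) \<le> e * (norm (z i) * norm a)"
          using e(3) by (intro mult_left_mono norm_cauchy_schwarz) auto
        also have "\<dots> \<le> sqrt (e * M) * (2 * L)"
          using mult_mono[OF 1 2] e(3) M(1) by (simp add: mult.assoc)
        finally show ?thesis .
      qed
      ultimately show ?thesis unfolding a_def by (simp add: mult_ac)
    qed
    then have "(\<Sum>i\<in>I. - 4 * L * sqrt (e * M)) \<le> (\<Sum>i\<in>I. c i * ((orth_proj (E i) (p s z) - q s z i) \<bullet> (orth_proj (E i) (p s z) + q s z i)))"
      by (intro sum_mono)
    then show ?thesis by (simp add: m_def mult_ac)
  qed
  have "dC s z \<ge> - (e * (m * n) + 2 * L * m * sqrt (e * M))"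
    unfolding dC_eq[OF spos] using trace energy by (simp add: field_simps)
  then show False using dt e(2) by linarith
qed

text \<open>A vector on which a positive semidefinite form vanishes is in its kernel. Here the
  diagonal family is paired with the family that is \<open>w\<close> at \<open>i\<close> and 0
  elsewhere; \<open>S\<close> sends the latter to \<open>c i\<close> times the projection of
  \<open>w\<close>, and the vanishing mixed term is the claim up to the factor
  \<open>c i\<close>.\<close>

theorem hess_at_zero:
  assumes nonneg: "\<And>s x. s > 0 \<Longrightarrow> C s x \<ge> 0" and t: "t > 0" and z: "C t x = 0" and i: "i \<in> I"
  shows "lhess t u (S x) a (orth_proj (E i) w) = lhess t (v i) (x i) a w"
proof -
  have crit: "G t x d = 0" "0 \<le> Q t x d" for d
  proof -
    have min: "C t (\<lambda>i. x i + 0 *\<^sub>R d i) \<le> C t (\<lambda>i. x i + r *\<^sub>R d i)" for r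
      using nonneg[OF t] z by simp
    show "G t x d = 0" "0 \<le> Q t x d"
      using second_derivative_test[OF C_has_derivative[OF t] G_has_derivative[OF t] min] by auto
  qed
  have dt: "dC t x = 0"
    by (rule DERIV_local_min[OF C_time_derivative[OF t] t]) (use nonneg z in auto)
  have pq: "orth_proj (E j) (p t x) = q t x j" if j: "j \<in> I" for j
  proof -
    define a where "a = orth_proj (E j) (p t x) - q t x j"
    have "c j * (a \<bullet> a) = 0"
      using crit(1)[of "\<lambda>i. if i = j then a else 0"] unfolding G_single[OF t j] a_def .
    then show ?thesis using cpos[OF j] by (simp add: a_def)
  qed
  have "(\<Sum>b\<in>Basis. Q t x (\<lambda>_. b)) = 0"
    using dt unfolding dC_eq[OF t] by (simp add: pq)
  then have Q0: "Q t x (\<lambda>_. b) = 0" if "b \<in> Basis" for b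
    using that crit(2) by (subst (asm) sum_nonneg_eq_0_iff) auto
  have lin2: "linear (\<lambda>a. lhess t u (S x) a w)" for w
    using U.linear_lhess[OF t, of "S x" w] unfolding U.lhess_sym[of t "S x" w] .
  have lin2': "linear (\<lambda>a. lhess t (v i) (x i) a w)" for w
    using lip.linear_lhess[OF lipv[OF i] t, of "x i" w] unfolding lip.lhess_sym[OF lipv[OF i], of t "x i" w] .
  have basis: "lhess t u (S x) b (orth_proj (E i) w) = lhess t (v i) (x i) b w" if b: "b \<in> Basis" for b
  proof -
    let ?P = "orth_proj (E i) w"
    define \<alpha> where "\<alpha> = c i * (lhess t u (S x) b ?P - lhess t (v i) (x i) b w)"
    define \<beta> where "\<beta> = (c i)\<^sup>2 * lhess t u (S x) ?P ?P - c i * lhess t (v i) (x i) w w"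
    \<comment> \<open>As \<open>Q\<close> vanishes at the constant family \<open>b\<close>, this
      polynomial is \<open>Q\<close> at the perturbation of \<open>b\<close> by \<open>r\<close>
      times \<open>w\<close> in the coordinate \<open>i\<close>.\<close>
    have "0 \<le> 2 * r * \<alpha> + r\<^sup>2 * \<beta>" for r
    proof -
      define d where "d j = b + r *\<^sub>R (if j = i then w else 0)" for j
      have Sd: "S d = b + (r * c i) *\<^sub>R ?P"
        unfolding d_def S_add_scale S_const S_single[OF i] by simp
      have 1: "lhess t u (S x) (S d) (S d) = lhess t u (S x) b b + 2 * r * c i * lhess t u (S x) b ?P + r\<^sup>2 * (c i)\<^sup>2 * lhess t u (S x) ?P ?P"
        unfolding Sd bilinear_form_expand[OF U.linear_lhess[OF t] U.lhess_sym]
          linear_scale[OF U.linear_lhess[OF t]] by (simp add: power_mult_distrib)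
      have 2: "lhess t (v i) (x i) (d i) (d i) = lhess t (v i) (x i) b b + 2 * r * lhess t (v i) (x i) b w + r\<^sup>2 * lhess t (v i) (x i) w w"
        unfolding d_def using bilinear_form_expand[OF lip.linear_lhess[OF lipv[OF i] t] lip.lhess_sym[OF lipv[OF i]]]
        by simp
      have "(\<Sum>j\<in>I. c j * lhess t (v j) (x j) (d j) (d j))
        = (\<Sum>j\<in>I. c j * lhess t (v j) (x j) b b + (if j = i then c i * (2 * r * lhess t (v i) (x i) b w + r\<^sup>2 * lhess t (v i) (x i) w w) else 0))"
        using 2 by (intro sum.cong) (auto simp: d_def algebra_simps)
      also have "\<dots> = (\<Sum>j\<in>I. c j * lhess t (v j) (x j) b b) + c i * (2 * r * lhess t (v i) (x i) b w + r\<^sup>2 * lhess t (v i) (x i) w w)"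
        using i finI by (simp add: sum.distrib)
      finally have "Q t x d = Q t x (\<lambda>_. b) + (2 * r * \<alpha> + r\<^sup>2 * \<beta>)"
        unfolding Q_def 1 S_const \<alpha>_def \<beta>_def by (simp add: algebra_simps)
      then show ?thesis using crit(2)[of d] Q0[OF b] by simp
    qed
    then have "\<alpha> = 0" by (rule quadratic_nonneg_imp_linear_0)
    then show ?thesis using cpos[OF i] by (simp add: \<alpha>_def)
  qed
  have "(\<lambda>a. lhess t u (S x) a (orth_proj (E i) w)) = (\<lambda>a. lhess t (v i) (x i) a w)"
    using lin2 lin2' basis by (rule linear_eq_stdbasis)
  then show ?thesis by (rule fun_cong)
qed

end

subsection \<open>Gauges and volumes\<close>

text \<open>The trace of a projection, computed once in the standard basis and once in an
  orthonormal basis of \<open>E\<close>.\<close>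

lemma sum_norm_orth_proj_Basis:
  fixes E :: "'a::euclidean_space set"
  assumes E: "subspace E"
  shows "(\<Sum>b\<in>Basis. (norm (orth_proj E b))\<^sup>2) = dim E"
proof -
  obtain B where B: "orthonormal_basis_of E B" using orthonormal_basis_of_exists[OF E] by blast
  note BD = orthonormal_basis_ofD[OF B]
  have P: "orth_proj E x = (\<Sum>e\<in>B. (x \<bullet> e) *\<^sub>R e)" for x
  proof (rule orth_proj_unique[OF E onb_sum_in[OF B]])
    define w where "w = x - (\<Sum>e\<in>B. (x \<bullet> e) *\<^sub>R e)"
    have "e \<bullet> w = 0" if "e \<in> B" for e
    proof -
      have "e \<bullet> (\<Sum>e\<in>B. (x \<bullet> e) *\<^sub>R e) = (\<Sum>e'\<in>B. if e = e' then x \<bullet> e' else 0)"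
        unfolding inner_sum_right using that BD(7) by (intro sum.cong) auto
      then show ?thesis using that BD(1) by (simp add: w_def inner_diff_right inner_commute)
    qed
    then have "orthogonal y w" if "y \<in> span B" for y
      using that by (metis orthogonal_commute orthogonal_def orthogonal_to_span)
    then show "w \<in> E\<^sup>\<bottom>" by (simp add: orthogonal_comp_def BD(6))
  qed
  have "(\<Sum>b\<in>Basis. (norm (orth_proj E b))\<^sup>2) = (\<Sum>b\<in>Basis. \<Sum>e\<in>B. (b \<bullet> e)\<^sup>2)"
    unfolding P onb_norm_sum[OF B] ..
  also have "\<dots> = (\<Sum>e\<in>B. \<Sum>b\<in>Basis. (e \<bullet> b) * (e \<bullet> b))"
    by (subst sum.swap) (simp add: power2_eq_square inner_commute)
  also have "\<dots> = (\<Sum>e\<in>B. e \<bullet> e)" by (subst euclidean_inner[symmetric]) simp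
  also have "\<dots> = (\<Sum>e\<in>B. 1)" using BD(7) by (intro sum.cong) auto
  finally show ?thesis using BD(3) by simp
qed

text \<open>The trace of the decomposition of the identity. It makes the normalising powers of
  \<open>sqrt (2 * pi * s)\<close> agree on the two sides of the inequality.\<close>

lemma (in tight_frame) sum_dim: "(\<Sum>i\<in>I. c i * real (dim (E i))) = DIM('a)"
proof -
  have "(\<Sum>i\<in>I. c i * real (dim (E i))) = (\<Sum>i\<in>I. \<Sum>b\<in>Basis. c i * (norm (orth_proj (E i) b))\<^sup>2)"
    using sum_norm_orth_proj_Basis[OF subE] by (intro sum.cong) (auto simp: sum_distrib_left[symmetric])
  also have "\<dots> = (\<Sum>b\<in>Basis. \<Sum>i\<in>I. c i * (norm (orth_proj (E i) b))\<^sup>2)" by (rule sum.swap)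
  also have "\<dots> = (\<Sum>b\<in>(Basis::'a set). (norm b)\<^sup>2)" unfolding norm_frame[symmetric] ..
  also have "\<dots> = DIM('a)" by simp
  finally show ?thesis .
qed

lemma (in lip) lheat_tendsto_0: "(\<lambda>j. lheat (1 / real (Suc j)) u x) \<longlonglongrightarrow> u x"
proof -
  have "(\<lambda>j. (1 / real (Suc j), x)) \<longlonglongrightarrow> (0, x)"
    by (intro tendsto_intros LIMSEQ_Suc[OF lim_1_over_n])
  then have "(\<lambda>j. case (1 / real (Suc j), x) of (t, x) \<Rightarrow> lheat t u x) \<longlonglongrightarrow> (case (0, x) of (t, x) \<Rightarrow> lheat t u x)"
    by (intro continuous_on_tendsto_compose[OF continuous_on_lheat]) auto
  then show ?thesis by simp
qed

text \<open>Without mixed second derivatives the slope along \<open>w\<close> is unchanged by the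
  shift by \<open>e\<close>; integrating it along \<open>w\<close> separates the two
  variables.\<close>

lemma (in lip) lheat_split:
  assumes t: "t > 0" and h: "\<And>z. lhess t u z e w = 0"
  shows "lheat t u (e + w) = lheat t u e + lheat t u w - lheat t u 0"
proof -
  have g: "lgrad t u (z + e) w = lgrad t u z w" for z
    using DERIV_isconst_all[of "\<lambda>s. lgrad t u (z + s *\<^sub>R e) w" 1 0] lgrad_has_derivative[OF t, of z e w] h by simp
  have "((\<lambda>s. lheat t u (e + s *\<^sub>R w) - lheat t u (0 + s *\<^sub>R w)) has_real_derivative 0) (at s)" for s
    by (rule DERIV_cong[OF DERIV_diff[OF lheat_has_derivative[OF t] lheat_has_derivative[OF t]]])
      (use g[of "s *\<^sub>R w"] in \<open>simp add: add.commute[of e]\<close>)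
  from DERIV_isconst_all[of "\<lambda>s. lheat t u (e + s *\<^sub>R w) - lheat t u (0 + s *\<^sub>R w)" 1 0, OF allI, OF this]
  show ?thesis by simp
qed

text \<open>What the proof uses of a Minkowski gauge. The lower bound by \<open>m * norm x\<close>
  gives integrability and coercivity, and the Lipschitz bound makes \<open>exp (- N)\<close> an
  admissible start of the flow.\<close>

locale gauge_fun =
  fixes N :: "'a::euclidean_space \<Rightarrow> real" and L m :: real
  assumes lipN: "lip (\<lambda>x. - N x) L" and mpos: "m > 0" and N_ge: "\<And>x. m * norm x \<le> N x"
    and N_add: "\<And>x y. N (x + y) \<le> N x + N y" and N_scale: "\<And>r x. r > 0 \<Longrightarrow> N (r *\<^sub>R x) = r * N x"
begin

lemma N_nonneg: "N x \<ge> 0"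
  using N_ge[of x] mpos by (meson mult_nonneg_nonneg norm_ge_zero order_trans less_imp_le)

lemma N_0 [simp]: "N 0 = 0"
  using N_scale[of 2 0] by simp

lemma N_scale0: "r \<ge> 0 \<Longrightarrow> N (r *\<^sub>R x) = r * N x"
  using N_scale[of r x] by (cases "r = 0") auto

lemma N_sum: "finite A \<Longrightarrow> N (\<Sum>i\<in>A. f i) \<le> (\<Sum>i\<in>A. N (f i))"
  by (induction A rule: finite_induct) (auto intro: order_trans[OF N_add])

lemma measurable_N [measurable]: "N \<in> borel_measurable borel"
proof -
  have "(\<lambda>x. - (- N x)) \<in> borel_measurable borel"
    by (intro borel_measurable_uminus lip.measurable_u[OF lipN])
  then show ?thesis by simp
qed

lemma lip_proj:
  assumes "subspace F"
  shows "lip (\<lambda>x. - N (orth_proj F x)) L"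
proof
  interpret N: lip "\<lambda>x. - N x" L by (rule lipN)
  show "L-lipschitz_on UNIV (\<lambda>x. - N (orth_proj F x))"
  proof (rule lipschitz_onI)
    fix x y :: 'a
    have "dist (- N (orth_proj F x)) (- N (orth_proj F y)) \<le> L * dist (orth_proj F x) (orth_proj F y)"
      by (rule lipschitz_onD[OF N.lipschitz]) auto
    also have "dist (orth_proj F x) (orth_proj F y) \<le> dist x y"
      using norm_orth_proj_le[OF assms, of "x - y"] linear_diff[OF linear_orth_proj[OF assms]] by (simp add: dist_norm)
    finally show "dist (- N (orth_proj F x)) (- N (orth_proj F y)) \<le> L * dist x y"
      using N.L0 by (simp add: mult_left_mono)
  qed (rule N.L0)
qed

text \<open>This is the integral of \<open>exp (- N)\<close> over \<open>F\<close>, see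
  \<open>integrable_exp_N\<close>. With the factorial built in, the inequality has no constants
  left.\<close>

definition vol :: "'a set \<Rightarrow> real" where
  "vol F = fact (dim F) * measure (subspace_lborel F) {x. N x \<le> 1}"

text \<open>The flow lives in the whole space and the projection confines it to \<open>F\<close>, so
  all subspaces share one Gaussian measure.\<close>

definition heatvol :: "'a set \<Rightarrow> real \<Rightarrow> real" where
  "heatvol F s = exp (lheat s (\<lambda>x. - N (orth_proj F x)) 0)"

lemma emeasure_level_finite:
  assumes F: "subspace F"
  shows "emeasure (subspace_lborel F) {x. N x \<le> 1} < \<infinity>"
proof -
  \<comment> \<open>On the level set the norm is at most \<open>1 / m\<close>, where
    \<open>k\<close> times the Gaussian kernel is at least 1.\<close>
  define k where "k = exp (1 / (2 * m\<^sup>2))"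
  have k: "k \<ge> 0" by (simp add: k_def)
  have "emeasure (subspace_lborel F) {x. N x \<le> 1} = (\<integral>\<^sup>+x. indicator {x. N x \<le> 1} x \<partial>subspace_lborel F)"
    by simp
  also have "\<dots> \<le> (\<integral>\<^sup>+x. ennreal k * ennreal (gauss_kernel x) \<partial>subspace_lborel F)"
  proof (rule nn_integral_mono)
    fix x
    have "1 \<le> k * gauss_kernel x" if "N x \<le> 1"
    proof -
      have "m * norm x \<le> 1" using N_ge[of x] that by simp
      then have "norm x \<le> 1 / m" using mpos by (simp add: field_simps)
      then have "(norm x)\<^sup>2 \<le> (1 / m)\<^sup>2" by (intro power_mono) auto
      then have "0 \<le> 1 / (2 * m\<^sup>2) + - (norm x)\<^sup>2 / 2" by (simp add: power_divide)
      then have "1 \<le> exp (1 / (2 * m\<^sup>2) + - (norm x)\<^sup>2 / 2)" by (simp only: one_le_exp_iff)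
      then show ?thesis unfolding k_def by (simp only: exp_add)
    qed
    then show "indicator {x. N x \<le> 1} x \<le> ennreal k * ennreal (gauss_kernel x)"
      unfolding ennreal_mult[OF k exp_ge_zero, symmetric]
      by (auto simp: indicator_def simp flip: ennreal_1 intro!: ennreal_leI)
  qed
  also have "\<dots> = ennreal k * ennreal (sqrt (2 * pi) ^ dim F)"
    by (subst nn_integral_cmult) (auto simp: nn_integral_gauss_subspace[OF F, simplified])
  also have "\<dots> < \<infinity>" by (simp flip: ennreal_mult'')
  finally show ?thesis .
qed

lemma nn_integral_exp_N:
  assumes F: "subspace F"
  shows "(\<integral>\<^sup>+x. ennreal (exp (- N x)) \<partial>subspace_lborel F) = ennreal (vol F)"
proof -
  have "(\<integral>\<^sup>+x. ennreal (exp (- N x)) \<partial>subspace_lborel F)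
      = ennreal (fact (dim F)) * emeasure (subspace_lborel F) {x. N x \<le> 1}"
    by (rule nn_integral_exp_neg_gauge[OF F]) (auto simp: N_nonneg N_scale)
  also have "emeasure (subspace_lborel F) {x. N x \<le> 1} = ennreal (measure (subspace_lborel F) {x. N x \<le> 1})"
    using emeasure_level_finite[OF F] by (intro emeasure_eq_ennreal_measure) auto
  finally show ?thesis by (simp add: vol_def ennreal_mult)
qed

lemma integrable_exp_N:
  assumes F: "subspace F"
  shows "integrable (subspace_lborel F) (\<lambda>x. exp (- N x))" "(LINT x|subspace_lborel F. exp (- N x)) = vol F"
proof -
  show int: "integrable (subspace_lborel F) (\<lambda>x. exp (- N x))"
    by (rule integrableI_bounded) (auto simp: nn_integral_exp_N[OF F])
  have "ennreal (LINT x|subspace_lborel F. exp (- N x)) = ennreal (vol F)"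
    using nn_integral_eq_integral[OF int] nn_integral_exp_N[OF F] by simp
  then show "(LINT x|subspace_lborel F. exp (- N x)) = vol F"
    by (subst (asm) ennreal_inj) (auto simp: vol_def)
qed

lemma heatvol_eq:
  assumes F: "subspace F" and s: "s > 0"
  shows "sqrt (2 * pi * s) ^ dim F * heatvol F s = (LINT x|subspace_lborel F. exp (- (norm x)\<^sup>2 / (2 * s)) * exp (- N x))"
proof -
  interpret l: lip "\<lambda>x. - N (orth_proj F x)" L by (rule lip_proj[OF F])
  have int: "integrable (subspace_lborel F) (\<lambda>x. exp (- (norm x)\<^sup>2 / (2 * s)) * exp (- N x))"
    by (rule Bochner_Integration.integrable_bound[OF integrable_exp_N(1)[OF F]]) (use s in auto)
  have "ennreal (sqrt (2 * pi * s) ^ dim F * heatvol F s)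
    = ennreal (sqrt (2 * pi * s) ^ dim F) * (\<integral>\<^sup>+y. ennreal (exp (- N (orth_proj F (0 + sqrt s *\<^sub>R y)))) \<partial>std_gauss)"
    unfolding heatvol_def using s by (simp add: ennreal_mult l.nn_exp_lheat)
  also have "\<dots> = ennreal (sqrt (2 * pi * s) ^ dim F) * (\<integral>\<^sup>+y. ennreal (exp (- N (sqrt s *\<^sub>R orth_proj F y))) \<partial>std_gauss)"
    using linear_scale[OF linear_orth_proj[OF F]] by simp
  also have "\<dots> = (\<integral>\<^sup>+x. ennreal (exp (- (norm x)\<^sup>2 / (2 * s))) * ennreal (exp (- N x)) \<partial>subspace_lborel F)"
    by (rule nn_integral_std_gauss_proj_scale[OF F _ s]) measurable
  also have "\<dots> = (\<integral>\<^sup>+x. ennreal (exp (- (norm x)\<^sup>2 / (2 * s)) * exp (- N x)) \<partial>subspace_lborel F)"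
    by (simp add: ennreal_mult)
  also have "\<dots> = ennreal (LINT x|subspace_lborel F. exp (- (norm x)\<^sup>2 / (2 * s)) * exp (- N x))"
    by (rule nn_integral_eq_integral[OF int]) auto
  finally show ?thesis
    using s by (subst (asm) ennreal_inj) (auto simp: heatvol_def)
qed

text \<open>By \<open>heatvol_eq\<close> the left side integrates \<open>exp (- N)\<close> against a
  weight that is at most 1 and tends to 1; dominated convergence applies.\<close>

lemma heatvol_tendsto:
  assumes F: "subspace F"
  shows "((\<lambda>s. sqrt (2 * pi * s) ^ dim F * heatvol F s) \<longlongrightarrow> vol F) at_top"
proof -
  have "((\<lambda>s. LINT x|subspace_lborel F. exp (- (norm x)\<^sup>2 / (2 * s)) * exp (- N x)) \<longlongrightarrow> (LINT x|subspace_lborel F. exp (- N x))) at_top"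
  proof (rule integral_dominated_convergence_at_top[OF _ _ integrable_exp_N(1)[OF F]])
    show "\<forall>\<^sub>F s in at_top. AE x in subspace_lborel F. norm (exp (- (norm x)\<^sup>2 / (2 * s)) * exp (- N x)) \<le> exp (- N x)"
      using eventually_gt_at_top[of 0] by eventually_elim auto
    show "AE x in subspace_lborel F. ((\<lambda>s. exp (- (norm x)\<^sup>2 / (2 * s)) * exp (- N x)) \<longlongrightarrow> exp (- N x)) at_top"
    proof (intro AE_I2)
      fix x :: 'a
      have "((\<lambda>s::real. - (norm x)\<^sup>2 / (2 * s)) \<longlongrightarrow> 0) at_top"
        by (intro tendsto_divide_0[OF tendsto_const] filterlim_at_top_imp_at_infinity
            filterlim_tendsto_pos_mult_at_top[OF tendsto_const] filterlim_ident) simp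
      then have "((\<lambda>s. exp (- (norm x)\<^sup>2 / (2 * s)) * exp (- N x)) \<longlongrightarrow> exp 0 * exp (- N x)) at_top"
        by (intro tendsto_mult tendsto_exp tendsto_const)
      then show "((\<lambda>s. exp (- (norm x)\<^sup>2 / (2 * s)) * exp (- N x)) \<longlongrightarrow> exp (- N x)) at_top" by simp
    qed
  qed measurable
  then have "((\<lambda>s. LINT x|subspace_lborel F. exp (- (norm x)\<^sup>2 / (2 * s)) * exp (- N x)) \<longlongrightarrow> vol F) at_top"
    by (simp add: integrable_exp_N(2)[OF F])
  moreover have "\<forall>\<^sub>F s in at_top. (LINT x|subspace_lborel F. exp (- (norm x)\<^sup>2 / (2 * s)) * exp (- N x)) = sqrt (2 * pi * s) ^ dim F * heatvol F s"
    using eventually_gt_at_top[of 0] by eventually_elim (simp add: heatvol_eq[OF F])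
  ultimately show ?thesis by (rule Lim_transform_eventually)
qed

text \<open>A flow restarted at \<open>t\<close> is normalised for the elapsed time \<open>s\<close>
  but has total time \<open>s + t\<close>; the quotient of the two normalisations tends to
  1.\<close>

lemma heatvol_tendsto_shift:
  assumes F: "subspace F" and t: "t > 0"
  shows "((\<lambda>s. sqrt (2 * pi * s) ^ dim F * heatvol F (s + t)) \<longlongrightarrow> vol F) at_top"
proof -
  have sh: "filterlim (\<lambda>s. s + t) at_top at_top"
    using filterlim_tendsto_add_at_top[OF tendsto_const[of t] filterlim_ident] by (simp add: add.commute)
  have 1: "((\<lambda>s. sqrt (2 * pi * (s + t)) ^ dim F * heatvol F (s + t)) \<longlongrightarrow> vol F) at_top"
    by (rule filterlim_compose[OF heatvol_tendsto[OF F] sh])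
  have "((\<lambda>s. 1 - t / (s + t)) \<longlongrightarrow> 1 - 0) at_top"
    by (intro tendsto_diff tendsto_const tendsto_divide_0[OF tendsto_const] filterlim_at_top_imp_at_infinity[OF sh])
  moreover have "\<forall>\<^sub>F s in at_top. 1 - t / (s + t) = s / (s + t)"
    using eventually_gt_at_top[of 0] by eventually_elim (use t in \<open>simp add: field_simps\<close>)
  ultimately have "((\<lambda>s. s / (s + t)) \<longlongrightarrow> 1) at_top"
    by (simp add: Lim_transform_eventually)
  then have 2: "((\<lambda>s. sqrt (s / (s + t)) ^ dim F) \<longlongrightarrow> sqrt 1 ^ dim F) at_top"
    by (intro tendsto_intros)
  have "((\<lambda>s. sqrt (s / (s + t)) ^ dim F * (sqrt (2 * pi * (s + t)) ^ dim F * heatvol F (s + t))) \<longlongrightarrow> sqrt 1 ^ dim F * vol F) at_top"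
    by (intro tendsto_mult 1 2)
  moreover have "\<forall>\<^sub>F s in at_top. sqrt (s / (s + t)) ^ dim F * (sqrt (2 * pi * (s + t)) ^ dim F * heatvol F (s + t)) = sqrt (2 * pi * s) ^ dim F * heatvol F (s + t)"
    using eventually_gt_at_top[of 0]
  proof eventually_elim
    case (elim s)
    then have "s / (s + t) * (2 * pi * (s + t)) = 2 * pi * s" using t by simp
    then show ?case by (simp only: mult.assoc[symmetric] power_mult_distrib[symmetric] real_sqrt_mult[symmetric])
  qed
  ultimately show ?thesis
    by (simp add: Lim_transform_eventually)
qed

end

subsection \<open>Equality\<close>

locale gauge_frame = gauge_fun N L m + tight_frame I E c
  for N :: "'a::euclidean_space \<Rightarrow> real" and L m :: real
    and I :: "'i set" and E :: "'i \<Rightarrow> 'a set" and c :: "'i \<Rightarrow> real"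
begin

definition U :: "'a \<Rightarrow> real" where "U x = - N x"

definition V :: "'i \<Rightarrow> 'a \<Rightarrow> real" where "V i x = - N (orth_proj (E i) x)"

sublocale T: tight_frame_lip I E c U L V
proof (intro tight_frame_lip.intro tight_frame_lip_axioms.intro)
  show "tight_frame I E c" by unfold_locales
  show "lip U L" using lipN by (simp add: U_def[abs_def])
  show "lip (V i) L" if "i \<in> I" for i using lip_proj[OF subE[OF that]] by (simp add: V_def[abs_def])
qed

text \<open>Subadditivity and homogeneity of the gauge say that the deficit is nonnegative at time
  0.\<close>

lemma sum_V_le: "(\<Sum>i\<in>I. c i * V i (x i)) \<le> U (S x)"
proof -
  have "N (S x) \<le> (\<Sum>i\<in>I. N (c i *\<^sub>R orth_proj (E i) (x i)))"
    unfolding S_def by (rule N_sum[OF finI])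
  also have "\<dots> = (\<Sum>i\<in>I. c i * N (orth_proj (E i) (x i)))"
    using cpos by (intro sum.cong refl N_scale) auto
  finally show ?thesis by (simp add: U_def V_def sum_negf)
qed

lemma C_nonneg: "t \<ge> 0 \<Longrightarrow> T.C t x \<ge> 0"
  by (rule T.maximum_principle[OF sum_V_le])

lemma lheat_V_proj:
  assumes i: "i \<in> I"
  shows "lheat t (V i) (orth_proj (E i) x) = lheat t (V i) x"
proof -
  interpret l: lip "V i" L by (rule T.lipv[OF i])
  define e where "e = orth_proj (E i) x - x"
  note lin = linear_orth_proj[OF subE[OF i]]
  have "orth_proj (E i) e = 0" by (simp add: e_def linear_diff[OF lin] orth_proj_proj[OF subE[OF i]])
  then have "V i (y + s *\<^sub>R e) = V i y" for y s
    by (simp add: V_def linear_add[OF lin] linear_scale[OF lin])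
  from l.lheat_invariant[OF this, of t x 1] show ?thesis by (simp add: e_def)
qed

text \<open>By the gap, subtracting the bump \<open>w\<close> from the flow of \<open>U\<close> at
  time \<open>t\<close> preserves the initial inequality, so the maximum principle applies to the
  restarted flows. At infinite time it bounds the product of volumes by
  \<open>vol UNIV - \<kappa>\<close>, where \<open>\<kappa> > 0\<close> bounds the loss from below,
  against the assumed equality.\<close>

lemma no_gap:
  assumes eq: "vol UNIV = (\<Prod>i\<in>I. vol (E i) powr c i)" and t: "t > 0" and \<delta>: "\<delta> > 0"
    and gap: "\<And>x. \<delta> - norm (S x - z) \<le> T.C t x"
  shows False
proof -
  \<comment> \<open>A cone of slope 1, so that subtracting it raises the Lipschitz constant to
    \<open>L + 1\<close> only.\<close>
  define w where "w y = max 0 (\<delta> - norm (y - z))" for y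
  define U' where "U' y = lheat t U y - w y" for y
  define V' where "V' i = lheat t (V i)" for i
  have w0: "w y \<ge> 0" for y by (simp add: w_def)
  have lipU: "lip (lheat t U) L" by standard (use T.U.lheat_lipschitz t in auto)
  have lipU': "lip U' (L + 1)"
  proof
    show "(L + 1)-lipschitz_on UNIV U'"
    proof (rule lipschitz_onI)
      fix x y :: 'a
      have "\<bar>norm (x - z) - norm (y - z)\<bar> \<le> norm (x - y)"
        using norm_triangle_ineq3[of "x - z" "y - z"] by simp
      then have 1: "\<bar>w x - w y\<bar> \<le> norm (x - y)" unfolding w_def by linarith
      have "\<bar>lheat t U x - lheat t U y\<bar> \<le> L * norm (x - y)"
        using lipschitz_onD[OF T.U.lheat_lipschitz, of t x y] t by (simp add: dist_norm)
      then have "\<bar>U' x - U' y\<bar> \<le> L * norm (x - y) + norm (x - y)"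
        unfolding U'_def using 1 by linarith
      then show "dist (U' x) (U' y) \<le> (L + 1) * dist x y" by (simp add: dist_norm distrib_right)
    qed (use T.U.L0 in simp)
  qed
  have lipV': "lip (V' i) (L + 1)" if "i \<in> I" for i
  proof
    show "(L + 1)-lipschitz_on UNIV (V' i)"
      unfolding V'_def by (rule lipschitz_on_le[OF lip.lheat_lipschitz[OF T.lipv[OF that]]]) (use t in auto)
  qed
  interpret T': tight_frame_lip I E c U' "L + 1" V'
    by (intro tight_frame_lip.intro tight_frame_lip_axioms.intro lipU' lipV' tight_frame_axioms)
  have "(\<Sum>i\<in>I. c i * V' i (x i)) \<le> U' (S x)" for x
    using gap[of x] C_nonneg[of t x] t by (simp add: U'_def V'_def w_def T.C_def)
  from T'.maximum_principle[OF this, of _ "\<lambda>_. 0"]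
  have mp: "(\<Sum>i\<in>I. c i * lheat s (V' i) 0) \<le> lheat s U' 0" if "s \<ge> 0" for s
    using that by (simp add: T'.C_def S_const)
  define n where "n = DIM('a)"
  define h where "h y = exp (lheat t U y) - exp (U' y)" for y
  interpret HU: lip "lheat t U" L by (rule lipU)
  have h0: "h y \<ge> 0" for y unfolding h_def U'_def using w0[of y] by simp
  have hpos: "h y > 0" if "y \<in> ball z \<delta>" for y
    using that by (simp add: h_def U'_def w_def dist_norm norm_minus_commute)
  have [measurable]: "h \<in> borel_measurable borel"
    unfolding h_def by measurable
  have hint: "integrable std_gauss (\<lambda>y. h (sqrt s *\<^sub>R y))" if "s \<ge> 0" for s
    unfolding h_def using HU.integrable_weight_1[OF that, of 0] T'.U.integrable_weight_1[OF that, of 0] by simp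
  define K where "K = (LINT y|std_gauss. h y)"
  have Kpos: "K > 0"
  proof -
    have int: "integrable std_gauss h" using hint[of 1] by simp
    have "K \<ge> 0" unfolding K_def using h0 by (intro Bochner_Integration.integral_nonneg) auto
    moreover have "K \<noteq> 0"
    proof
      assume "K = 0"
      then have "AE y in std_gauss. h y = 0"
        unfolding K_def using h0 by (subst (asm) integral_nonneg_eq_0_iff_AE[OF int]) auto
      then have "AE y in lborel. h y = 0"
        unfolding std_gauss_def by (subst (asm) AE_density) auto
      then have "AE y in lborel. y \<notin> ball z \<delta>"
        by eventually_elim (use hpos in fastforce)
      then have "ball z \<delta> \<in> null_sets lborel"
        by (subst AE_iff_null_sets) auto
      then have "negligible (ball z \<delta>)"
        unfolding negligible_iff_null_sets by (rule null_sets_completionI)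
      then show False using open_not_negligible[of "ball z \<delta>"] \<delta> by simp
    qed
    ultimately show ?thesis by simp
  qed
  \<comment> \<open>After normalisation the kernel is
    \<open>exp (- (norm x)\<^sup>2 / (2 * s))\<close>, which increases with \<open>s\<close>; so the
    loss at every time \<open>s \<ge> 1\<close> is at least the one at time 1.\<close>
  have K_le': "ennreal (sqrt (2 * pi) ^ n * K) \<le> ennreal (sqrt (2 * pi * s) ^ n * (LINT y|std_gauss. h (sqrt s *\<^sub>R y)))" if s: "s \<ge> 1" for s
  proof -
    have *: "ennreal (sqrt (2 * pi * r) ^ n * (LINT y|std_gauss. h (sqrt r *\<^sub>R y)))
       = (\<integral>\<^sup>+x. ennreal (exp (- (norm x)\<^sup>2 / (2 * r))) * ennreal (h x) \<partial>lborel)" if r: "r > 0" for r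
    proof -
      have "ennreal (sqrt (2 * pi * r) ^ n * (LINT y|std_gauss. h (sqrt r *\<^sub>R y)))
        = ennreal (sqrt (2 * pi * r) ^ n) * (\<integral>\<^sup>+y. ennreal (h (sqrt r *\<^sub>R y)) \<partial>std_gauss)"
        using r hint[of r] h0 by (simp add: nn_integral_eq_integral ennreal_mult')
      then show ?thesis
        using nn_integral_std_gauss_proj_scale[OF subspace_UNIV, of "\<lambda>x. ennreal (h x)" r] r
        by (simp add: n_def subspace_lborel_UNIV)
    qed
    have "ennreal (sqrt (2 * pi) ^ n * K) = (\<integral>\<^sup>+x. ennreal (exp (- (norm x)\<^sup>2 / (2 * 1))) * ennreal (h x) \<partial>lborel)"
      using *[of 1] by (simp add: K_def)
    also have "\<dots> \<le> (\<integral>\<^sup>+x. ennreal (exp (- (norm x)\<^sup>2 / (2 * s))) * ennreal (h x) \<partial>lborel)"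
      using s by (intro nn_integral_mono mult_right_mono ennreal_leI) (auto simp: divide_simps mult_le_cancel_left1)
    finally show ?thesis using *[of s] s by simp
  qed
  have K_le: "sqrt (2 * pi) ^ n * K \<le> sqrt (2 * pi * s) ^ n * (LINT y|std_gauss. h (sqrt s *\<^sub>R y))" if s: "s \<ge> 1" for s
    using K_le'[OF s] s h0
    by (subst (asm) ennreal_le_iff) (auto intro!: mult_nonneg_nonneg Bochner_Integration.integral_nonneg)
  define \<kappa> where "\<kappa> = sqrt (2 * pi) ^ n * K"
  have \<kappa>: "\<kappa> > 0" using Kpos by (simp add: \<kappa>_def)
  have upper: "sqrt (2 * pi * s) ^ n * exp (lheat s U' 0) \<le> sqrt (2 * pi * s) ^ n * heatvol UNIV (s + t) - \<kappa>" if s: "s \<ge> 1" for s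
  proof -
    have s0: "s \<ge> 0" "s > 0" using s by auto
    have "(LINT y|std_gauss. h (sqrt s *\<^sub>R y)) = exp (lheat s (lheat t U) 0) - exp (lheat s U' 0)"
      unfolding h_def HU.exp_lheat[OF s0(1)] T'.U.exp_lheat[OF s0(1)]
      using HU.integrable_weight_1[OF s0(1), of 0] T'.U.integrable_weight_1[OF s0(1), of 0] by simp
    also have "lheat s (lheat t U) 0 = lheat (s + t) U 0"
      by (rule T.U.lheat_semigroup[OF s0(2) t])
    also have "exp (lheat (s + t) U 0) = heatvol UNIV (s + t)" by (simp add: heatvol_def U_def[abs_def])
    finally show ?thesis using K_le[OF s] by (simp add: \<kappa>_def right_diff_distrib)
  qed
  have lower: "(\<Prod>i\<in>I. (sqrt (2 * pi * s) ^ dim (E i) * heatvol (E i) (s + t)) powr c i) \<le> sqrt (2 * pi * s) ^ n * exp (lheat s U' 0)"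
    if s: "s \<ge> 1" for s
  proof -
    have s0: "s \<ge> 0" "s > 0" using s by auto
    define r where "r = sqrt (2 * pi * s)"
    have r: "r > 0" using s0 by (simp add: r_def)
    have 1: "(r ^ dim (E i) * heatvol (E i) (s + t)) powr c i = exp (c i * real (dim (E i)) * ln r + c i * lheat s (V' i) 0)"
      if i: "i \<in> I" for i
    proof -
      have "heatvol (E i) (s + t) = exp (lheat s (V' i) 0)"
        unfolding heatvol_def V'_def lip.lheat_semigroup[OF T.lipv[OF i] s0(2) t] by (simp add: V_def[abs_def])
      moreover have "r ^ dim (E i) = exp (real (dim (E i)) * ln r)"
        using r by (simp add: powr_realpow[symmetric] powr_def)
      ultimately show ?thesis by (simp add: powr_def exp_add[symmetric] distrib_left)
    qed
    have "(\<Prod>i\<in>I. (r ^ dim (E i) * heatvol (E i) (s + t)) powr c i) = exp (\<Sum>i\<in>I. c i * real (dim (E i)) * ln r + c i * lheat s (V' i) 0)"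
      using 1 finI by (simp add: exp_sum)
    also have "(\<Sum>i\<in>I. c i * real (dim (E i)) * ln r + c i * lheat s (V' i) 0) = real n * ln r + (\<Sum>i\<in>I. c i * lheat s (V' i) 0)"
      by (simp add: sum.distrib sum_distrib_right[symmetric] sum_dim n_def)
    also have "exp \<dots> = r ^ n * exp (\<Sum>i\<in>I. c i * lheat s (V' i) 0)"
      using r by (simp add: exp_add powr_realpow[symmetric] powr_def)
    also have "\<dots> \<le> r ^ n * exp (lheat s U' 0)"
      using mp[OF s0(1)] r by (intro mult_left_mono) auto
    finally show ?thesis unfolding r_def .
  qed
  have lim1: "((\<lambda>s. sqrt (2 * pi * s) ^ n * heatvol UNIV (s + t) - \<kappa>) \<longlongrightarrow> vol UNIV - \<kappa>) at_top"
    using heatvol_tendsto_shift[OF subspace_UNIV t] by (intro tendsto_diff tendsto_const) (simp add: n_def)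
  have lim2: "((\<lambda>s. \<Prod>i\<in>I. (sqrt (2 * pi * s) ^ dim (E i) * heatvol (E i) (s + t)) powr c i) \<longlongrightarrow> (\<Prod>i\<in>I. vol (E i) powr c i)) at_top"
  proof (intro tendsto_prod tendsto_powr' heatvol_tendsto_shift subE t tendsto_const)
    fix i assume "i \<in> I"
    moreover have "\<forall>\<^sub>F s in at_top. 0 \<le> sqrt (2 * pi * s) ^ dim (E i) * heatvol (E i) (s + t)"
      using eventually_ge_at_top[of 0] by eventually_elim (simp add: heatvol_def)
    ultimately show "vol (E i) \<noteq> 0 \<or> 0 < c i \<and> (\<forall>\<^sub>F s in at_top. 0 \<le> sqrt (2 * pi * s) ^ dim (E i) * heatvol (E i) (s + t))"
      using cpos by blast
  qed
  have "(\<Prod>i\<in>I. vol (E i) powr c i) \<le> vol UNIV - \<kappa>"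
  proof (rule tendsto_le[OF _ lim1 lim2])
    show "\<forall>\<^sub>F s in at_top. (\<Prod>i\<in>I. (sqrt (2 * pi * s) ^ dim (E i) * heatvol (E i) (s + t)) powr c i) \<le> sqrt (2 * pi * s) ^ n * heatvol UNIV (s + t) - \<kappa>"
      using eventually_ge_at_top[of 1] by eventually_elim (use upper lower in \<open>blast intro: order_trans\<close>)
  qed simp
  then show False using eq \<kappa> by simp
qed

text \<open>Minimise the deficit plus the distance of \<open>S x\<close> from \<open>z\<close>. A
  positive minimum would be a gap in the sense of \<open>no_gap\<close>, so it is 0 and both terms
  vanish. The minimum is attained because projecting \<open>x i\<close> to \<open>E i\<close>
  changes neither term, and on \<open>E i\<close> the flow of \<open>V i\<close> decreases
  linearly.\<close>

lemma fibre_zero: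
  assumes eq: "vol UNIV = (\<Prod>i\<in>I. vol (E i) powr c i)" and t: "t > 0"
  obtains x where "S x = z" "T.C t x = 0"
proof -
  define \<Phi> where "\<Phi> x = T.C t x + norm (S x - z)" for x
  have "\<exists>M. \<forall>x. \<bar>lheat t (V i) x - V i x\<bar> \<le> M" if "i \<in> I" for i
    using lip.lheat_near[OF T.lipv[OF that], of t] t by (metis less_imp_le order_refl)
  then obtain M where M: "\<And>i x. i \<in> I \<Longrightarrow> \<bar>lheat t (V i) x - V i x\<bar> \<le> M i" by metis
  have M0: "M i \<ge> 0" if "i \<in> I" for i using M[OF that, of 0] by simp
  \<comment> \<open>\<open>B\<close> and \<open>R\<close> are such that one coordinate of norm above
    \<open>R\<close> forces the deficit to be at least 1, as long as \<open>S y\<close> is within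
    distance 1 of \<open>z\<close>; otherwise the distance term alone exceeds 1.\<close>
  define B where "B = \<bar>lheat t U z\<bar> + L + (\<Sum>i\<in>I. c i * M i) + 1"
  have B: "B > 0"
    unfolding B_def using T.U.L0 M0 cpos
    by (intro add_nonneg_pos add_nonneg_nonneg sum_nonneg mult_nonneg_nonneg) (auto intro: less_imp_le)
  define R where "R = (\<Sum>i\<in>I. B / (c i * m))"
  define D where "D = Pi\<^sub>E UNIV (\<lambda>i. if i \<in> I then E i \<inter> cball 0 R else {0})"
  have far: "\<Phi> y \<ge> 1" if yE: "\<And>i. i \<in> I \<Longrightarrow> y i \<in> E i" and i: "i \<in> I" and big: "norm (y i) > R" for y i
  proof (cases "norm (S y - z) \<le> 1")
    case True
    have "\<bar>lheat t U (S y) - lheat t U z\<bar> \<le> L * norm (S y - z)"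
      using lipschitz_onD[OF T.U.lheat_lipschitz, of t "S y" z] t by (simp add: dist_norm)
    also have "\<dots> \<le> L" using True T.U.L0 by (simp add: mult_left_le)
    finally have 1: "lheat t U (S y) \<ge> lheat t U z - L" by linarith
    have "(\<Sum>j\<in>I. c j * lheat t (V j) (y j)) \<le> (\<Sum>j\<in>I. c j * M j - c j * (m * norm (y j)))"
    proof (rule sum_mono)
      fix j assume j: "j \<in> I"
      have "lheat t (V j) (y j) \<le> M j - m * norm (y j)"
        using M[OF j, of "y j"] N_ge[of "y j"] orth_proj_id[OF subE[OF j] yE[OF j]] by (simp add: V_def abs_le_iff)
      then have "c j * lheat t (V j) (y j) \<le> c j * (M j - m * norm (y j))"
        using cpos[OF j] by (intro mult_left_mono) auto
      then show "c j * lheat t (V j) (y j) \<le> c j * M j - c j * (m * norm (y j))" by (simp add: right_diff_distrib)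
    qed
    also have "\<dots> = (\<Sum>j\<in>I. c j * M j) - (\<Sum>j\<in>I. c j * (m * norm (y j)))" by (rule sum_subtractf)
    finally have 3: "(\<Sum>j\<in>I. c j * lheat t (V j) (y j)) \<le> (\<Sum>j\<in>I. c j * M j) - (\<Sum>j\<in>I. c j * (m * norm (y j)))" .
    have "(\<Sum>j\<in>I. c j * (m * norm (y j))) \<ge> c i * (m * norm (y i))"
      using finI cpos mpos by (intro member_le_sum[OF i]) (auto intro!: mult_nonneg_nonneg intro: less_imp_le)
    with 3 have 2: "(\<Sum>j\<in>I. c j * lheat t (V j) (y j)) \<le> (\<Sum>j\<in>I. c j * M j) - c i * (m * norm (y i))" by simp
    have cm: "c i * m > 0" using cpos[OF i] mpos by simp
    have "B / (c i * m) \<le> R"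
      unfolding R_def using finI cpos mpos B by (intro member_le_sum[OF i]) (auto intro!: divide_nonneg_pos)
    then have "B / (c i * m) \<le> norm (y i)" using big by simp
    then have "B \<le> c i * (m * norm (y i))" using cm by (simp add: field_simps)
    then have "T.C t y \<ge> 1"
      unfolding T.C_def using 1 2 by (simp add: B_def)
    then show ?thesis unfolding \<Phi>_def by (meson add_increasing2 norm_ge_zero)
  next
    case False
    then show ?thesis using C_nonneg[of t y] t by (simp add: \<Phi>_def)
  qed
  have R0: "R \<ge> 0" unfolding R_def using B cpos mpos by (intro sum_nonneg) (auto intro!: divide_nonneg_pos)
  have "compact D"
    unfolding D_def using subE by (intro compact_fun_box) (auto intro!: closed_Int_compact closed_subspace)
  moreover have "(\<lambda>_. 0) \<in> D" using R0 subE by (auto simp: D_def subspace_0)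
  moreover have "continuous_on D \<Phi>"
  proof -
    have "continuous_on D (\<lambda>x. (t, x))" by (intro continuous_intros)
    from continuous_on_compose2[OF T.continuous_on_C this]
    have "continuous_on D (\<lambda>x. T.C t x)" using t by (simp add: image_subset_iff)
    then show ?thesis unfolding \<Phi>_def by (intro continuous_intros continuous_on_S)
  qed
  ultimately obtain x where x: "x \<in> D" "\<And>y. y \<in> D \<Longrightarrow> \<Phi> x \<le> \<Phi> y"
    using continuous_attains_inf[of D \<Phi>] by auto
  \<comment> \<open>Outside the compact set only the lower bound 1 is known, hence the minimum with
    1; this number serves as \<open>\<delta>\<close> in \<open>no_gap\<close>.\<close>
  have low: "min (\<Phi> x) 1 \<le> \<Phi> w" for w
  proof -
    define y where "y i = (if i \<in> I then orth_proj (E i) (w i) else 0)" for i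
    have yE: "y i \<in> E i" if "i \<in> I" for i using that by (simp add: y_def orth_proj_in[OF subE])
    have "S y = S w" unfolding S_def by (intro sum.cong) (auto simp: y_def orth_proj_proj[OF subE])
    moreover have "(\<Sum>i\<in>I. c i * lheat t (V i) (y i)) = (\<Sum>i\<in>I. c i * lheat t (V i) (w i))"
      by (intro sum.cong) (auto simp: y_def lheat_V_proj)
    ultimately have eq: "\<Phi> w = \<Phi> y" by (simp add: \<Phi>_def T.C_def)
    show ?thesis
    proof (cases "\<forall>i\<in>I. norm (y i) \<le> R")
      case True
      then have "y \<in> D" unfolding D_def using yE by (auto simp: y_def)
      then show ?thesis using x(2) eq by fastforce
    next
      case False
      then obtain i where "i \<in> I" "norm (y i) > R" by force
      then show ?thesis using far[OF yE] eq by fastforce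
    qed
  qed
  have nn: "T.C t x \<ge> 0" using C_nonneg t by simp
  have "\<not> \<Phi> x > 0"
  proof
    assume "\<Phi> x > 0"
    then have "min (\<Phi> x) 1 > 0" by simp
    from no_gap[OF eq t this, of z] low show False by (simp add: \<Phi>_def algebra_simps)
  qed
  then have "T.C t x + norm (S x - z) \<le> 0" by (simp add: \<Phi>_def)
  then have "T.C t x = 0" "norm (S x - z) = 0" using nn norm_ge_zero[of "S x - z"] by linarith+
  then show ?thesis using that by simp
qed

text \<open>\<open>V i\<close> does not see \<open>e\<close>, so \<open>hess_at_zero\<close> removes
  the mixed Hessian entries of the flow of \<open>U\<close> at every point. The splitting survives
  the limit at time 0, where the term at the origin disappears because
  \<open>N 0 = 0\<close>.\<close>

theorem equality_imp_split:
  assumes eq: "vol UNIV = (\<Prod>i\<in>I. vol (E i) powr c i)" and i: "i \<in> I"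
    and e: "e \<in> (E i)\<^sup>\<bottom>" and w: "w \<in> E i"
  shows "N (e + w) = N e + N w"
proof -
  note lin = linear_orth_proj[OF subE[OF i]]
  have Pe: "orth_proj (E i) e = 0" by (rule orth_proj_eq_0[OF subE[OF i] e])
  have Pw: "orth_proj (E i) w = w" by (rule orth_proj_id[OF subE[OF i] w])
  have inv: "V i (y + s *\<^sub>R e) = V i y" for y s
    by (simp add: V_def linear_add[OF lin] linear_scale[OF lin] Pe)
  have split: "lheat t U (e + w) = lheat t U e + lheat t U w - lheat t U 0" if t: "t > 0" for t
  proof (rule T.U.lheat_split[OF t])
    fix z
    obtain x where x: "S x = z" "T.C t x = 0" by (rule fibre_zero[OF eq t])
    have "lhess t U (S x) e (orth_proj (E i) w) = lhess t (V i) (x i) e w"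
      by (rule T.hess_at_zero[OF _ t x(2) i]) (simp add: C_nonneg)
    also have "\<dots> = 0" by (rule lip.lhess_invariant[OF T.lipv[OF i] inv t])
    finally show "lhess t U z e w = 0" by (simp add: x(1) Pw)
  qed
  have "(\<lambda>j. lheat (1 / real (Suc j)) U e + lheat (1 / real (Suc j)) U w - lheat (1 / real (Suc j)) U 0) \<longlonglongrightarrow> U e + U w - U 0"
    by (intro tendsto_intros T.U.lheat_tendsto_0)
  then have "(\<lambda>j. lheat (1 / real (Suc j)) U (e + w)) \<longlonglongrightarrow> U e + U w - U 0"
    by (simp add: split)
  from LIMSEQ_unique[OF this T.U.lheat_tendsto_0] show ?thesis by (simp add: U_def)
qed

end

subsection \<open>Convex bodies\<close>

definition minkowski_gauge :: "'a::real_vector set \<Rightarrow> 'a \<Rightarrow> real" where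
  "minkowski_gauge K x = Inf {r. r > 0 \<and> (1 / r) *\<^sub>R x \<in> K}"

text \<open>A ball of radius \<open>\<rho>\<close> inside \<open>K\<close> gives the Lipschitz
  constant \<open>1 / \<rho>\<close>, a bound \<open>R\<close> on the norms in \<open>K\<close>
  gives \<open>m = 1 / R\<close>, and convexity gives subadditivity. Closedness of \<open>K\<close>
  is what puts the points of gauge exactly 1 into \<open>K\<close>.\<close>

lemma gauge_fun_minkowski_gauge:
  fixes K :: "'a::euclidean_space set"
  assumes K: "compact K" "convex K" "0 \<in> interior K"
  obtains L m where "gauge_fun (minkowski_gauge K) L m" "K = {x. minkowski_gauge K x \<le> 1}"
proof -
  obtain \<rho> where \<rho>: "\<rho> > 0" "ball 0 \<rho> \<subseteq> K"
    using K(3) by (auto simp: mem_interior)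
  obtain R where R: "R > 0" "\<And>x. x \<in> K \<Longrightarrow> norm x \<le> R"
    using compact_imp_bounded[OF K(1)] unfolding bounded_pos by auto
  have K0: "0 \<in> K" using \<rho> by auto
  define A where "A x = {r. r > 0 \<and> (1 / r) *\<^sub>R x \<in> K}" for x
  define N where "N = minkowski_gauge K"
  have N: "N x = Inf (A x)" for x by (simp add: N_def A_def minkowski_gauge_def)
  have small: "r \<in> A x" if "r > norm x / \<rho>" for r x
  proof -
    have "r > 0" using that \<rho>(1) by (meson divide_nonneg_pos le_less_trans norm_ge_zero)
    then have "(1 / r) *\<^sub>R x \<in> ball 0 \<rho>" using that \<rho>(1) by (simp add: field_simps)
    then show ?thesis using \<open>r > 0\<close> \<rho>(2) by (auto simp: A_def)
  qed
  have ne: "A x \<noteq> {}" for x using small[of x "norm x / \<rho> + 1"] by auto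
  have bdd: "bdd_below (A x)" for x by (rule bdd_belowI[of _ 0]) (auto simp: A_def)
  have up: "s \<in> A x" if "r \<in> A x" "r \<le> s" for r s x
  proof -
    have r: "r > 0" "(1 / r) *\<^sub>R x \<in> K" "s > 0" using that by (auto simp: A_def)
    have "(r / s) *\<^sub>R ((1 / r) *\<^sub>R x) + (1 - r / s) *\<^sub>R 0 \<in> K"
      using r that(2) by (intro convexD[OF K(2)] K0) auto
    then show ?thesis using r by (simp add: A_def)
  qed
  have le: "N x \<le> r" if "r \<in> A x" for r x unfolding N by (rule cInf_lower[OF that bdd])
  have lt: "r \<in> A x" if "N x < r" for r x
    using that up unfolding N cInf_less_iff[OF ne bdd] by (auto intro: less_imp_le)
  have lower: "(1 / R) * norm x \<le> N x" for x
    unfolding N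
  proof (rule cInf_greatest[OF ne])
    fix r assume "r \<in> A x"
    then have "r > 0" "norm ((1 / r) *\<^sub>R x) \<le> R" using R(2) unfolding A_def by blast+
    then show "(1 / R) * norm x \<le> r" using R(1) by (simp add: field_simps)
  qed
  have upper: "N x \<le> (1 / \<rho>) * norm x" for x
    by (rule dense_ge) (use small le in auto)
  have nonneg: "N x \<ge> 0" for x
    using lower[of x] R(1) by (meson divide_nonneg_pos mult_nonneg_nonneg norm_ge_zero order_trans zero_le_one)
  have add: "N (x + y) \<le> N x + N y" for x y
  proof (rule field_le_epsilon)
    fix e :: real assume e: "e > 0"
    define r s where "r = N x + e / 2" and "s = N y + e / 2"
    have "r \<in> A x" "s \<in> A y" using e by (auto simp: r_def s_def intro!: lt)
    then have rs: "r > 0" "s > 0" "(1 / r) *\<^sub>R x \<in> K" "(1 / s) *\<^sub>R y \<in> K" by (auto simp: A_def)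
    have "(r / (r + s)) *\<^sub>R ((1 / r) *\<^sub>R x) + (s / (r + s)) *\<^sub>R ((1 / s) *\<^sub>R y) \<in> K"
      using rs by (intro convexD[OF K(2)]) (auto simp: add_divide_distrib[symmetric])
    then have "r + s \<in> A (x + y)" using rs by (simp add: A_def scaleR_add_right)
    then show "N (x + y) \<le> N x + N y + e" using le by (fastforce simp: r_def s_def)
  qed
  have scale_le: "N (r *\<^sub>R x) \<le> r * N x" if r: "r > 0" for r x
  proof -
    have "N (r *\<^sub>R x) / r \<le> N x"
    proof (rule dense_ge)
      fix a assume "N x < a"
      then have "a > 0" "(1 / a) *\<^sub>R x \<in> K" using lt by (auto simp: A_def)
      then have "r * a \<in> A (r *\<^sub>R x)" using r by (simp add: A_def)
      then show "N (r *\<^sub>R x) / r \<le> a" using le r by (simp add: field_simps)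
    qed
    then show ?thesis using r by (simp add: field_simps)
  qed
  have scale: "N (r *\<^sub>R x) = r * N x" if r: "r > 0" for r x
    using scale_le[OF r, of x] scale_le[of "1 / r" "r *\<^sub>R x"] r by (simp add: field_simps)
  have lip: "(1 / \<rho>)-lipschitz_on UNIV (\<lambda>x. - N x)"
  proof (rule lipschitz_onI)
    fix x y
    have "N x \<le> N y + (1 / \<rho>) * norm (x - y)" for x y
      using add[of y "x - y"] upper[of "x - y"] by simp
    from this[of x y] this[of y x] show "dist (- N x) (- N y) \<le> (1 / \<rho>) * dist x y"
      by (simp add: dist_norm norm_minus_commute abs_le_iff)
  qed (use \<rho> in simp)
  have "x \<in> K" if "N x \<le> 1" for x
  proof -
    have "(1 / (1 + 1 / real (Suc j))) *\<^sub>R x \<in> K" for j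
    proof -
      have "1 + 1 / real (Suc j) \<in> A x" using that by (intro lt) (simp add: add_pos_pos le_less_trans)
      then show ?thesis by (simp add: A_def)
    qed
    moreover have "(\<lambda>j. (1 / (1 + 1 / real (Suc j))) *\<^sub>R x) \<longlonglongrightarrow> (1 / (1 + 0)) *\<^sub>R x"
      by (intro tendsto_intros LIMSEQ_Suc[OF lim_1_over_n]) simp
    ultimately show ?thesis
      using closed_sequentially[OF compact_imp_closed[OF K(1)], of "\<lambda>j. (1 / (1 + 1 / real (Suc j))) *\<^sub>R x" "(1 / (1 + 0)) *\<^sub>R x"]
      by simp
  qed
  then have "K = {x. N x \<le> 1}" using le[of 1] by (auto simp: A_def)
  moreover have "gauge_fun N (1 / \<rho>) (1 / R)"
    using lower add scale lip R(1) by unfold_locales auto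
  ultimately show ?thesis using that unfolding N_def by blast
qed

text \<open>Removing the component in \<open>F\<close> leaves the components in the other,
  orthogonal members unchanged, so the independence of two complementary components can be
  iterated.\<close>

lemma nn_integral_std_gauss_prod_proj:
  fixes \<G> :: "'a::euclidean_space set set" and \<phi> :: "'a set \<Rightarrow> 'a \<Rightarrow> ennreal"
  assumes "finite \<G>" "\<And>F. F \<in> \<G> \<Longrightarrow> subspace F" "\<And>F. F \<in> \<G> \<Longrightarrow> \<phi> F \<in> borel_measurable borel"
    and "\<And>F G x y. F \<in> \<G> \<Longrightarrow> G \<in> \<G> \<Longrightarrow> F \<noteq> G \<Longrightarrow> x \<in> F \<Longrightarrow> y \<in> G \<Longrightarrow> x \<bullet> y = 0"
  shows "(\<integral>\<^sup>+y. (\<Prod>F\<in>\<G>. \<phi> F (orth_proj F y)) \<partial>std_gauss) = (\<Prod>F\<in>\<G>. \<integral>\<^sup>+y. \<phi> F (orth_proj F y) \<partial>std_gauss)"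
  using assms
proof (induction \<G> rule: finite_induct)
  case empty
  then show ?case using std_gauss.emeasure_space_1[where 'a='a] by simp
next
  case (insert F \<G>)
  have F: "subspace F" by (rule insert.prems(1)) simp
  have GP: "orth_proj G (y - orth_proj F y) = orth_proj G y" if G: "G \<in> \<G>" for G y
  proof -
    have sG: "subspace G" using insert.prems(1) G by simp
    have "orth_proj F y \<in> G\<^sup>\<bottom>"
      unfolding orthogonal_comp_def orthogonal_def
      using insert.prems(3)[of G F] insert.hyps G orth_proj_in[OF F, of y] by auto
    then show ?thesis
      using orth_proj_eq_0[OF sG] by (simp add: linear_diff[OF linear_orth_proj[OF sG]])
  qed
  define \<psi> where "\<psi> z = (\<Prod>G\<in>\<G>. \<phi> G (orth_proj G z))" for z
  have [measurable]: "\<psi> \<in> borel_measurable borel"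
    unfolding \<psi>_def
  proof (rule borel_measurable_prod_ennreal)
    fix G assume "G \<in> \<G>"
    then show "(\<lambda>z. \<phi> G (orth_proj G z)) \<in> borel_measurable borel"
      using measurable_compose[OF borel_measurable_orth_proj[OF insert.prems(1)] insert.prems(2), of G G] by simp
  qed
  have \<psi>: "\<psi> (y - orth_proj F y) = \<psi> y" for y
    unfolding \<psi>_def using GP by (intro prod.cong) auto
  have "(\<integral>\<^sup>+y. (\<Prod>G\<in>insert F \<G>. \<phi> G (orth_proj G y)) \<partial>std_gauss) = (\<integral>\<^sup>+y. \<phi> F (orth_proj F y) * \<psi> (y - orth_proj F y) \<partial>std_gauss)"
    using insert.hyps by (simp add: \<psi>) (simp add: \<psi>_def)
  also have "\<dots> = (\<integral>\<^sup>+y. \<phi> F (orth_proj F y) \<partial>std_gauss) * (\<integral>\<^sup>+y. \<psi> (y - orth_proj F y) \<partial>std_gauss)"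
    by (rule nn_integral_std_gauss_indep[OF F insert.prems(2)]) auto
  also have "(\<integral>\<^sup>+y. \<psi> (y - orth_proj F y) \<partial>std_gauss) = (\<Prod>G\<in>\<G>. \<integral>\<^sup>+y. \<phi> G (orth_proj G y) \<partial>std_gauss)"
    unfolding \<psi> unfolding \<psi>_def
  proof (rule insert.IH)
    show "x \<bullet> y = 0" if "G \<in> \<G>" "H \<in> \<G>" "G \<noteq> H" "x \<in> G" "y \<in> H" for G H x y
      using insert.prems(3)[of G H x y] that by simp
  qed (use insert.prems(1,2) in auto)
  finally show ?case using insert.hyps by simp
qed

context gauge_fun
begin

lemma heatvol_prod:
  assumes \<G>: "finite \<G>" "\<And>F. F \<in> \<G> \<Longrightarrow> subspace F"
    and orth: "\<And>F G x y. F \<in> \<G> \<Longrightarrow> G \<in> \<G> \<Longrightarrow> F \<noteq> G \<Longrightarrow> x \<in> F \<Longrightarrow> y \<in> G \<Longrightarrow> x \<bullet> y = 0"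
    and E: "subspace E" and sum: "\<And>x. N (orth_proj E x) = (\<Sum>F\<in>\<G>. N (orth_proj F x))" and t: "t \<ge> 0"
  shows "heatvol E t = (\<Prod>F\<in>\<G>. heatvol F t)"
proof -
  have hv: "ennreal (heatvol F t) = (\<integral>\<^sup>+y. ennreal (exp (- N (sqrt t *\<^sub>R orth_proj F y))) \<partial>std_gauss)"
    if F: "subspace F" for F
    unfolding heatvol_def lip.nn_exp_lheat[OF lip_proj[OF F] t]
    by (simp add: linear_scale[OF linear_orth_proj[OF F]])
  have "ennreal (heatvol E t) = (\<integral>\<^sup>+y. (\<Prod>F\<in>\<G>. ennreal (exp (- N (sqrt t *\<^sub>R orth_proj F y)))) \<partial>std_gauss)"
    unfolding hv[OF E]
  proof (rule nn_integral_cong)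
    fix y
    have "N (sqrt t *\<^sub>R orth_proj E y) = (\<Sum>F\<in>\<G>. N (sqrt t *\<^sub>R orth_proj F y))"
      using t by (simp add: N_scale0 sum sum_distrib_left)
    then show "ennreal (exp (- N (sqrt t *\<^sub>R orth_proj E y))) = (\<Prod>F\<in>\<G>. ennreal (exp (- N (sqrt t *\<^sub>R orth_proj F y))))"
      using \<G>(1) by (simp add: prod_ennreal exp_sum sum_negf[symmetric])
  qed
  also have "\<dots> = (\<Prod>F\<in>\<G>. \<integral>\<^sup>+y. ennreal (exp (- N (sqrt t *\<^sub>R orth_proj F y))) \<partial>std_gauss)"
    by (rule nn_integral_std_gauss_prod_proj[where \<phi>="\<lambda>_ z. ennreal (exp (- N (sqrt t *\<^sub>R z)))", OF \<G> _ orth]) auto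
  also have "\<dots> = (\<Prod>F\<in>\<G>. ennreal (heatvol F t))"
    using hv \<G>(2) by (intro prod.cong) auto
  also have "\<dots> = ennreal (\<Prod>F\<in>\<G>. heatvol F t)" by (rule prod_ennreal) (simp add: heatvol_def)
  finally show ?thesis
    by (subst (asm) ennreal_inj) (auto simp: heatvol_def intro!: prod_nonneg)
qed

end

section \<open>Independent subspaces and the structure of the body\<close>

context gauge_frame
begin

definition indep :: "'a set set" where
  "indep = {F. 1 \<le> dim F \<and> (\<exists>E0. (\<forall>i\<in>I. E0 i = E i \<or> E0 i = (E i)\<^sup>\<bottom>) \<and> F = (\<Inter>i\<in>I. E0 i))}"

text \<open>Each such intersection is determined by the set \<open>J\<close> of indices at which
  \<open>E i\<close> itself is taken.\<close>

lemma finite_indep: "finite indep"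
proof (rule finite_subset)
  show "indep \<subseteq> (\<lambda>J. \<Inter>i\<in>I. if i \<in> J then E i else (E i)\<^sup>\<bottom>) ` Pow I"
  proof
    fix F assume "F \<in> indep"
    then obtain E0 where E0: "\<forall>i\<in>I. E0 i = E i \<or> E0 i = (E i)\<^sup>\<bottom>" "F = (\<Inter>i\<in>I. E0 i)"
      by (auto simp: indep_def)
    have "F = (\<Inter>i\<in>I. if i \<in> {i\<in>I. E0 i = E i} then E i else (E i)\<^sup>\<bottom>)"
      unfolding E0(2) using E0(1) by (intro INF_cong) auto
    then show "F \<in> (\<lambda>J. \<Inter>i\<in>I. if i \<in> J then E i else (E i)\<^sup>\<bottom>) ` Pow I" by blast
  qed
qed (use finI in simp)

lemma indep_cases:
  assumes "F \<in> indep" "i \<in> I"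
  shows "F \<subseteq> E i \<or> F \<subseteq> (E i)\<^sup>\<bottom>"
  using assms by (fastforce simp: indep_def)

lemma subspace_indep:
  assumes "F \<in> indep"
  shows "subspace F"
proof -
  obtain E0 where E0: "\<forall>i\<in>I. E0 i = E i \<or> E0 i = (E i)\<^sup>\<bottom>" "F = (\<Inter>i\<in>I. E0 i)"
    using assms by (auto simp: indep_def)
  have "subspace (E0 i)" if "i \<in> I" for i
    using E0(1) that subE subspace_orthogonal_comp by metis
  then show ?thesis unfolding E0(2) by (intro subspace_Inter) auto
qed

lemma indep_nonzero:
  assumes "F \<in> indep"
  obtains x where "x \<in> F" "x \<noteq> 0"
  using assms dim_eq_0[of F] by (fastforce simp: indep_def)

text \<open>Different intersections differ in some factor, where one takes \<open>E i\<close> and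
  the other its complement.\<close>

lemma indep_orthogonal:
  assumes F: "F \<in> indep" and G: "G \<in> indep" and ne: "F \<noteq> G" and x: "x \<in> F" and y: "y \<in> G"
  shows "x \<bullet> y = 0"
proof -
  obtain E0 where E0: "\<forall>i\<in>I. E0 i = E i \<or> E0 i = (E i)\<^sup>\<bottom>" "F = (\<Inter>i\<in>I. E0 i)"
    using F by (auto simp: indep_def)
  obtain E1 where E1: "\<forall>i\<in>I. E1 i = E i \<or> E1 i = (E i)\<^sup>\<bottom>" "G = (\<Inter>i\<in>I. E1 i)"
    using G by (auto simp: indep_def)
  obtain i where i: "i \<in> I" "E0 i \<noteq> E1 i"
    using ne unfolding E0(2) E1(2) by (metis INF_cong)
  have "x \<in> E0 i" "y \<in> E1 i" using x y i(1) by (auto simp: E0(2) E1(2))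
  then show ?thesis
    using E0(1) E1(1) i orth_comp_inner orth_comp_inner' by metis
qed

lemma orth_proj_other:
  assumes F: "F \<in> indep" and G: "G \<in> indep" and ne: "F \<noteq> G" and x: "x \<in> F"
  shows "orth_proj G x = 0"
proof (rule orth_proj_eq_0[OF subspace_indep[OF G]])
  show "x \<in> G\<^sup>\<bottom>"
    using indep_orthogonal[OF G F] ne x by (auto simp: orthogonal_comp_def orthogonal_def)
qed

lemma orth_proj_indep:
  assumes F: "F \<in> indep" and G: "G \<in> indep" and x: "x \<in> F"
  shows "orth_proj G x = (if F = G then x else 0)"
  using orth_proj_other[OF F G _ x] orth_proj_id[OF subspace_indep[OF F] x] by auto

lemma orth_proj_sum_indep:
  assumes f: "\<And>F. F \<in> indep \<Longrightarrow> f F \<in> F" and G: "G \<in> indep"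
  shows "orth_proj G (\<Sum>F\<in>indep. f F) = f G"
proof -
  have "orth_proj G (\<Sum>F\<in>indep. f F) = (\<Sum>F\<in>indep. if F = G then f F else 0)"
    using orth_proj_indep[OF _ G f] by (simp add: linear_sum[OF linear_orth_proj[OF subspace_indep[OF G]]])
  then show ?thesis using G finite_indep by simp
qed

text \<open>The members are mutually orthogonal, so the summands of a decomposition are its
  projections: uniqueness is automatic and only spanning has content.\<close>

lemma is_direct_sum_indep_iff: "is_direct_sum indep UNIV \<longleftrightarrow> (\<forall>x. (\<Sum>F\<in>indep. orth_proj F x) = x)"
proof
  assume "is_direct_sum indep UNIV"
  then have bij: "bij_betw (\<lambda>f. \<Sum>F\<in>indep. f F) (\<Pi>\<^sub>E F\<in>indep. F) UNIV" by (simp add: is_direct_sum_def)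
  show "\<forall>x. (\<Sum>F\<in>indep. orth_proj F x) = x"
  proof
    fix x :: 'a
    obtain f where f: "f \<in> (\<Pi>\<^sub>E F\<in>indep. F)" "x = (\<Sum>F\<in>indep. f F)"
      using bij unfolding bij_betw_def by (metis UNIV_I imageE)
    have "f F \<in> F" if "F \<in> indep" for F using f(1) that by (auto simp: PiE_iff)
    then show "(\<Sum>F\<in>indep. orth_proj F x) = x"
      unfolding f(2) using orth_proj_sum_indep[of f] by (intro sum.cong) auto
  qed
next
  assume *: "\<forall>x. (\<Sum>F\<in>indep. orth_proj F x) = x"
  have "inj_on (\<lambda>f. \<Sum>F\<in>indep. f F) (\<Pi>\<^sub>E F\<in>indep. F)"
  proof (rule inj_onI)
    fix f g assume f: "f \<in> (\<Pi>\<^sub>E F\<in>indep. F)" and g: "g \<in> (\<Pi>\<^sub>E F\<in>indep. F)"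
      and eq: "(\<Sum>F\<in>indep. f F) = (\<Sum>F\<in>indep. g F)"
    show "f = g"
    proof (rule PiE_ext[OF f g])
      fix F assume "F \<in> indep"
      then show "f F = g F"
        using orth_proj_sum_indep[of f F] orth_proj_sum_indep[of g F] f g eq by (simp add: PiE_iff)
    qed
  qed
  moreover have "x \<in> (\<lambda>f. \<Sum>F\<in>indep. f F) ` (\<Pi>\<^sub>E F\<in>indep. F)" for x
  proof
    show "x = (\<Sum>F\<in>indep. (\<lambda>F\<in>indep. orth_proj F x) F)" using * by simp
    show "(\<lambda>F\<in>indep. orth_proj F x) \<in> (\<Pi>\<^sub>E F\<in>indep. F)"
      using orth_proj_in[OF subspace_indep] by auto
  qed
  ultimately show "is_direct_sum indep UNIV"
    using finite_indep by (auto simp: is_direct_sum_def bij_betw_def)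
qed

text \<open>Along \<open>(1 + s * N w) e + (1 - s * N e) w\<close> the gauge is constant, so a point with two nonzero
  components is not extreme.\<close>

lemma extreme_point_split:
  assumes K: "K = {x. N x \<le> 1}" and split: "\<And>e w. e \<in> F\<^sup>\<bottom> \<Longrightarrow> w \<in> F \<Longrightarrow> N (e + w) = N e + N w"
    and F: "subspace F" and x: "x extreme_point_of K"
  shows "x \<in> F \<or> x \<in> F\<^sup>\<bottom>"
proof (rule ccontr)
  assume neg: "\<not> (x \<in> F \<or> x \<in> F\<^sup>\<bottom>)"
  define w e where "w = orth_proj F x" and "e = x - w"
  have wF: "w \<in> F" and eF: "e \<in> F\<^sup>\<bottom>" and xew: "x = e + w"
    using orth_proj_in[OF F] orth_proj_diff_in[OF F] by (auto simp: w_def e_def)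
  have w0: "w \<noteq> 0" and e0: "e \<noteq> 0" using neg wF eF by (auto simp: xew)
  have pos: "N y > 0" if "y \<noteq> 0" for y
    using N_ge[of y] mpos that by (meson less_le_trans mult_pos_pos zero_less_norm_iff)
  define \<alpha> \<beta> where "\<alpha> = N e" and "\<beta> = N w"
  have \<alpha>: "\<alpha> > 0" and \<beta>: "\<beta> > 0" using pos w0 e0 by (auto simp: \<alpha>_def \<beta>_def)
  \<comment> \<open>Small enough to keep \<open>1 - s * \<alpha>\<close> and
    \<open>1 - s * \<beta>\<close> nonnegative, as \<open>inK\<close> requires.\<close>
  define s where "s = 1 / (\<alpha> + \<beta>)"
  have s: "s > 0" "s * \<alpha> \<le> 1" "s * \<beta> \<le> 1" using \<alpha> \<beta> by (auto simp: s_def divide_simps)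
  have le1: "\<alpha> + \<beta> \<le> 1"
    using x split[OF eF wF] by (simp add: extreme_point_of_def K xew \<alpha>_def \<beta>_def)
  define a b where "a = (1 + s * \<beta>) *\<^sub>R e + (1 - s * \<alpha>) *\<^sub>R w" and "b = (1 - s * \<beta>) *\<^sub>R e + (1 + s * \<alpha>) *\<^sub>R w"
  have inK: "p *\<^sub>R e + q *\<^sub>R w \<in> K" if "p \<ge> 0" "q \<ge> 0" "p * \<alpha> + q * \<beta> = \<alpha> + \<beta>" for p q
  proof -
    have "N (p *\<^sub>R e + q *\<^sub>R w) = p * \<alpha> + q * \<beta>"
      using that split[of "p *\<^sub>R e" "q *\<^sub>R w"] subspace_scale[OF F wF] subspace_scale[OF subspace_orthogonal_comp eF]
      by (simp add: N_scale0 \<alpha>_def \<beta>_def)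
    then show ?thesis using le1 that(3) by (simp add: K)
  qed
  have "a \<in> K" unfolding a_def using s \<alpha> \<beta> by (intro inK) (auto simp: algebra_simps)
  moreover have "b \<in> K" unfolding b_def using s \<alpha> \<beta> by (intro inK) (auto simp: algebra_simps)
  moreover have "x = midpoint a b"
  proof -
    have "a + b = x + x" by (simp add: a_def b_def xew algebra_simps)
    then show ?thesis by (simp add: midpoint_def flip: scaleR_2)
  qed
  moreover have "a \<noteq> b"
  proof
    assume "a = b"
    then have "a \<bullet> e = b \<bullet> e" by simp
    then have "(1 + s * \<beta>) * (e \<bullet> e) = (1 - s * \<beta>) * (e \<bullet> e)"
      using orth_comp_inner[OF wF eF] by (simp add: a_def b_def inner_add_left)
    then have "2 * (s * \<beta>) * (e \<bullet> e) = 0" by (simp add: algebra_simps)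
    then show False using s \<beta> e0 by simp
  qed
  ultimately show False
    using x midpoint_in_open_segment by (fastforce simp: extreme_point_of_def)
qed

lemma split_imp_structure:
  assumes K: "K = {x. N x \<le> 1}" "compact K" "convex K"
    and split: "\<And>i e w. i \<in> I \<Longrightarrow> e \<in> (E i)\<^sup>\<bottom> \<Longrightarrow> w \<in> E i \<Longrightarrow> N (e + w) = N e + N w"
  shows "is_direct_sum indep UNIV \<and> K = convex hull (\<Union>F\<in>indep. K \<inter> F)"
proof -
  have ext: "x \<in> (\<Union>F\<in>indep. K \<inter> F)" if x: "x extreme_point_of K" for x
  proof -
    define E0 where "E0 i = (if x \<in> E i then E i else (E i)\<^sup>\<bottom>)" for i
    define F where "F = (\<Inter>i\<in>I. E0 i)"
    have "x \<in> E i \<or> x \<in> (E i)\<^sup>\<bottom>" if i: "i \<in> I" for i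
      by (rule extreme_point_split[OF K(1) split[OF i] subE[OF i] x])
    then have xF: "x \<in> F" unfolding F_def E0_def by auto
    \<comment> \<open>Otherwise \<open>F\<close> could have dimension 0. The origin is not extreme,
      being the midpoint of two opposite points of \<open>K\<close>; the scale \<open>r\<close>
      below brings both a basis vector and its negative into \<open>K\<close>.\<close>
    have "x \<noteq> 0"
    proof
      assume x0: "x = 0"
      obtain b :: 'a where b: "b \<in> Basis" using nonempty_Basis by blast
      define r where "r = 1 / (1 + N b + N (- b))"
      have r: "r > 0" unfolding r_def using N_nonneg[of b] N_nonneg[of "- b"] by simp
      have "r * N b \<le> 1" "r * N (- b) \<le> 1"
        unfolding r_def using N_nonneg[of b] N_nonneg[of "- b"] by (auto simp: divide_simps)
      then have "r *\<^sub>R b \<in> K" "r *\<^sub>R (- b) \<in> K" using r by (auto simp only: K(1) N_scale mem_Collect_eq)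
      moreover have "r *\<^sub>R b \<noteq> r *\<^sub>R (- b)"
      proof
        assume "r *\<^sub>R b = r *\<^sub>R (- b)"
        then have "r *\<^sub>R b + r *\<^sub>R b = 0" by (simp add: eq_neg_iff_add_eq_0)
        then have "(2 * r) *\<^sub>R b = 0" by (simp add: scaleR_add_left[symmetric])
        then show False using r b nonzero_Basis by auto
      qed
      moreover have "x = midpoint (r *\<^sub>R b) (r *\<^sub>R (- b))" by (simp add: midpoint_def x0)
      ultimately show False
        using x midpoint_in_open_segment by (fastforce simp: extreme_point_of_def)
    qed
    then have "dim F \<noteq> 0" using xF by (auto simp: dim_eq_0)
    then have "1 \<le> dim F" by linarith
    moreover have "\<forall>i\<in>I. E0 i = E i \<or> E0 i = (E i)\<^sup>\<bottom>" by (simp add: E0_def)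
    ultimately have "F \<in> indep" unfolding indep_def mem_Collect_eq using F_def by blast
    moreover have "x \<in> K" using x by (simp add: extreme_point_of_def)
    ultimately show ?thesis using xF by blast
  qed
  have hull: "K = convex hull (\<Union>F\<in>indep. K \<inter> F)"
  proof
    have "{x. x extreme_point_of K} \<subseteq> (\<Union>F\<in>indep. K \<inter> F)"
      using ext by blast
    then have "convex hull {x. x extreme_point_of K} \<subseteq> convex hull (\<Union>F\<in>indep. K \<inter> F)"
      by (rule hull_mono)
    then show "K \<subseteq> convex hull (\<Union>F\<in>indep. K \<inter> F)"
      using equalityD1[OF Krein_Milman_Minkowski[OF K(2,3)]] by (rule order_trans[rotated])
    show "convex hull (\<Union>F\<in>indep. K \<inter> F) \<subseteq> K"
      by (intro hull_minimal K(3)) auto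
  qed
  \<comment> \<open>\<open>T\<close> fixes every piece of the hull, hence all of \<open>K\<close>.
    As \<open>K\<close> contains a positive multiple of each vector, \<open>T\<close> is the
    identity, which is the criterion for the direct sum.\<close>
  define T where "T x = (\<Sum>F\<in>indep. orth_proj F x)" for x
  have linT: "linear T"
    unfolding T_def by (intro linear_compose_sum ballI linear_orth_proj subspace_indep)
  have "K \<subseteq> {x. T x = x}"
  proof -
    have "convex {x. T x = x}"
      by (intro subspace_imp_convex) (auto simp: subspace_def linear_0[OF linT] linear_add[OF linT] linear_scale[OF linT])
    moreover have "(\<Union>F\<in>indep. K \<inter> F) \<subseteq> {x. T x = x}"
    proof safe
      fix F x assume F: "F \<in> indep" and x: "x \<in> F"
      have "T x = (\<Sum>G\<in>indep. if F = G then x else 0)"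
        unfolding T_def using orth_proj_indep[OF F _ x] by (intro sum.cong) auto
      then show "T x = x" using F finite_indep by simp
    qed
    ultimately have "convex hull (\<Union>F\<in>indep. K \<inter> F) \<subseteq> {x. T x = x}" by (intro hull_minimal)
    then show ?thesis using equalityD1[OF hull] by (rule order_trans[rotated])
  qed
  moreover have "T x = x" if "K \<subseteq> {x. T x = x}" for x
  proof -
    define r where "r = 1 / (1 + N x)"
    have r: "r > 0" "r * N x \<le> 1" unfolding r_def using N_nonneg[of x] by (auto simp: divide_simps)
    then have "r *\<^sub>R x \<in> K" by (simp add: K(1) N_scale)
    then have "r *\<^sub>R T x = r *\<^sub>R x" using that linear_scale[OF linT, of r x] by auto
    then show ?thesis using r by simp
  qed
  ultimately have "is_direct_sum indep UNIV"
    unfolding is_direct_sum_indep_iff T_def by blast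
  with hull show ?thesis by blast
qed

text \<open>The sum \<open>g\<close> on the right is sublinear, and its unit level set is convex and
  contains each \<open>K \<inter> F\<close>, hence \<open>K\<close>; by homogeneity
  \<open>g \<le> N\<close>. The other inequality is subadditivity of \<open>N\<close>.\<close>

lemma structure_imp_N_sum:
  assumes K: "K = {x. N x \<le> 1}" and sum: "\<And>x. (\<Sum>F\<in>indep. orth_proj F x) = x"
    and hull: "K = convex hull (\<Union>F\<in>indep. K \<inter> F)"
  shows "N x = (\<Sum>F\<in>indep. N (orth_proj F x))"
proof -
  define g where "g x = (\<Sum>F\<in>indep. N (orth_proj F x))" for x
  have gadd: "g (x + y) \<le> g x + g y" for x y
    unfolding g_def sum.distrib[symmetric]
    using N_add by (intro sum_mono) (simp add: linear_add[OF linear_orth_proj[OF subspace_indep]])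
  have gscale: "g (r *\<^sub>R x) = r * g x" if "r \<ge> 0" for r x
    unfolding g_def sum_distrib_left
    using that by (intro sum.cong refl) (simp add: linear_scale[OF linear_orth_proj[OF subspace_indep]] N_scale0)
  have "convex {x. g x \<le> 1}"
  proof (rule convexI)
    fix x y and p q :: real assume *: "x \<in> {x. g x \<le> 1}" "y \<in> {x. g x \<le> 1}" "0 \<le> p" "0 \<le> q" "p + q = 1"
    have "g (p *\<^sub>R x + q *\<^sub>R y) \<le> p * g x + q * g y" using gadd[of "p *\<^sub>R x" "q *\<^sub>R y"] * by (simp add: gscale)
    also have "\<dots> \<le> p * 1 + q * 1" using * by (intro add_mono mult_left_mono) auto
    finally show "p *\<^sub>R x + q *\<^sub>R y \<in> {x. g x \<le> 1}" using * by simp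
  qed
  moreover have "(\<Union>F\<in>indep. K \<inter> F) \<subseteq> {x. g x \<le> 1}"
  proof safe
    fix F x assume F: "F \<in> indep" and x: "x \<in> F" "x \<in> K"
    have "g x = (\<Sum>G\<in>indep. if F = G then N x else 0)"
      unfolding g_def using orth_proj_indep[OF F _ x(1)] by (intro sum.cong) auto
    then show "g x \<le> 1" using F finite_indep x(2) by (simp add: K)
  qed
  ultimately have "convex hull (\<Union>F\<in>indep. K \<inter> F) \<subseteq> {x. g x \<le> 1}" by (intro hull_minimal)
  then have "K \<subseteq> {x. g x \<le> 1}" using equalityD1[OF hull] by (rule order_trans[rotated])
  then have sub: "g x \<le> 1" if "N x \<le> 1" for x using that by (auto simp: K)
  have "g x \<le> N x"
  proof (cases "x = 0")
    case True
    then show ?thesis using gscale[of 0 0] by simp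
  next
    case False
    then have pos: "N x > 0"
      using N_ge[of x] mpos by (meson less_le_trans mult_pos_pos zero_less_norm_iff)
    have "g ((1 / N x) *\<^sub>R x) \<le> 1" using pos by (intro sub) (simp add: N_scale)
    then show ?thesis using pos gscale[of "1 / N x" x] by (simp add: field_simps)
  qed
  moreover have "N x \<le> g x"
    using N_sum[OF finite_indep, of "\<lambda>F. orth_proj F x"] sum[of x] by (simp add: g_def)
  ultimately show ?thesis by (simp add: g_def)
qed

text \<open>By the splitting of \<open>N\<close>, the flows at the origin for the whole space and
  for each \<open>E i\<close> are products over independent subspaces. In the product over
  \<open>i\<close> a subspace \<open>F\<close> gets the sum of those \<open>c i\<close> with
  \<open>F \<subseteq> E i\<close> as its exponent, and this sum is 1. So both sides agree at every
  positive time, and hence in the limit.\<close>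

lemma structure_imp_equality:
  assumes K: "K = {x. N x \<le> 1}" and ds: "is_direct_sum indep UNIV"
    and hull: "K = convex hull (\<Union>F\<in>indep. K \<inter> F)"
  shows "vol UNIV = (\<Prod>i\<in>I. vol (E i) powr c i)"
proof -
  have sum: "(\<Sum>F\<in>indep. orth_proj F x) = x" for x using ds by (simp add: is_direct_sum_indep_iff)
  note Nsum = structure_imp_N_sum[OF K sum hull]
  define D where "D i = {F \<in> indep. F \<subseteq> E i}" for i
  have PP: "orth_proj F (orth_proj (E i) x) = (if F \<in> D i then orth_proj F x else 0)" if F: "F \<in> indep" and i: "i \<in> I" for F i x
  proof (cases "F \<subseteq> E i")
    case True
    have "x - orth_proj (E i) x \<in> F\<^sup>\<bottom>"
      using orth_proj_diff_in[OF subE[OF i], of x] orthogonal_comp_anti_mono[OF True] by auto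
    then have "orth_proj F (x - orth_proj (E i) x) = 0" by (rule orth_proj_eq_0[OF subspace_indep[OF F]])
    then show ?thesis using True F by (simp add: D_def linear_diff[OF linear_orth_proj[OF subspace_indep[OF F]]])
  next
    case False
    then have "F \<subseteq> (E i)\<^sup>\<bottom>" using indep_cases[OF F i] by blast
    then have "orth_proj (E i) x \<in> F\<^sup>\<bottom>"
      using orth_proj_in[OF subE[OF i], of x] unfolding orthogonal_comp_def orthogonal_def by (auto simp: inner_commute)
    then show ?thesis using False orth_proj_eq_0[OF subspace_indep[OF F]] by (simp add: D_def)
  qed
  have NE: "N (orth_proj (E i) x) = (\<Sum>F\<in>D i. N (orth_proj F x))" if i: "i \<in> I" for i x
  proof -
    have "N (orth_proj (E i) x) = (\<Sum>F\<in>indep. if F \<in> D i then N (orth_proj F x) else 0)"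
      unfolding Nsum[of "orth_proj (E i) x"] using PP[OF _ i] by (intro sum.cong) auto
    also have "\<dots> = (\<Sum>F\<in>D i. N (orth_proj F x))"
      using finite_indep by (subst sum.inter_restrict[symmetric]) (auto simp: D_def intro!: sum.cong)
    finally show ?thesis .
  qed
  have hvU: "heatvol UNIV t = (\<Prod>F\<in>indep. heatvol F t)" if "t \<ge> 0" for t
  proof (rule heatvol_prod[OF finite_indep subspace_indep indep_orthogonal subspace_UNIV _ that])
    show "N (orth_proj UNIV x) = (\<Sum>F\<in>indep. N (orth_proj F x))" for x
      unfolding orth_proj_UNIV by (rule Nsum)
  qed
  have hvE: "heatvol (E i) t = (\<Prod>F\<in>D i. heatvol F t)" if "t \<ge> 0" "i \<in> I" for t i
  proof (rule heatvol_prod[OF _ _ _ subE[OF that(2)] NE[OF that(2)] that(1)])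
    show "finite (D i)" using finite_indep by (simp add: D_def)
    show "subspace F" if "F \<in> D i" for F using that subspace_indep by (simp add: D_def)
    show "x \<bullet> y = 0" if "F \<in> D i" "G \<in> D i" "F \<noteq> G" "x \<in> F" "y \<in> G" for F G x y
      using indep_orthogonal[of F G x y] that by (simp add: D_def)
  qed
  \<comment> \<open>Apply the decomposition of the identity to a nonzero vector of \<open>F\<close>,
    which each projection either keeps or kills.\<close>
  have csum: "(\<Sum>i\<in>{i\<in>I. F \<in> D i}. c i) = 1" if F: "F \<in> indep" for F
  proof -
    obtain x where x: "x \<in> F" "x \<noteq> 0" by (rule indep_nonzero[OF F])
    have "x = (\<Sum>i\<in>I. c i *\<^sub>R orth_proj (E i) x)" by (simp add: frame)
    also have "\<dots> = (\<Sum>i\<in>I. (if F \<in> D i then c i else 0) *\<^sub>R x)"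
    proof (intro sum.cong refl)
      fix i assume i: "i \<in> I"
      show "c i *\<^sub>R orth_proj (E i) x = (if F \<in> D i then c i else 0) *\<^sub>R x"
      proof (cases "F \<subseteq> E i")
        case True
        then show ?thesis using x F orth_proj_id[OF subE[OF i], of x] by (auto simp: D_def)
      next
        case False
        then have "x \<in> (E i)\<^sup>\<bottom>" using indep_cases[OF F i] x by blast
        then show ?thesis using False orth_proj_eq_0[OF subE[OF i]] by (auto simp: D_def)
      qed
    qed
    also have "\<dots> = (\<Sum>i\<in>{i\<in>I. F \<in> D i}. c i) *\<^sub>R x"
      using finI by (simp add: scaleR_sum_left[symmetric] sum.inter_filter)
    finally have "(1 - (\<Sum>i\<in>{i\<in>I. F \<in> D i}. c i)) *\<^sub>R x = 0" by (simp add: algebra_simps)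
    then show ?thesis using x by simp
  qed
  have prod: "(\<Prod>i\<in>I. (r ^ dim (E i) * heatvol (E i) t) powr c i) = r ^ DIM('a) * heatvol UNIV t"
    if t: "t \<ge> 0" and r: "r > 0" for t r
  proof -
    have hv0: "heatvol F t > 0" and hv1: "heatvol F t \<noteq> 0" for F by (simp_all add: heatvol_def)
    \<comment> \<open>Logarithms turn the powers over \<open>i\<close> and the products over
      \<open>D i\<close> into a double sum, whose order is exchanged below to bring in
      \<open>csum\<close>.\<close>
    have "ln (\<Prod>i\<in>I. (r ^ dim (E i) * heatvol (E i) t) powr c i) = (\<Sum>i\<in>I. c i * (real (dim (E i)) * ln r + (\<Sum>F\<in>D i. ln (heatvol F t))))"
    proof -
      have "ln (\<Prod>i\<in>I. (r ^ dim (E i) * heatvol (E i) t) powr c i) = (\<Sum>i\<in>I. c i * ln (r ^ dim (E i) * heatvol (E i) t))"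
        using finI r hv0 by (subst ln_prod) (auto simp: ln_powr powr_gt_zero less_imp_neq[symmetric])
      also have "\<dots> = (\<Sum>i\<in>I. c i * (real (dim (E i)) * ln r + (\<Sum>F\<in>D i. ln (heatvol F t))))"
      proof (intro sum.cong refl)
        fix i assume i: "i \<in> I"
        have "finite (D i)" using finite_indep by (simp add: D_def)
        then have "ln (heatvol (E i) t) = (\<Sum>F\<in>D i. ln (heatvol F t))"
          unfolding hvE[OF t i] using hv1 by (intro ln_prod) auto
        then show "c i * ln (r ^ dim (E i) * heatvol (E i) t) = c i * (real (dim (E i)) * ln r + (\<Sum>F\<in>D i. ln (heatvol F t)))"
          using r hv0[of "E i"] by (simp add: ln_mult ln_realpow)
      qed
      finally show ?thesis .
    qed
    also have "\<dots> = (\<Sum>i\<in>I. c i * real (dim (E i))) * ln r + (\<Sum>i\<in>I. \<Sum>F\<in>indep. if F \<in> D i then c i * ln (heatvol F t) else 0)"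
    proof -
      have "(\<Sum>F\<in>indep. if F \<in> D i then c i * ln (heatvol F t) else 0) = c i * (\<Sum>F\<in>D i. ln (heatvol F t))" for i
        unfolding sum_distrib_left using finite_indep
        by (subst sum.inter_restrict[symmetric]) (auto simp: D_def intro!: sum.cong)
      then show ?thesis by (simp add: distrib_left sum.distrib sum_distrib_right mult.assoc)
    qed
    also have "(\<Sum>i\<in>I. \<Sum>F\<in>indep. if F \<in> D i then c i * ln (heatvol F t) else 0) = (\<Sum>F\<in>indep. (\<Sum>i\<in>{i\<in>I. F \<in> D i}. c i) * ln (heatvol F t))"
      unfolding sum_distrib_right using finI by (subst sum.swap) (simp add: sum.inter_filter)
    also have "\<dots> = (\<Sum>F\<in>indep. ln (heatvol F t))" by (simp add: csum)
    also have "\<dots> = ln (heatvol UNIV t)"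
      unfolding hvU[OF t] using finite_indep hv1 by (subst ln_prod) auto
    also have "(\<Sum>i\<in>I. c i * real (dim (E i))) * ln r + ln (heatvol UNIV t) = ln (r ^ DIM('a) * heatvol UNIV t)"
      using r hv0[of UNIV] by (simp add: sum_dim ln_mult ln_realpow)
    finally show ?thesis
      using r hv0 by (subst (asm) ln_inj_iff) (auto intro!: prod_pos simp: powr_gt_zero less_imp_neq[symmetric])
  qed
  have lim1: "((\<lambda>s. \<Prod>i\<in>I. (sqrt (2 * pi * s) ^ dim (E i) * heatvol (E i) s) powr c i) \<longlongrightarrow> (\<Prod>i\<in>I. vol (E i) powr c i)) at_top"
  proof (intro tendsto_prod tendsto_powr' heatvol_tendsto subE tendsto_const)
    fix i assume "i \<in> I"
    moreover have "\<forall>\<^sub>F s in at_top. 0 \<le> sqrt (2 * pi * s) ^ dim (E i) * heatvol (E i) s"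
      using eventually_ge_at_top[of 0] by eventually_elim (simp add: heatvol_def)
    ultimately show "vol (E i) \<noteq> 0 \<or> 0 < c i \<and> (\<forall>\<^sub>F s in at_top. 0 \<le> sqrt (2 * pi * s) ^ dim (E i) * heatvol (E i) s)"
      using cpos by blast
  qed
  have lim2: "((\<lambda>s. sqrt (2 * pi * s) ^ DIM('a) * heatvol UNIV s) \<longlongrightarrow> vol UNIV) at_top"
    using heatvol_tendsto[OF subspace_UNIV] by simp
  have "\<forall>\<^sub>F s in at_top. (\<Prod>i\<in>I. (sqrt (2 * pi * s) ^ dim (E i) * heatvol (E i) s) powr c i) = sqrt (2 * pi * s) ^ DIM('a) * heatvol UNIV s"
    using eventually_gt_at_top[of 0] by eventually_elim (auto intro!: prod)
  from Lim_transform_eventually[OF lim1 this] show ?thesis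
    by (rule tendsto_unique[OF trivial_limit_at_top_linorder lim2])
qed

end

theorem (in gauge_frame) equality_iff:
  assumes K: "K = {x. N x \<le> 1}" "compact K" "convex K"
  shows "fact DIM('a) * measure lborel K = (\<Prod>i\<in>I. (fact (dim (E i)) * measure (subspace_lborel (E i)) (K \<inter> E i)) powr c i)
    \<longleftrightarrow> is_direct_sum indep UNIV \<and> K = convex hull (\<Union>F\<in>indep. K \<inter> F)"
proof -
  have Kb: "K \<in> sets borel" using K(2) by (rule borel_compact)
  \<comment> \<open>\<open>vol\<close> measures the whole level set \<open>K\<close>; under a
    measure concentrated on \<open>E i\<close> it has the same mass as
    \<open>K \<inter> E i\<close>.\<close>
  have volE: "vol (E i) = fact (dim (E i)) * measure (subspace_lborel (E i)) (K \<inter> E i)" if i: "i \<in> I" for i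
  proof -
    have Eb: "E i \<in> sets borel" using closed_subspace[OF subE[OF i]] by (rule borel_closed)
    have "(\<integral>\<^sup>+x. indicator K x \<partial>subspace_lborel (E i)) = (\<integral>\<^sup>+x. indicator (K \<inter> E i) x \<partial>subspace_lborel (E i))"
      using Kb Eb by (intro nn_integral_subspace_lborel_cong[OF subE[OF i]] borel_measurable_indicator)
        (auto simp: indicator_def)
    then have "emeasure (subspace_lborel (E i)) K = emeasure (subspace_lborel (E i)) (K \<inter> E i)"
      using Kb Eb by simp
    then show ?thesis unfolding vol_def K(1)[symmetric] by (simp add: measure_def)
  qed
  have volU: "vol UNIV = fact DIM('a) * measure lborel K"
    unfolding vol_def K(1)[symmetric] by (simp add: subspace_lborel_UNIV)
  have "fact DIM('a) * measure lborel K = (\<Prod>i\<in>I. (fact (dim (E i)) * measure (subspace_lborel (E i)) (K \<inter> E i)) powr c i)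
    \<longleftrightarrow> vol UNIV = (\<Prod>i\<in>I. vol (E i) powr c i)"
    using volU volE by (simp cong: prod.cong)
  also have "\<dots> \<longleftrightarrow> is_direct_sum indep UNIV \<and> K = convex hull (\<Union>F\<in>indep. K \<inter> F)"
  proof
    assume eq: "vol UNIV = (\<Prod>i\<in>I. vol (E i) powr c i)"
    show "is_direct_sum indep UNIV \<and> K = convex hull (\<Union>F\<in>indep. K \<inter> F)"
      by (rule split_imp_structure[OF K]) (rule equality_imp_split[OF eq])
  qed (use structure_imp_equality[OF K(1)] in blast)
  finally show ?thesis .
qed

theorem theorem6:
  fixes K :: "(real ^ 'n) set"
    and E :: "nat \<Rightarrow> (real ^ 'n) set"
    and c :: "nat \<Rightarrow> real"
    and k :: nat
  assumes "CARD('n) \<ge> 2"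
    and "compact K" and "convex K" and "0 \<in> interior K"
    and "\<And>i. i \<in> {1..k} \<Longrightarrow> subspace (E i)"
    and "\<And>i. i \<in> {1..k} \<Longrightarrow> dim (E i) \<in> {1..CARD('n) - 1}"
    and "\<And>i. i \<in> {1..k} \<Longrightarrow> c i > 0"
    and "\<And>x. (\<Sum>i=1..k. c i *\<^sub>R orth_proj (E i) x) = x"
  shows
    "measure lebesgue K =
       (\<Prod>i=1..k. (fact (dim (E i)) :: real) powr c i) / fact CARD('n) *
       (\<Prod>i=1..k. measure (subspace_lborel (E i)) (K \<inter> E i) powr c i)
     \<longleftrightarrow>
       is_direct_sum {F. independent_subspace k E F} UNIV \<and>
       K = convex hull (\<Union>F\<in>{F. independent_subspace k E F}. K \<inter> F)"
proof -
  obtain L m where g: "gauge_fun (minkowski_gauge K) L m" and K: "K = {x. minkowski_gauge K x \<le> 1}"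
    by (rule gauge_fun_minkowski_gauge[OF assms(2-4)])
  have tf: "tight_frame {1..k} E c"
    using assms(5,7,8) by (rule tight_frame.intro[OF finite_atLeastAtMost])
  have gf: "gauge_frame (minkowski_gauge K) L m {1..k} E c"
    by (rule gauge_frame.intro[OF g tf])
  have Kb: "K \<in> sets lborel" using borel_compact[OF assms(2)] by simp
  have indep: "{F. independent_subspace k E F} = gauge_frame.indep {1..k} E"
    unfolding gauge_frame.indep_def[OF gf] independent_subspace_def ..
  have "measure lebesgue K =
       (\<Prod>i=1..k. (fact (dim (E i)) :: real) powr c i) / fact CARD('n) *
       (\<Prod>i=1..k. measure (subspace_lborel (E i)) (K \<inter> E i) powr c i)
     \<longleftrightarrow> fact DIM(real ^ 'n) * measure lborel K
        = (\<Prod>i=1..k. (fact (dim (E i)) * measure (subspace_lborel (E i)) (K \<inter> E i)) powr c i)"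
    \<comment> \<open>Each power of a product is split into powers, which collects the factorials in
      front, and the factorial in the denominator moves to the left.\<close>
    unfolding measure_completion[OF Kb] by (simp add: powr_mult prod.distrib field_simps)
  also have "\<dots> \<longleftrightarrow> is_direct_sum {F. independent_subspace k E F} UNIV \<and>
       K = convex hull (\<Union>F\<in>{F. independent_subspace k E F}. K \<inter> F)"
    unfolding indep by (rule gauge_frame.equality_iff[OF gf K assms(2,3)])
  finally show ?thesis .
qed

end
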